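(* Let $(F,K,L)$ be a $\sigma$-admissible triple, let $\Phi\in\mathrm{GL}_r(K)$ and let $\Psi\in\mathrm{GL}_r(L)$ be a fundamental matrix for $\Phi$, i.e. $\sigma(\Psi)=\Phi\Psi$. Assume $K$ is algebraically closed in $\Lambda=K(\Psi)$. Fix an extension of $\sigma$ to an automorphism of $\overline{L}$ and let $\mathbf F_n:=\overline{L}^{\sigma^n}$. Suppose that $(\mathbf F_n,\overline{K},\overline{L})$ is $\sigma^n$-admissible for each $n\ge1$ and that $\overline{F}=\bigcup_n\mathbf F_n$. Let $\widetilde\Sigma=\overline{K}[\Psi,1/\det\Psi]\subseteq\overline{L}$ be the coordinate ring of $Z_{\overline{K}}$ and $\widetilde\Lambda$ its fraction field. Then: (a) the subfield of $\widetilde\Lambda$ fixed by $\Gamma(\overline{F})$ is $\overline{K}$; (b) the elements of $\Lambda$ fixed by $\Gamma(\overline{F})$ are precisely the elements of $K$.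
   Context: A triple of fields $F\subseteq K\subseteq L$ with an automorphism $\sigma$ of $L$ is $\sigma$-admissible if $\sigma$ restricts to automorphisms of $F$ and $K$, $F=F^\sigma=K^\sigma=L^\sigma$ (fixed fields), and $L$ is separable over $K$. With $X=(X_{ij})$ an $r\times r$ matrix of variables: $Z=Z_\Psi=\mathrm{Spec}\,K[\Psi,1/\det\Psi]$, the closed $K$-subscheme of $\mathrm{GL}_{r/K}$ cut out by the kernel of $K[X,1/\det X]\to L$, $X\mapsto\Psi$; $\Gamma=\Gamma_\Psi=\mathrm{Spec}$ of the image of the $F$-algebra map $F[X,1/\det X]\to L\otimes_KL$, $X\mapsto\Psi_1^{-1}\Psi_2$, where $\Psi_1,\Psi_2$ have entries $\Psi_{ij}\otimes1$, $1\otimes\Psi_{ij}$. $\Gamma$ is a closed subgroup scheme of $\mathrm{GL}_{r/F}$ and $Z$ is stable under right multiplication by $\Gamma_K$. Action of $\Gamma(\overline{F})$: every $\gamma\in\Gamma(\overline{F})$ lies in $\Gamma(\mathbf F_n)$ for some $n$ and acts on $\widetilde\Sigma$ (hence on $\widetilde\Lambda$) by the $\overline{K}$-algebra automorphism $h(\Psi)\mapsto h(\Psi\gamma)$ (for $h\in\overline{K}[X,1/\det X]$), induced by right multiplication by $\gamma$ on $Z_{\overline{K}}$; this automorphism commutes with $\sigma^n$. *)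

theory Defs
  imports "HOL-Analysis.Analysis" "HOL-Computational_Algebra.Computational_Algebra"
    "HOL-Library.Poly_Mapping"
begin

text \<open>
  All fields are subfields of one algebraically closed field, the type \<^typ>\<open>'a\<close>. It plays the role
  of an algebraic closure of L once every element of \<^typ>\<open>'a\<close> is algebraic over L.
\<close>

definition is_subfield :: "'a::field set \<Rightarrow> bool" where
  "is_subfield S \<longleftrightarrow> 0 \<in> S \<and> 1 \<in> S \<and>
     (\<forall>x\<in>S. \<forall>y\<in>S. x + y \<in> S \<and> x * y \<in> S) \<and> (\<forall>x\<in>S. - x \<in> S \<and> inverse x \<in> S)"

definition field_adjoin :: "'a::field set \<Rightarrow> 'a set \<Rightarrow> 'a set" where
  "field_adjoin K S = \<Inter>{E. is_subfield E \<and> K \<subseteq> E \<and> S \<subseteq> E}"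

definition algebraic_over :: "'a::field set \<Rightarrow> 'a \<Rightarrow> bool" where
  "algebraic_over K x \<longleftrightarrow> (\<exists>p. p \<noteq> 0 \<and> (\<forall>i. coeff p i \<in> K) \<and> poly p x = 0)"

definition alg_closure_in :: "'a::field set \<Rightarrow> 'a set \<Rightarrow> 'a set" where
  "alg_closure_in E K = {x \<in> E. algebraic_over K x}"

abbreviation alg_closure_of :: "'a::alg_closed_field set \<Rightarrow> 'a set" where
  "alg_closure_of K \<equiv> alg_closure_in UNIV K"

definition lin_indep_over :: "'a::field set \<Rightarrow> 'a set \<Rightarrow> bool" where
  "lin_indep_over K B \<longleftrightarrow>
     (\<forall>c. (\<forall>b\<in>B. c b \<in> K) \<and> (\<Sum>b\<in>B. c b * b) = 0 \<longrightarrow> (\<forall>b\<in>B. c b = 0))"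

definition linearly_disjoint_over :: "'a::field set \<Rightarrow> 'a set \<Rightarrow> 'a set \<Rightarrow> bool" where
  "linearly_disjoint_over K L M \<longleftrightarrow>
     (\<forall>B. finite B \<and> B \<subseteq> L \<and> lin_indep_over K B \<longrightarrow> lin_indep_over M B)"

text \<open>The field obtained from K by adjoining all p-power roots, p the characteristic exponent.\<close>

definition perfect_closure :: "'a::alg_closed_field set \<Rightarrow> 'a set" where
  "perfect_closure K =
     (if CHAR('a) = 0 then K else {x. \<exists>n. x ^ (CHAR('a) ^ n) \<in> K})"

text \<open>
  Separability of a possibly transcendental extension, in the sense of MacLane and Lang: L is
  linearly disjoint over K from the perfect closure of K.
\<close>

definition separable_over :: "'a::alg_closed_field set \<Rightarrow> 'a set \<Rightarrow> bool" where
  "separable_over K L \<longleftrightarrow> linearly_disjoint_over K L (perfect_closure K)"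

definition field_aut_on :: "('a::field \<Rightarrow> 'a) \<Rightarrow> 'a set \<Rightarrow> bool" where
  "field_aut_on \<sigma> L \<longleftrightarrow> bij_betw \<sigma> L L \<and>
     (\<forall>x\<in>L. \<forall>y\<in>L. \<sigma> (x + y) = \<sigma> x + \<sigma> y \<and> \<sigma> (x * y) = \<sigma> x * \<sigma> y)"

definition fixed_field :: "('a \<Rightarrow> 'a) \<Rightarrow> 'a set \<Rightarrow> 'a set" where
  "fixed_field \<sigma> L = {x \<in> L. \<sigma> x = x}"

definition sigma_admissible ::
    "'a::alg_closed_field set \<Rightarrow> 'a set \<Rightarrow> 'a set \<Rightarrow> ('a \<Rightarrow> 'a) \<Rightarrow> bool" where
  "sigma_admissible F K L \<sigma> \<longleftrightarrow>
     is_subfield F \<and> is_subfield K \<and> is_subfield L \<and> F \<subseteq> K \<and> K \<subseteq> L \<and>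
     field_aut_on \<sigma> L \<and> field_aut_on \<sigma> K \<and> field_aut_on \<sigma> F \<and>
     F = fixed_field \<sigma> F \<and> F = fixed_field \<sigma> K \<and> F = fixed_field \<sigma> L \<and>
     separable_over K L"

definition mat_entries :: "'a^'n^'m \<Rightarrow> 'a set" where
  "mat_entries A = {A $ i $ j |i j. True}"

definition GL_over :: "'a::field set \<Rightarrow> ('a^'r^'r) set" where
  "GL_over S = {A. mat_entries A \<subseteq> S \<and> det A \<noteq> 0}"

text \<open>
  Elements of S[X, 1/det X] are represented by polynomials over S in the variables \<^term>\<open>Some (i, j)\<close>,
  standing for the matrix entries, and \<^term>\<open>None\<close>, standing for 1/det X. The representation is not
  unique, but its evaluation at an invertible matrix depends only on the element represented.
\<close>

type_synonym ('r, 'a) gl_poly = "(('r \<times> 'r) option \<Rightarrow>\<^sub>0 nat) \<Rightarrow>\<^sub>0 'a"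

definition coeffs_in :: "'a::zero set \<Rightarrow> ('m \<Rightarrow>\<^sub>0 'a) \<Rightarrow> bool" where
  "coeffs_in S h \<longleftrightarrow> (\<forall>m. Poly_Mapping.lookup h m \<in> S)"

text \<open>Here \<open>\<phi>\<close> embeds the coefficients, and d is an inverse of the determinant of A.\<close>

definition gl_eval :: "('a::zero \<Rightarrow> 'b::comm_ring_1) \<Rightarrow> 'b^'r^'r \<Rightarrow> 'b \<Rightarrow> ('r, 'a) gl_poly \<Rightarrow> 'b" where
  "gl_eval \<phi> A d h =
     (\<Sum>m\<in>Poly_Mapping.keys h. \<phi> (Poly_Mapping.lookup h m) *
        (\<Prod>v\<in>Poly_Mapping.keys m.
           (case v of None \<Rightarrow> d | Some (i, j) \<Rightarrow> A $ i $ j) ^ Poly_Mapping.lookup m v))"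

definition gl_at :: "('a::field)^'r^'r \<Rightarrow> ('r, 'a) gl_poly \<Rightarrow> 'a" where
  "gl_at A h = gl_eval (\<lambda>c. c) A (inverse (det A)) h"

text \<open>
  The tensor product of L with itself over K is the free abelian group on L \<open>\<times>\<close> L modulo the
  subgroup generated by the bilinearity relations. The free group is a commutative ring with
  product (a, b)(a', b') = (aa', bb') on generators, in which that subgroup is an ideal if L is a
  subfield containing K. As the product of finitely supported functions is convolution along the
  addition of their index type, the product of generators has to be called addition.
\<close>

datatype 'a tensor_gen = Tensor_Gen 'a 'a

instantiation tensor_gen :: (comm_monoid_mult) comm_monoid_add
begin

definition zero_tensor_gen :: "'a tensor_gen" where
  "0 = Tensor_Gen 1 1"

fun plus_tensor_gen :: "'a tensor_gen \<Rightarrow> 'a tensor_gen \<Rightarrow> 'a tensor_gen" where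
  "Tensor_Gen a b + Tensor_Gen a' b' = Tensor_Gen (a * a') (b * b')"

instance
proof
  fix x y z :: "'a tensor_gen"
  show "x + y + z = x + (y + z)" by (cases x; cases y; cases z) (simp add: mult.assoc)
  show "x + y = y + x" by (cases x; cases y) (simp add: mult.commute)
  show "0 + x = x" by (cases x) (simp add: zero_tensor_gen_def)
qed

end

type_synonym 'a formal_tensor = "'a tensor_gen \<Rightarrow>\<^sub>0 int"

definition tensor :: "'a \<Rightarrow> 'a \<Rightarrow> 'a formal_tensor" where
  "tensor a b = Poly_Mapping.single (Tensor_Gen a b) 1"

text \<open>The formal tensors that are zero in the tensor product of L with itself over K.\<close>

inductive_set tensor_relations :: "'a::field set \<Rightarrow> 'a set \<Rightarrow> 'a formal_tensor set"
  for K L :: "'a set" where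
  zero: "0 \<in> tensor_relations K L"
| diff: "x \<in> tensor_relations K L \<Longrightarrow> y \<in> tensor_relations K L \<Longrightarrow> x - y \<in> tensor_relations K L"
| add_left: "a \<in> L \<Longrightarrow> a' \<in> L \<Longrightarrow> b \<in> L \<Longrightarrow>
    tensor (a + a') b - tensor a b - tensor a' b \<in> tensor_relations K L"
| add_right: "a \<in> L \<Longrightarrow> b \<in> L \<Longrightarrow> b' \<in> L \<Longrightarrow>
    tensor a (b + b') - tensor a b - tensor a b' \<in> tensor_relations K L"
| balanced: "c \<in> K \<Longrightarrow> a \<in> L \<Longrightarrow> b \<in> L \<Longrightarrow>
    tensor (c * a) b - tensor a (c * b) \<in> tensor_relations K L"

text \<open>
  A representative of the image of h under X \<open>\<mapsto>\<close> \<open>\<Psi>\<^sub>1\<close>\<open>\<^sup>-\<^sup>1\<close>\<open>\<Psi>\<^sub>2\<close>; the determinant of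
  \<open>\<Psi>\<^sub>1\<close>\<open>\<^sup>-\<^sup>1\<close>\<open>\<Psi>\<^sub>2\<close> has the inverse det \<open>\<Psi>\<close> \<open>\<otimes>\<close> 1/det \<open>\<Psi>\<close>.
\<close>

definition gl_at_tensor :: "('a::field)^'r^'r \<Rightarrow> ('r, 'a) gl_poly \<Rightarrow> 'a formal_tensor" where
  "gl_at_tensor \<Psi> h =
     gl_eval (\<lambda>c. tensor c 1)
       (map_matrix (\<lambda>x. tensor x 1) (matrix_inv \<Psi>) ** map_matrix (\<lambda>x. tensor 1 x) \<Psi>)
       (tensor (det \<Psi>) (inverse (det \<Psi>))) h"

text \<open>The defining ideal of \<open>\<Gamma>\<close> in F[X, 1/det X], and the points of \<open>\<Gamma>\<close> in an extension R of F.\<close>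

definition Gamma_ideal ::
    "'a::field set \<Rightarrow> 'a set \<Rightarrow> 'a set \<Rightarrow> 'a^'r^'r \<Rightarrow> ('r, 'a) gl_poly set" where
  "Gamma_ideal F K L \<Psi> = {h. coeffs_in F h \<and> gl_at_tensor \<Psi> h \<in> tensor_relations K L}"

definition Gamma_points ::
    "'a::field set \<Rightarrow> 'a set \<Rightarrow> 'a set \<Rightarrow> 'a^'r^'r \<Rightarrow> 'a set \<Rightarrow> ('a^'r^'r) set" where
  "Gamma_points F K L \<Psi> R = {\<gamma> \<in> GL_over R. \<forall>h \<in> Gamma_ideal F K L \<Psi>. gl_at \<gamma> h = 0}"

text \<open>S[\<open>\<Psi>\<close>, 1/det \<open>\<Psi>\<close>] and its fraction field.\<close>

definition coord_ring :: "'a::field set \<Rightarrow> 'a^'r^'r \<Rightarrow> 'a set" where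
  "coord_ring S \<Psi> = {gl_at \<Psi> h |h. coeffs_in S h}"

definition fraction_field :: "'a::field set \<Rightarrow> 'a set" where
  "fraction_field R = {a / b |a b. a \<in> R \<and> b \<in> R \<and> b \<noteq> 0}"

text \<open>
  The action h(\<open>\<Psi>\<close>) \<open>\<mapsto>\<close> h(\<open>\<Psi>\<gamma>\<close>) on S[\<open>\<Psi>\<close>, 1/det \<open>\<Psi>\<close>] and its extension to the fraction field.
  The values are specified only if they do not depend on the chosen representations.
\<close>

definition act_ring :: "'a::field set \<Rightarrow> 'a^'r^'r \<Rightarrow> 'a^'r^'r \<Rightarrow> 'a \<Rightarrow> 'a" where
  "act_ring S \<Psi> \<gamma> x =
     (THE y. \<exists>h. coeffs_in S h \<and> x = gl_at \<Psi> h \<and> y = gl_at (\<Psi> ** \<gamma>) h)"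

definition act_field :: "'a::field set \<Rightarrow> 'a^'r^'r \<Rightarrow> 'a^'r^'r \<Rightarrow> 'a \<Rightarrow> 'a" where
  "act_field S \<Psi> \<gamma> x =
     (THE y. \<exists>a \<in> coord_ring S \<Psi>. \<exists>b \<in> coord_ring S \<Psi>. b \<noteq> 0 \<and> x = a / b \<and>
        y = act_ring S \<Psi> \<gamma> a / act_ring S \<Psi> \<gamma> b)"

end

theory Submission
  imports Defs
begin

text \<open>
  By Galois descent along \<open>\<sigma>\<close>, the polynomials over L vanishing at \<open>\<Psi>\<^sub>1\<close>\<open>\<^sup>-\<^sup>1\<close>\<open>\<Psi>\<^sub>2\<close> in the tensor product
  of L with itself over K are spanned by those with coefficients in F, that is, by the equations of
  \<open>\<Gamma>\<close>. If q over K vanishes at \<open>\<Psi>\<close>, then q(\<open>\<Psi>\<close>X) is such a polynomial, so q(\<open>\<Psi>\<gamma>\<close>) = 0 for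
  \<open>\<gamma>\<close> in \<open>\<Gamma>\<close>. This extends to the algebraic closure of K, as K(\<open>\<Psi>\<close>) is a regular extension of K.

  Let f = a(\<open>\<Psi>\<close>)/b(\<open>\<Psi>\<close>) be fixed by \<open>\<Gamma>\<close>. The polynomial H = a(\<open>\<Psi>\<close>X) b(\<open>\<Psi>\<close>) - b(\<open>\<Psi>\<close>X) a(\<open>\<Psi>\<close>) vanishes on
  all points of \<open>\<Gamma>\<close> over the algebraic closure of F. By a second descent, H is spanned by polynomials
  over the periodic elements of \<open>\<sigma>\<close> with the same property. These vanish at every solution of the
  equations of \<open>\<Gamma>\<close>, since such a solution can be specialized to the algebraic closure of F. One
  such solution is \<open>\<Psi>\<close>\<open>\<^sup>-\<^sup>1\<close>A, for a point A of Z over the algebraic closure of K with b(A) \<open>\<noteq>\<close> 0. Hence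
  f = a(A)/b(A) is algebraic over K.
\<close>

section \<open>Specialization of finitely generated algebras\<close>

text \<open>Three obstacles shape the proof. The tensor product is present only as formal tensors
  with a set of relations, so evaluation of polynomials is developed for coefficient maps that are
  homomorphisms up to a partial equivalence; the same lemmas, read with equality, serve for
  evaluation in a field. Next, \<gamma> acts on fractions only if a denominator that is nonzero at
  \<Psi> stays nonzero at \<Psi>\<gamma>. This would follow at once if the inverse of \<gamma> were
  known to lie in \<Gamma>, but closure under inverses is never proved; linear dependence among the
  translates by powers of \<gamma> takes its place. Finally, points with prescribed nonvanishing are
  built by specializing generators one at a time, following a single nonzero element down to the
  base. Both descents use \<sigma> itself; its powers serve to describe the closure of F as the set
  of periodic elements.\<close>

definition is_subring :: "'a::comm_ring_1 set \<Rightarrow> bool" where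
  "is_subring A \<longleftrightarrow> 0 \<in> A \<and> 1 \<in> A \<and> (\<forall>x\<in>A. \<forall>y\<in>A. x + y \<in> A \<and> x * y \<in> A) \<and> (\<forall>x\<in>A. - x \<in> A)"

lemma subringD:
  assumes "is_subring A"
  shows "0 \<in> A" "1 \<in> A" "x \<in> A \<Longrightarrow> y \<in> A \<Longrightarrow> x + y \<in> A" "x \<in> A \<Longrightarrow> y \<in> A \<Longrightarrow> x * y \<in> A"
    "x \<in> A \<Longrightarrow> - x \<in> A" "x \<in> A \<Longrightarrow> y \<in> A \<Longrightarrow> x - y \<in> A" "x \<in> A \<Longrightarrow> x ^ n \<in> A"
proof -
  show *: "0 \<in> A" "1 \<in> A" "x \<in> A \<Longrightarrow> y \<in> A \<Longrightarrow> x + y \<in> A" "x \<in> A \<Longrightarrow> - x \<in> A"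
    and m: "x \<in> A \<Longrightarrow> y \<in> A \<Longrightarrow> x * y \<in> A" for x y
    using assms by (auto simp: is_subring_def)
  show "x \<in> A \<Longrightarrow> y \<in> A \<Longrightarrow> x - y \<in> A" using *(3)[of x "-y"] *(4)[of y] by simp
  show "x \<in> A \<Longrightarrow> x ^ n \<in> A" by (induction n) (auto intro: * m)
qed

lemma subring_sum: "is_subring A \<Longrightarrow> (\<And>i. i \<in> I \<Longrightarrow> f i \<in> A) \<Longrightarrow> sum f I \<in> A"
  by (induction I rule: infinite_finite_induct) (auto intro: subringD)

lemma subring_prod: "is_subring A \<Longrightarrow> (\<And>i. i \<in> I \<Longrightarrow> f i \<in> A) \<Longrightarrow> prod f I \<in> A"
  by (induction I rule: infinite_finite_induct) (auto intro: subringD)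

lemma subfield_subring: "is_subfield A \<Longrightarrow> is_subring A"
  by (auto simp: is_subfield_def is_subring_def)

lemma subfield_inverse: "is_subfield A \<Longrightarrow> x \<in> A \<Longrightarrow> inverse x \<in> A"
  by (auto simp: is_subfield_def)

lemma subfield_divide: "is_subfield A \<Longrightarrow> x \<in> A \<Longrightarrow> y \<in> A \<Longrightarrow> x / y \<in> A"
  by (auto simp: divide_inverse intro: subfield_inverse subringD(4) subfield_subring)

definition ring_hom_on :: "'a::comm_ring_1 set \<Rightarrow> ('a \<Rightarrow> 'b::comm_ring_1) \<Rightarrow> bool" where
  "ring_hom_on A \<phi> \<longleftrightarrow> \<phi> 1 = 1 \<and> (\<forall>x\<in>A. \<forall>y\<in>A. \<phi> (x + y) = \<phi> x + \<phi> y \<and> \<phi> (x * y) = \<phi> x * \<phi> y)"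

lemma ring_hom_onD:
  assumes "ring_hom_on A \<phi>" "is_subring A"
  shows "\<phi> 0 = 0" "\<phi> 1 = 1" "x \<in> A \<Longrightarrow> y \<in> A \<Longrightarrow> \<phi> (x + y) = \<phi> x + \<phi> y"
    "x \<in> A \<Longrightarrow> y \<in> A \<Longrightarrow> \<phi> (x * y) = \<phi> x * \<phi> y" "x \<in> A \<Longrightarrow> \<phi> (- x) = - \<phi> x"
    "x \<in> A \<Longrightarrow> y \<in> A \<Longrightarrow> \<phi> (x - y) = \<phi> x - \<phi> y" "x \<in> A \<Longrightarrow> \<phi> (x ^ n) = \<phi> x ^ n"
proof -
  show 1: "\<phi> 1 = 1" and a: "x \<in> A \<Longrightarrow> y \<in> A \<Longrightarrow> \<phi> (x + y) = \<phi> x + \<phi> y"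
    and m: "x \<in> A \<Longrightarrow> y \<in> A \<Longrightarrow> \<phi> (x * y) = \<phi> x * \<phi> y" for x y
    using assms by (auto simp: ring_hom_on_def)
  note A = subringD[OF assms(2)]
  show 0: "\<phi> 0 = 0" using a[of 0 0] A(1) by simp
  show m': "x \<in> A \<Longrightarrow> \<phi> (- x) = - \<phi> x" for x
    using a[of x "-x"] A(5)[of x] 0 by (simp add: eq_neg_iff_add_eq_0 add.commute)
  show "x \<in> A \<Longrightarrow> y \<in> A \<Longrightarrow> \<phi> (x - y) = \<phi> x - \<phi> y"
    using a[of x "-y"] m'[of y] A(5)[of y] by simp
  show "x \<in> A \<Longrightarrow> \<phi> (x ^ n) = \<phi> x ^ n"
    by (induction n) (simp_all add: 1 m A)
qed

lemma ring_hom_on_sum: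
  assumes "ring_hom_on A \<phi>" "is_subring A" "\<And>i. i \<in> I \<Longrightarrow> f i \<in> A"
  shows "\<phi> (sum f I) = (\<Sum>i\<in>I. \<phi> (f i))"
  using assms(3)
  by (induction I rule: infinite_finite_induct)
    (simp_all add: ring_hom_onD[OF assms(1,2)] subring_sum[OF assms(2)])

section \<open>Polynomials over a subring and their images under homomorphisms\<close>

definition polys_over :: "'a::comm_ring_1 set \<Rightarrow> 'a poly set" where
  "polys_over A = {p. \<forall>i. coeff p i \<in> A}"

lemma polys_overI: "(\<And>i. coeff p i \<in> A) \<Longrightarrow> p \<in> polys_over A"
  by (simp add: polys_over_def)

lemma polys_overD: "p \<in> polys_over A \<Longrightarrow> coeff p i \<in> A"
  by (simp add: polys_over_def)

lemma polys_over_const: "is_subring A \<Longrightarrow> a \<in> A \<Longrightarrow> [:a:] \<in> polys_over A"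
  by (auto simp: polys_over_def coeff_pCons subringD split: nat.splits)

lemma polys_over_X: "is_subring A \<Longrightarrow> [:0, 1:] \<in> polys_over A"
  by (auto simp: polys_over_def coeff_pCons subringD split: nat.splits)

lemma polys_over_subring:
  assumes "is_subring A" shows "is_subring (polys_over A)"
  unfolding is_subring_def polys_over_def
  by (auto simp: coeff_mult intro!: subringD[OF assms] subring_sum[OF assms])

lemma polys_over_smult: "is_subring A \<Longrightarrow> a \<in> A \<Longrightarrow> p \<in> polys_over A \<Longrightarrow> smult a p \<in> polys_over A"
  by (auto simp: polys_over_def subringD)

lemma polys_over_monom: "is_subring A \<Longrightarrow> a \<in> A \<Longrightarrow> monom a n \<in> polys_over A"
  by (auto simp: polys_over_def subringD)

lemma poly_in_subring: "is_subring A \<Longrightarrow> p \<in> polys_over A \<Longrightarrow> x \<in> A \<Longrightarrow> poly p x \<in> A"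
  unfolding poly_altdef by (auto intro!: subring_sum subringD dest: polys_overD)

lemma polys_over_mono: "A \<subseteq> B \<Longrightarrow> polys_over A \<subseteq> polys_over B"
  by (auto simp: polys_over_def)

lemma map_poly_hom:
  assumes "ring_hom_on A \<phi>" "is_subring A" "p \<in> polys_over A" "q \<in> polys_over A"
  shows "map_poly \<phi> (p + q) = map_poly \<phi> p + map_poly \<phi> q"
    and "map_poly \<phi> (p - q) = map_poly \<phi> p - map_poly \<phi> q"
    and "map_poly \<phi> (p * q) = map_poly \<phi> p * map_poly \<phi> q"
  using assms(3,4)
  by (auto intro!: poly_eqI sum.cong
    simp: coeff_map_poly coeff_mult polys_over_def ring_hom_onD[OF assms(1,2)]
      ring_hom_on_sum[OF assms(1,2)] subringD[OF assms(2)])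

lemma map_poly_hom_smult:
  assumes "ring_hom_on A \<phi>" "is_subring A" "p \<in> polys_over A" "a \<in> A"
  shows "map_poly \<phi> (smult a p) = smult (\<phi> a) (map_poly \<phi> p)"
  using assms(3,4)
  by (auto intro!: poly_eqI simp: coeff_map_poly polys_over_def ring_hom_onD[OF assms(1,2)])

lemma map_poly_hom_const:
  assumes "ring_hom_on A \<phi>" "is_subring A"
  shows "map_poly \<phi> [:a:] = [:\<phi> a:]"
  by (intro poly_eqI)
    (auto simp: coeff_map_poly coeff_pCons ring_hom_onD[OF assms] split: nat.splits)

lemma map_poly_in_polys_over:
  assumes "ring_hom_on A \<phi>" "is_subring A" "p \<in> polys_over A" "\<phi> ` A \<subseteq> B"
  shows "map_poly \<phi> p \<in> polys_over B"
  using assms(3,4) by (auto simp: polys_over_def coeff_map_poly ring_hom_onD[OF assms(1,2)])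

section \<open>Rings generated by one element, and division without inverses\<close>

definition adjoin :: "'a::comm_ring_1 set \<Rightarrow> 'a \<Rightarrow> 'a set" where
  "adjoin A x = (\<lambda>p. poly p x) ` polys_over A"

lemma adjoin_subring:
  assumes "is_subring A" shows "is_subring (adjoin A x)"
proof -
  note P = subringD[OF polys_over_subring[OF assms]]
  have "poly p x + poly q x \<in> adjoin A x" "poly p x * poly q x \<in> adjoin A x" "- poly p x \<in> adjoin A x"
    if "p \<in> polys_over A" "q \<in> polys_over A" for p q
    using P(3,4)[OF that] P(5)[OF that(1)] unfolding adjoin_def
    by (metis (no_types, lifting) image_eqI poly_add poly_mult poly_minus)+
  moreover have "0 \<in> adjoin A x" "1 \<in> adjoin A x"
    using P(1,2) unfolding adjoin_def by (metis image_eqI poly_0 poly_1)+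
  ultimately show ?thesis unfolding is_subring_def adjoin_def by auto
qed

lemma subset_adjoin: "is_subring A \<Longrightarrow> A \<subseteq> adjoin A x"
  unfolding adjoin_def by (auto intro!: image_eqI[where x = "[:_:]"] polys_over_const)

lemma in_adjoin: "is_subring A \<Longrightarrow> x \<in> adjoin A x"
  unfolding adjoin_def by (auto intro!: image_eqI[where x = "[:0, 1:]"] polys_over_X)

text \<open>Each cancellation of a top term costs a factor \<open>lead_coeff m\<close> instead of a
  quotient, so everything stays in the coefficient ring although m need not be monic.\<close>

lemma pseudo_division:
  fixes m :: "'a::idom poly"
  assumes A: "is_subring A" and m: "m \<in> polys_over A" "m \<noteq> 0" and "p \<in> polys_over A"
  shows "\<exists>N s r. s \<in> polys_over A \<and> r \<in> polys_over A \<and> smult (lead_coeff m ^ N) p = m * s + r \<and>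
    (r = 0 \<or> degree r < degree m)"
  using \<open>p \<in> polys_over A\<close>
\<comment> \<open>The measure puts the zero polynomial strictly below the nonzero constants; both
  have degree 0.\<close>
proof (induction "if p = 0 then 0 else Suc (degree p)" arbitrary: p rule: less_induct)
  case (less p)
  note P = subringD[OF polys_over_subring[OF A]]
  show ?case
  proof (cases "p = 0 \<or> degree p < degree m")
    case True
    then show ?thesis using less.prems P(1)
      by (intro exI[of _ "0::nat"] exI[of _ "0 :: 'a poly"] exI[of _ p]) auto
  next
    case False
    define t where "t = monom (lead_coeff p) (degree p - degree m)"
    define p' where "p' = smult (lead_coeff m) p - t * m"
    have t: "t \<in> polys_over A" unfolding t_def
      using polys_over_monom[OF A] less.prems polys_overD by blast
    have p': "p' \<in> polys_over A" unfolding p'_def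
      by (intro P t m polys_over_smult[OF A] polys_overD less.prems)
    have "degree p' \<le> degree p" unfolding p'_def t_def
      using False m(2) by (intro degree_diff_le) (auto simp: degree_mult_eq degree_monom_eq)
    moreover have "coeff p' (degree p) = 0"
      using False m(2) coeff_mult_degree_sum[of t m] unfolding p'_def
      by (simp add: t_def degree_monom_eq)
    ultimately have "p' = 0 \<or> degree p' < degree p"
      by (metis le_neq_implies_less leading_coeff_0_iff)
    then have "(if p' = 0 then 0 else Suc (degree p')) < (if p = 0 then 0 else Suc (degree p))"
      using False by auto
    from less.hyps[OF this p'] obtain N s r where IH: "s \<in> polys_over A" "r \<in> polys_over A"
      "smult (lead_coeff m ^ N) p' = m * s + r" "r = 0 \<or> degree r < degree m"
      by metis
    have "smult (lead_coeff m ^ Suc N) p = smult (lead_coeff m ^ N) p' + smult (lead_coeff m ^ N) t * m"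
      by (simp add: p'_def smult_diff_right algebra_simps)
    also have "\<dots> = m * (s + smult (lead_coeff m ^ N) t) + r" by (simp add: IH(3) algebra_simps)
    finally have "smult (lead_coeff m ^ Suc N) p = m * (s + smult (lead_coeff m ^ N) t) + r" .
    moreover have "s + smult (lead_coeff m ^ N) t \<in> polys_over A"
      by (intro P IH t polys_over_smult[OF A] subringD(7)[OF A] polys_overD m)
    ultimately show ?thesis using IH(2,4) by blast
  qed
qed

text \<open>Least degree replaces the monic minimal polynomial, which may not exist over a ring. The
  price is a leading coefficient that homomorphisms must not kill.\<close>

definition minimal_over :: "'a::comm_ring_1 set \<Rightarrow> 'a poly \<Rightarrow> 'a \<Rightarrow> bool" where
  "minimal_over A m x \<longleftrightarrow> m \<in> polys_over A \<and> m \<noteq> 0 \<and> poly m x = 0 \<and>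
     (\<forall>p\<in>polys_over A. p \<noteq> 0 \<and> poly p x = 0 \<longrightarrow> degree m \<le> degree p)"

lemma minimal_over_exists:
  assumes "p \<in> polys_over A" "p \<noteq> 0" "poly p x = 0"
  obtains m where "minimal_over A m x"
  using ex_has_least_nat[of "\<lambda>p. p \<in> polys_over A \<and> p \<noteq> 0 \<and> poly p x = 0" p degree] assms
  by (auto simp: minimal_over_def)

text \<open>The pseudo-remainder also vanishes at x and is zero or of smaller degree than m, so
  minimality forces it to be zero.\<close>

lemma minimal_over_division:
  fixes m :: "'a::idom poly"
  assumes A: "is_subring A" and m: "minimal_over A m x" and p: "p \<in> polys_over A" "poly p x = 0"
  obtains N s where "s \<in> polys_over A" "smult (lead_coeff m ^ N) p = m * s"
proof -
  have m': "m \<in> polys_over A" "m \<noteq> 0" "poly m x = 0" using m by (auto simp: minimal_over_def)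
  obtain N s r where *: "s \<in> polys_over A" "r \<in> polys_over A"
    "smult (lead_coeff m ^ N) p = m * s + r" "r = 0 \<or> degree r < degree m"
    using pseudo_division[OF A m'(1,2) p(1)] by blast
  have "poly r x = 0" using arg_cong[OF *(3), of "\<lambda>q. poly q x"] p m' by simp
  then have "r = 0" using * m by (auto simp: minimal_over_def)
  then show ?thesis using that * by simp
qed

lemma minimal_over_degree:
  fixes m :: "'a::idom poly"
  shows "minimal_over A m x \<Longrightarrow> degree m > 0"
  by (auto simp: minimal_over_def elim!: degree_eq_zeroE intro!: gr0I)

text \<open>The hypothesis \<open>ker\<close> makes the value at \<xi> independent of the polynomial
  that represents an element of A[x], so an arbitrary representative can be chosen.\<close>

lemma hom_extend:
  fixes \<phi> :: "'a::comm_ring_1 \<Rightarrow> 'b::comm_ring_1"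
  assumes A: "is_subring A" and \<phi>: "ring_hom_on A \<phi>"
    and ker: "\<And>p. p \<in> polys_over A \<Longrightarrow> poly p x = 0 \<Longrightarrow> poly (map_poly \<phi> p) \<xi> = 0"
  obtains \<psi> where "ring_hom_on (adjoin A x) \<psi>" "\<And>p. p \<in> polys_over A \<Longrightarrow> \<psi> (poly p x) = poly (map_poly \<phi> p) \<xi>"
    "\<And>a. a \<in> A \<Longrightarrow> \<psi> a = \<phi> a"
proof -
  note P = subringD[OF polys_over_subring[OF A]]
  define rep where "rep v = (SOME p. p \<in> polys_over A \<and> poly p x = v)" for v
  define \<psi> where "\<psi> v = poly (map_poly \<phi> (rep v)) \<xi>" for v
  have \<psi>: "\<psi> (poly p x) = poly (map_poly \<phi> p) \<xi>" if p: "p \<in> polys_over A" for p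
  proof -
    have r: "rep (poly p x) \<in> polys_over A" "poly (rep (poly p x)) x = poly p x"
      using someI[of "\<lambda>q. q \<in> polys_over A \<and> poly q x = poly p x" p] p by (auto simp: rep_def)
    have "poly (map_poly \<phi> (rep (poly p x) - p)) \<xi> = 0"
      using r p by (intro ker P) auto
    then show ?thesis using r p by (simp add: map_poly_hom[OF \<phi> A] \<psi>_def)
  qed
  have "\<psi> 1 = 1" using \<psi>[OF P(2)] by (simp add: ring_hom_onD[OF \<phi> A])
  moreover have "\<psi> (u + v) = \<psi> u + \<psi> v \<and> \<psi> (u * v) = \<psi> u * \<psi> v"
    if uv: "u \<in> adjoin A x" "v \<in> adjoin A x" for u v
  proof -
    obtain p q where pq: "u = poly p x" "v = poly q x" "p \<in> polys_over A" "q \<in> polys_over A"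
      using uv by (auto simp: adjoin_def)
    show ?thesis
      using \<psi>[OF P(3)[OF pq(3,4)]] \<psi>[OF P(4)[OF pq(3,4)]] pq
      by (simp add: \<psi> map_poly_hom[OF \<phi> A])
  qed
  ultimately have "ring_hom_on (adjoin A x) \<psi>" by (simp add: ring_hom_on_def)
  moreover have "\<psi> a = \<phi> a" if "a \<in> A" for a
    using \<psi>[OF polys_over_const[OF A that]] map_poly_hom_const[OF \<phi> A, of a] by simp
  ultimately show ?thesis using that \<psi> by blast
qed

text \<open>Up to a power of its leading coefficient, every relation of x is a multiple of m. The
  image of that power is nonzero and can be cancelled in a domain after evaluating at \<xi>.\<close>

lemma minimal_over_kernel:
  fixes \<phi> :: "'a::idom \<Rightarrow> 'b::idom"
  assumes A: "is_subring A" and \<phi>: "ring_hom_on A \<phi>" and m: "minimal_over A m x"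
    and \<xi>: "\<phi> (lead_coeff m) \<noteq> 0" "poly (map_poly \<phi> m) \<xi> = 0"
    and p: "p \<in> polys_over A" "poly p x = 0"
  shows "poly (map_poly \<phi> p) \<xi> = 0"
proof -
  have m': "m \<in> polys_over A" using m by (simp add: minimal_over_def)
  obtain N s where s: "s \<in> polys_over A" "smult (lead_coeff m ^ N) p = m * s"
    using minimal_over_division[OF A m p] .
  have "smult (\<phi> (lead_coeff m) ^ N) (map_poly \<phi> p) = map_poly \<phi> m * map_poly \<phi> s"
    using arg_cong[OF s(2), of "map_poly \<phi>"] p(1) m' s(1) polys_overD[OF m']
    by (simp add: map_poly_hom[OF \<phi> A] map_poly_hom_smult[OF \<phi> A] subringD[OF A] ring_hom_onD[OF \<phi> A])
  from arg_cong[OF this, of "\<lambda>q. poly q \<xi>"] show ?thesis using \<xi> by simp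
qed

text \<open>Bezout for p and the minimal polynomial, without leaving the coefficient ring.\<close>

lemma algebraic_multiple_in_base:
  fixes x :: "'a::idom"
  assumes A: "is_subring A" and m: "minimal_over A m x" and v: "v \<in> adjoin A x" "v \<noteq> 0"
  obtains w where "w \<in> adjoin A x" "v * w \<in> A" "v * w \<noteq> 0"
proof -
  note P = subringD[OF polys_over_subring[OF A]]
  have m': "m \<in> polys_over A" "m \<noteq> 0" "poly m x = 0" using m by (auto simp: minimal_over_def)
  obtain p where p: "p \<in> polys_over A" "v = poly p x" using v by (auto simp: adjoin_def)
  \<comment> \<open>The ideal generated by p and m. Its nonzero element g of least degree divides
    every member up to a power of the leading coefficient of g.\<close>
  define I where "I = {s * p + t * m |s t. s \<in> polys_over A \<and> t \<in> polys_over A}"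
  have IP: "I \<subseteq> polys_over A" unfolding I_def using P(3,4) p(1) m'(1) by auto
  have "0 * p + 1 * m \<in> I" "1 * p + 0 * m \<in> I" unfolding I_def using P(1,2) by blast+
  then have mI: "m \<in> I" and pI: "p \<in> I" by simp_all
  have "\<exists>g. (g \<in> I \<and> g \<noteq> 0) \<and> (\<forall>h. h \<in> I \<and> h \<noteq> 0 \<longrightarrow> degree g \<le> degree h)"
    using ex_has_least_nat[of "\<lambda>g. g \<in> I \<and> g \<noteq> 0" m degree] mI m'(2) by simp
  then obtain g where g: "g \<in> I" "g \<noteq> 0" "\<And>h. h \<in> I \<Longrightarrow> h \<noteq> 0 \<Longrightarrow> degree g \<le> degree h"
    by blast
  then have gP: "g \<in> polys_over A" using IP by blast
  have dvd: "\<exists>N s. s \<in> polys_over A \<and> smult (lead_coeff g ^ N) h = g * s" if h: "h \<in> I" for h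
  proof -
    obtain N s r where *: "s \<in> polys_over A" "r \<in> polys_over A"
      "smult (lead_coeff g ^ N) h = g * s + r" "r = 0 \<or> degree r < degree g"
      using pseudo_division[OF A gP g(2), of h] h IP by blast
    have c: "lead_coeff g ^ N \<in> A" using subringD(7)[OF A] polys_overD[OF gP] by blast
    obtain s1 t1 where h1: "h = s1 * p + t1 * m" "s1 \<in> polys_over A" "t1 \<in> polys_over A"
      using h by (auto simp: I_def)
    obtain s2 t2 where g1: "g = s2 * p + t2 * m" "s2 \<in> polys_over A" "t2 \<in> polys_over A"
      using g(1) by (auto simp: I_def)
    have "r = smult (lead_coeff g ^ N) h - g * s" using *(3) by simp
    also have "\<dots> = (smult (lead_coeff g ^ N) s1 - s2 * s) * p + (smult (lead_coeff g ^ N) t1 - t2 * s) * m"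
      by (simp only: h1(1), subst (3) g1(1)) (simp add: algebra_simps smult_add_right)
    also have "\<dots> \<in> I"
      unfolding I_def using P(4,6) polys_over_smult[OF A c] h1 g1 *(1) by blast
    finally have "r = 0" using g(3) *(4) by fastforce
    then show ?thesis using * by auto
  qed
  \<comment> \<open>Otherwise the cofactor s of g in m has smaller degree than m, so s does not
    vanish at x and g does. As p is a multiple of g up to a nonzero constant, v would be 0.\<close>
  have "degree g = 0"
  proof (rule ccontr)
    assume d: "degree g \<noteq> 0"
    obtain N s where s: "s \<in> polys_over A" "smult (lead_coeff g ^ N) m = g * s" using dvd[OF mI] by blast
    have s0: "s \<noteq> 0" using s(2) m'(2) g(2) by auto
    have deg: "degree m = degree g + degree s"
      using arg_cong[OF s(2), of degree] g(2) s0 by (simp add: degree_mult_eq)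
    have "poly s x \<noteq> 0" using m s s0 deg d by (fastforce simp: minimal_over_def)
    then have "poly g x = 0" using arg_cong[OF s(2), of "\<lambda>q. poly q x"] m'(3) by simp
    moreover obtain N' s' where "smult (lead_coeff g ^ N') p = g * s'" using dvd[OF pI] by blast
    ultimately have "lead_coeff g ^ N' * poly p x = 0" by (metis poly_smult poly_mult mult_zero_left)
    then show False using g(2) p v by simp
  qed
  then obtain a where a: "g = [:a:]" by (auto elim: degree_eq_zeroE)
  obtain s t where st: "g = s * p + t * m" "s \<in> polys_over A" using g(1) by (auto simp: I_def)
  have "v * poly s x = a" using arg_cong[OF st(1), of "\<lambda>q. poly q x"] a p(2) m'(3) by (simp add: mult.commute)
  moreover have "a \<in> A" "a \<noteq> 0" using gP a g(2) polys_overD[of g A 0] by auto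
  ultimately show ?thesis using that[of "poly s x"] st(2) by (auto simp: adjoin_def)
qed

section \<open>Specialization into an algebraically closed set, one generator at a time\<close>

definition rel_alg_closed :: "'a::field set \<Rightarrow> bool" where
  "rel_alg_closed k \<longleftrightarrow> (\<forall>p\<in>polys_over k. degree p > 0 \<longrightarrow> (\<exists>x\<in>k. poly p x = 0))"

text \<open>Elimination of one generator: nonvanishing of v on A[x] is reduced to nonvanishing of a
  single u in A. If x is algebraic over A, its value has to be a root of the image of m; otherwise
  it is free and only has to avoid the zeros of one polynomial.\<close>

lemma specialize_step:
  fixes k :: "'a::field set" and x :: "'b::idom"
  assumes A: "is_subring A" and k: "is_subring k" "rel_alg_closed k"
    and v: "v \<in> adjoin A x" "v \<noteq> 0"
  obtains u where "u \<in> A" "u \<noteq> 0"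
    "\<And>\<phi>. ring_hom_on A \<phi> \<Longrightarrow> \<phi> ` A \<subseteq> k \<Longrightarrow> \<phi> u \<noteq> 0 \<Longrightarrow>
      \<exists>\<psi>. ring_hom_on (adjoin A x) \<psi> \<and> \<psi> ` adjoin A x \<subseteq> k \<and> (\<forall>a\<in>A. \<psi> a = \<phi> a) \<and> \<psi> v \<noteq> 0"
proof (cases "\<exists>p\<in>polys_over A. p \<noteq> 0 \<and> poly p x = 0")
  case True
  then obtain m where m: "minimal_over A m x" using minimal_over_exists by metis
  then have m': "m \<in> polys_over A" "m \<noteq> 0" by (auto simp: minimal_over_def)
  obtain w where w: "w \<in> adjoin A x" "v * w \<in> A" "v * w \<noteq> 0"
    using algebraic_multiple_in_base[OF A m v] .
  have l: "lead_coeff m \<in> A" using m'(1) polys_overD by blast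
  show ?thesis
  \<comment> \<open>The factor \<open>lead_coeff m\<close> preserves the degree of m, so that a root
    exists and \<phi> extends to it; the factor \<open>v * w\<close> is a multiple of v and keeps
    the image of v nonzero.\<close>
  proof (rule that[of "lead_coeff m * (v * w)"])
    show "lead_coeff m * (v * w) \<in> A" "lead_coeff m * (v * w) \<noteq> 0"
      using l w m'(2) subringD(4)[OF A] by auto
    fix \<phi> :: "'b \<Rightarrow> 'a"
    assume \<phi>: "ring_hom_on A \<phi>" "\<phi> ` A \<subseteq> k" "\<phi> (lead_coeff m * (v * w)) \<noteq> 0"
    then have nz: "\<phi> (lead_coeff m) \<noteq> 0" "\<phi> (v * w) \<noteq> 0"
      using ring_hom_onD(4)[OF \<phi>(1) A l w(2)] by auto
    have "degree (map_poly \<phi> m) = degree m" using nz(1) by (intro map_poly_degree_eq)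
    moreover have "map_poly \<phi> m \<in> polys_over k" using map_poly_in_polys_over[OF \<phi>(1) A m'(1) \<phi>(2)] .
    ultimately obtain \<xi> where \<xi>: "\<xi> \<in> k" "poly (map_poly \<phi> m) \<xi> = 0"
      using k(2) minimal_over_degree[OF m] by (auto simp: rel_alg_closed_def)
    obtain \<psi> where \<psi>: "ring_hom_on (adjoin A x) \<psi>"
      "\<And>p. p \<in> polys_over A \<Longrightarrow> \<psi> (poly p x) = poly (map_poly \<phi> p) \<xi>" "\<And>a. a \<in> A \<Longrightarrow> \<psi> a = \<phi> a"
      using hom_extend[OF A \<phi>(1) minimal_over_kernel[OF A \<phi>(1) m nz(1) \<xi>(2)]] by metis
    have "\<psi> ` adjoin A x \<subseteq> k"
      using \<psi>(2) poly_in_subring[OF k(1) map_poly_in_polys_over[OF \<phi>(1) A _ \<phi>(2)] \<xi>(1)]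
      by (auto simp: adjoin_def)
    moreover have "\<psi> v \<noteq> 0"
      using nz(2) \<psi>(3)[OF w(2)] ring_hom_onD(4)[OF \<psi>(1) adjoin_subring[OF A] v(1) w(1)] by auto
    ultimately show "\<exists>\<psi>. ring_hom_on (adjoin A x) \<psi> \<and> \<psi> ` adjoin A x \<subseteq> k \<and> (\<forall>a\<in>A. \<psi> a = \<phi> a) \<and> \<psi> v \<noteq> 0"
      using \<psi>(1,3) by blast
  qed
next
  case False
  obtain p where p: "p \<in> polys_over A" "v = poly p x" using v by (auto simp: adjoin_def)
  then have p0: "p \<noteq> 0" using v by auto
  show ?thesis
  proof (rule that[of "lead_coeff p"])
    show "lead_coeff p \<in> A" "lead_coeff p \<noteq> 0" using polys_overD[OF p(1)] p0 by auto
    fix \<phi> :: "'b \<Rightarrow> 'a"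
    assume \<phi>: "ring_hom_on A \<phi>" "\<phi> ` A \<subseteq> k" "\<phi> (lead_coeff p) \<noteq> 0"
    define q where "q = map_poly \<phi> p"
    have q: "q \<in> polys_over k" unfolding q_def using map_poly_in_polys_over[OF \<phi>(1) A p(1) \<phi>(2)] .
    have dq: "degree q = degree p" unfolding q_def using \<phi>(3) by (rule map_poly_degree_eq)
    have q0: "q \<noteq> 0" using \<phi>(3) p0 dq unfolding q_def
      by (metis coeff_0 coeff_map_poly ring_hom_onD(1)[OF \<phi>(1) A])
    obtain \<xi> where \<xi>: "\<xi> \<in> k" "poly q \<xi> \<noteq> 0"
    proof (cases "degree q = 0")
      case True
      then obtain c where "q = [:c:]" by (auto elim: degree_eq_zeroE)
      then show ?thesis using that[of 0] q0 subringD(1)[OF k(1)] by auto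
    next
      case False
      \<comment> \<open>A root of q - 1 is a point where q takes the value 1; this finds a non-root
        of q without counting roots.\<close>
      have "q - 1 \<in> polys_over k" using subringD(2,6)[OF polys_over_subring[OF k(1)]] q by blast
      moreover have "degree (q - 1) = degree q" using False
        by (metis degree_1 degree_add_eq_left degree_minus diff_conv_add_uminus gr0I)
      ultimately obtain \<xi> where "\<xi> \<in> k" "poly (q - 1) \<xi> = 0"
        using k(2) False by (auto simp: rel_alg_closed_def)
      then show ?thesis using that[of \<xi>] by simp
    qed
    have ker: "poly (map_poly \<phi> r) \<xi> = 0" if "r \<in> polys_over A" "poly r x = 0" for r
    proof -
      have "r = 0" using False that by blast
      then show ?thesis by simp
    qed
    obtain \<psi> where \<psi>: "ring_hom_on (adjoin A x) \<psi>"
      "\<And>p. p \<in> polys_over A \<Longrightarrow> \<psi> (poly p x) = poly (map_poly \<phi> p) \<xi>" "\<And>a. a \<in> A \<Longrightarrow> \<psi> a = \<phi> a"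
      using hom_extend[OF A \<phi>(1) ker] by metis
    have "\<psi> ` adjoin A x \<subseteq> k"
      using \<psi>(2) poly_in_subring[OF k(1) map_poly_in_polys_over[OF \<phi>(1) A _ \<phi>(2)] \<xi>(1)]
      by (auto simp: adjoin_def)
    then show "\<exists>\<psi>. ring_hom_on (adjoin A x) \<psi> \<and> \<psi> ` adjoin A x \<subseteq> k \<and> (\<forall>a\<in>A. \<psi> a = \<phi> a) \<and> \<psi> v \<noteq> 0"
      using \<psi> \<xi>(2) p unfolding q_def by auto
  qed
qed

fun adjoin_list :: "'a::comm_ring_1 set \<Rightarrow> 'a list \<Rightarrow> 'a set" where
  "adjoin_list A [] = A"
| "adjoin_list A (x # xs) = adjoin (adjoin_list A xs) x"

lemma adjoin_list_subring: "is_subring A \<Longrightarrow> is_subring (adjoin_list A xs)"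
  by (induction xs) (auto intro: adjoin_subring)

lemma subset_adjoin_list: "is_subring A \<Longrightarrow> A \<subseteq> adjoin_list A xs"
  by (induction xs) (auto dest: subset_adjoin[OF adjoin_list_subring])

lemma set_subset_adjoin_list: "is_subring A \<Longrightarrow> set xs \<subseteq> adjoin_list A xs"
  by (induction xs) (auto dest: subset_adjoin[OF adjoin_list_subring] in_adjoin[OF adjoin_list_subring])

text \<open>A Nullstellensatz with a prescribed nonvanishing element: v is pushed down through the
  generators into k, where the identity is the homomorphism to start from.\<close>

lemma specialize:
  fixes k :: "'a::field set"
  assumes k: "is_subring k" "rel_alg_closed k" and v: "v \<in> adjoin_list k xs" "v \<noteq> 0"
  shows "\<exists>\<phi>. ring_hom_on (adjoin_list k xs) \<phi> \<and> \<phi> ` adjoin_list k xs \<subseteq> k \<and> (\<forall>a\<in>k. \<phi> a = a) \<and> \<phi> v \<noteq> 0"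
  using v
proof (induction xs arbitrary: v)
  case Nil
  then show ?case by (intro exI[of _ id]) (auto simp: ring_hom_on_def)
next
  case (Cons x xs)
  let ?A = "adjoin_list k xs"
  obtain u where u: "u \<in> ?A" "u \<noteq> 0" "\<And>\<phi>. ring_hom_on ?A \<phi> \<Longrightarrow> \<phi> ` ?A \<subseteq> k \<Longrightarrow> \<phi> u \<noteq> 0 \<Longrightarrow>
      \<exists>\<psi>. ring_hom_on (adjoin ?A x) \<psi> \<and> \<psi> ` adjoin ?A x \<subseteq> k \<and> (\<forall>a\<in>?A. \<psi> a = \<phi> a) \<and> \<psi> v \<noteq> 0"
    using specialize_step[OF adjoin_list_subring[OF k(1)] k] Cons.prems by (metis adjoin_list.simps(2))
  obtain \<phi> where \<phi>: "ring_hom_on ?A \<phi>" "\<phi> ` ?A \<subseteq> k" "\<forall>a\<in>k. \<phi> a = a" "\<phi> u \<noteq> 0"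
    using Cons.IH[OF u(1,2)] by blast
  obtain \<psi> where "ring_hom_on (adjoin ?A x) \<psi>" "\<psi> ` adjoin ?A x \<subseteq> k" "\<forall>a\<in>?A. \<psi> a = \<phi> a" "\<psi> v \<noteq> 0"
    using u(3)[OF \<phi>(1,2,4)] by blast
  then show ?case using \<phi>(3) subset_adjoin_list[OF k(1), of xs] by (intro exI[of _ \<psi>]) auto
qed

section \<open>Algebraic extensions\<close>

text \<open>Gaussian elimination carried out inside K: a pivot removes one equation and one unknown.
  It will be applied to powers of an element and to translates of a function.\<close>

lemma homogeneous_solution:
  fixes M :: "'i \<Rightarrow> 'j \<Rightarrow> 'a::field"
  assumes K: "is_subfield K" and "finite J" and "finite I" "card J < card I"
    and "\<And>i j. i \<in> I \<Longrightarrow> j \<in> J \<Longrightarrow> M i j \<in> K"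
  shows "\<exists>c. (\<forall>i\<in>I. c i \<in> K) \<and> (\<exists>i\<in>I. c i \<noteq> 0) \<and> (\<forall>j\<in>J. (\<Sum>i\<in>I. c i * M i j) = 0)"
  using assms(2-)
proof (induction J arbitrary: I M rule: finite_induct)
  case empty
  then have "I \<noteq> {}" by auto
  then show ?case using subringD(2)[OF subfield_subring[OF K]] by (intro exI[of _ "\<lambda>_. 1"]) auto
next
  case (insert j0 J)
  note A = subringD[OF subfield_subring[OF K]]
  show ?case
  proof (cases "\<forall>i\<in>I. M i j0 = 0")
    case True
    have "\<exists>c. (\<forall>i\<in>I. c i \<in> K) \<and> (\<exists>i\<in>I. c i \<noteq> 0) \<and> (\<forall>j\<in>J. (\<Sum>i\<in>I. c i * M i j) = 0)"
      using insert by (intro insert.IH) auto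
    then show ?thesis using True by auto
  next
    case False
    then obtain i0 where i0: "i0 \<in> I" "M i0 j0 \<noteq> 0" by blast
    define I' where "I' = I - {i0}"
    define q where "q i = M i j0 / M i0 j0" for i
    have q: "q i \<in> K" if "i \<in> I" for i
      unfolding q_def using that i0 insert.prems(3) subfield_divide[OF K] by auto
    have "\<exists>c. (\<forall>i\<in>I'. c i \<in> K) \<and> (\<exists>i\<in>I'. c i \<noteq> 0) \<and>
        (\<forall>j\<in>J. (\<Sum>i\<in>I'. c i * (M i j - q i * M i0 j)) = 0)"
      using insert i0(1) q unfolding I'_def by (intro insert.IH) (auto intro!: A)
    then obtain c where c: "\<forall>i\<in>I'. c i \<in> K" "\<exists>i\<in>I'. c i \<noteq> 0"
      "\<forall>j\<in>J. (\<Sum>i\<in>I'. c i * (M i j - q i * M i0 j)) = 0" by blast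
    \<comment> \<open>The value that equation \<open>j0\<close> dictates for the eliminated unknown
      \<open>i0\<close>.\<close>
    define s where "s = - (\<Sum>i\<in>I'. c i * q i)"
    have s: "s \<in> K" unfolding s_def
      by (intro A subring_sum[OF subfield_subring[OF K]]) (use c q in \<open>auto simp: I'_def\<close>)
    have split: "(\<Sum>i\<in>I. (c(i0 := s)) i * M i j) = s * M i0 j + (\<Sum>i\<in>I'. c i * M i j)" for j
      unfolding I'_def using insert.prems(1) i0(1)
      by (subst sum.remove[of _ i0]) (auto intro!: sum.cong)
    have total: "(\<Sum>i\<in>I. (c(i0 := s)) i * M i j) = (\<Sum>i\<in>I'. c i * (M i j - q i * M i0 j))" for j
      by (simp only: split, simp add: s_def algebra_simps sum_subtractf sum_distrib_left)
    have "c i * (M i j0 - q i * M i0 j0) = 0" for i using i0(2) by (simp add: q_def)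
    then have "(\<Sum>i\<in>I'. c i * (M i j0 - q i * M i0 j0)) = 0" by (intro sum.neutral ballI)
    with c(3) have "\<forall>j\<in>insert j0 J. (\<Sum>i\<in>I. (c(i0 := s)) i * M i j) = 0"
      unfolding total by blast
    moreover have "\<forall>i\<in>I. (c(i0 := s)) i \<in> K" using c(1) s by (auto simp: I'_def)
    moreover have "\<exists>i\<in>I. (c(i0 := s)) i \<noteq> 0" using c(2) by (auto simp: I'_def)
    ultimately show ?thesis by blast
  qed
qed

section \<open>Algebraic elements and the tower property\<close>

lemma algebraic_over_polys: "algebraic_over K x \<longleftrightarrow> (\<exists>p\<in>polys_over K. p \<noteq> 0 \<and> poly p x = 0)"
  by (auto simp: algebraic_over_def polys_over_def)

lemma algebraic_over_mono: "K \<subseteq> E \<Longrightarrow> algebraic_over K x \<Longrightarrow> algebraic_over E x"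
  unfolding algebraic_over_polys using polys_over_mono by blast

lemma algebraic_over_base: "is_subring K \<Longrightarrow> x \<in> K \<Longrightarrow> algebraic_over K x"
  unfolding algebraic_over_polys
  by (intro bexI[of _ "[:-x, 1:]"])
    (auto simp: polys_over_def coeff_pCons subringD split: nat.splits)

text \<open>A nonzero v has a nonzero multiple \<open>v * w\<close> in K, which can be inverted
  there.\<close>

lemma adjoin_subfield:
  assumes K: "is_subfield K" and c: "algebraic_over K c"
  shows "is_subfield (adjoin K c)"
proof -
  note A = subfield_subring[OF K]
  obtain m where m: "minimal_over K m c" using c minimal_over_exists unfolding algebraic_over_polys by metis
  have "inverse v \<in> adjoin K c" if v: "v \<in> adjoin K c" for v
  proof (cases "v = 0")
    case False
    obtain w where w: "w \<in> adjoin K c" "v * w \<in> K" "v * w \<noteq> 0"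
      using algebraic_multiple_in_base[OF A m v False] .
    have "inverse v = w * inverse (v * w)" using w(3) by (simp add: field_simps)
    moreover have "inverse (v * w) \<in> adjoin K c" using subfield_inverse[OF K w(2)] subset_adjoin[OF A] by blast
    ultimately show ?thesis using subringD(4)[OF adjoin_subring[OF A] w(1)] by metis
  qed (use v in simp)
  then show ?thesis using adjoin_subring[OF A, of c] by (auto simp: is_subfield_def is_subring_def)
qed

lemma poly_sum_below: "r = 0 \<or> degree r < n \<Longrightarrow> poly r y = (\<Sum>i<n. coeff r i * y ^ i)"
  for y :: "'a::comm_ring_1"
proof (cases "r = 0")
  case False
  assume "r = 0 \<or> degree r < n"
  then show ?thesis
    unfolding poly_altdef using False by (intro sum.mono_neutral_left) (auto simp: coeff_eq_0)
qed simp

text \<open>Pseudo-division by m reduces every polynomial in y to degree below that of m; the power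
  of the leading coefficient that it introduces is invertible in K.\<close>

lemma powers_reduced:
  fixes y :: "'a::field"
  assumes K: "is_subfield K" and y: "algebraic_over K y"
  shows "\<exists>n. \<forall>v\<in>adjoin K y. \<exists>a. (\<forall>i. a i \<in> K) \<and> v = (\<Sum>i<n. a i * y ^ i)"
proof -
  note A = subfield_subring[OF K]
  obtain m where m: "minimal_over K m y" using y minimal_over_exists unfolding algebraic_over_polys by metis
  then have m': "m \<in> polys_over K" "m \<noteq> 0" "poly m y = 0" by (auto simp: minimal_over_def)
  have "\<exists>a. (\<forall>i. a i \<in> K) \<and> v = (\<Sum>i<degree m. a i * y ^ i)" if v: "v \<in> adjoin K y" for v
  proof -
    obtain p where p: "p \<in> polys_over K" "v = poly p y" using v by (auto simp: adjoin_def)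
    obtain N s r where r: "r \<in> polys_over K" "smult (lead_coeff m ^ N) p = m * s + r"
      "r = 0 \<or> degree r < degree m" using pseudo_division[OF A m'(1,2) p(1)] by blast
    have "lead_coeff m ^ N * v = poly r y" using arg_cong[OF r(2), of "\<lambda>q. poly q y"] p(2) m'(3) by simp
    also have "\<dots> = (\<Sum>i<degree m. coeff r i * y ^ i)" by (rule poly_sum_below[OF r(3)])
    finally have "v = inverse (lead_coeff m ^ N) * (\<Sum>i<degree m. coeff r i * y ^ i)"
      using m'(2) by (simp add: field_simps)
    then have "v = (\<Sum>i<degree m. inverse (lead_coeff m ^ N) * coeff r i * y ^ i)"
      by (simp add: sum_distrib_left mult_ac)
    moreover have "inverse (lead_coeff m ^ N) * coeff r i \<in> K" for i
      by (intro subringD(4)[OF A] subfield_inverse[OF K] subringD(7)[OF A] polys_overD[OF m'(1)] polys_overD[OF r(1)])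
    ultimately show ?thesis by (intro exI[of _ "\<lambda>i. inverse (lead_coeff m ^ N) * coeff r i"]) simp
  qed
  then show ?thesis by blast
qed

text \<open>Dimension count: all powers of y lie in the K-span of \<open>d * e\<close> products of a
  power of y and a power of c, so \<open>d * e + 1\<close> powers of y satisfy a nontrivial relation
  over K.\<close>

lemma algebraic_over_adjoin:
  assumes K: "is_subfield K" and c: "algebraic_over K c" and y: "algebraic_over (adjoin K c) y"
  shows "algebraic_over K y"
proof -
  let ?E = "adjoin K c"
  note E = adjoin_subfield[OF K c]
  obtain e where e: "\<And>v. v \<in> ?E \<Longrightarrow> \<exists>a. (\<forall>i. a i \<in> K) \<and> v = (\<Sum>i<e. a i * c ^ i)"
    using powers_reduced[OF K c] by blast
  obtain d where d: "\<And>v. v \<in> adjoin ?E y \<Longrightarrow> \<exists>a. (\<forall>i. a i \<in> ?E) \<and> v = (\<Sum>i<d. a i * y ^ i)"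
    using powers_reduced[OF E y] by blast
  have "\<exists>a. (\<forall>j. a j \<in> K) \<and> y ^ n = (\<Sum>j\<in>{..<d} \<times> {..<e}. a j * (y ^ fst j * c ^ snd j))" for n
  proof -
    have "y ^ n \<in> adjoin ?E y"
      using subringD(7)[OF adjoin_subring in_adjoin] subfield_subring[OF E] by blast
    then obtain a where a: "\<forall>i. a i \<in> ?E" "y ^ n = (\<Sum>i<d. a i * y ^ i)" using d by blast
    have "\<forall>i. \<exists>b. (\<forall>l. b l \<in> K) \<and> a i = (\<Sum>l<e. b l * c ^ l)" using e a(1) by blast
    from choice[OF this] obtain b where b: "\<And>i l. b i l \<in> K" "\<And>i. a i = (\<Sum>l<e. b i l * c ^ l)"
      by blast
    have "y ^ n = (\<Sum>i<d. \<Sum>l<e. b i l * (y ^ i * c ^ l))"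
      unfolding a(2) b(2) by (simp add: sum_distrib_left sum_distrib_right mult_ac)
    also have "\<dots> = (\<Sum>j\<in>{..<d} \<times> {..<e}. b (fst j) (snd j) * (y ^ fst j * c ^ snd j))"
      by (simp add: sum.cartesian_product case_prod_unfold)
    finally show ?thesis using b(1) by (intro exI[of _ "\<lambda>j. b (fst j) (snd j)"]) auto
  qed
  then have "\<forall>n. \<exists>a. (\<forall>j. a j \<in> K) \<and> y ^ n = (\<Sum>j\<in>{..<d} \<times> {..<e}. a j * (y ^ fst j * c ^ snd j))"
    by blast
  from choice[OF this] obtain M where M: "\<And>n j. M n j \<in> K"
    "\<And>n. y ^ n = (\<Sum>j\<in>{..<d} \<times> {..<e}. M n j * (y ^ fst j * c ^ snd j))" by blast
  obtain k where k: "\<forall>n\<in>{..d * e}. k n \<in> K" "\<exists>n\<in>{..d * e}. k n \<noteq> 0"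
    "\<forall>j\<in>{..<d} \<times> {..<e}. (\<Sum>n\<in>{..d * e}. k n * M n j) = 0"
    using homogeneous_solution[OF K, of "{..<d} \<times> {..<e}" "{..d * e}" M] M(1)
    by (auto simp: card_cartesian_product simp del: mult_eq_0_iff)
  define p where "p = (\<Sum>n\<le>d * e. monom (k n) n)"
  have cp: "coeff p n = (if n \<le> d * e then k n else 0)" for n
    unfolding p_def by (simp add: coeff_sum if_distrib[of "\<lambda>q. coeff q n"] sum.delta)
  have "p \<in> polys_over K" using k(1) subringD(1)[OF subfield_subring[OF K]] by (auto simp: polys_over_def cp)
  moreover have "p \<noteq> 0" using k(2) cp by (metis atMost_iff coeff_0)
  moreover have "poly p y = (\<Sum>n\<le>d * e. k n * y ^ n)" by (simp add: p_def poly_sum poly_monom)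
  then have "poly p y = (\<Sum>n\<le>d * e. \<Sum>j\<in>{..<d} \<times> {..<e}. k n * M n j * (y ^ fst j * c ^ snd j))"
    by (subst (asm) M(2)) (simp add: sum_distrib_left mult.assoc)
  then have "poly p y = (\<Sum>j\<in>{..<d} \<times> {..<e}. (\<Sum>n\<le>d * e. k n * M n j) * (y ^ fst j * c ^ snd j))"
    by (subst (asm) sum.swap) (simp add: sum_distrib_right)
  then have "poly p y = 0" using k(3) by simp
  ultimately show ?thesis unfolding algebraic_over_polys by blast
qed

lemma algebraic_over_adjoin_list:
  assumes K: "is_subfield K" and "\<forall>c\<in>set cs. algebraic_over K c"
  shows "is_subfield (adjoin_list K cs) \<and> (\<forall>y. algebraic_over (adjoin_list K cs) y \<longrightarrow> algebraic_over K y)"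
  using assms(2)
proof (induction cs)
  case (Cons c cs)
  then have *: "is_subfield (adjoin_list K cs)" "\<And>y. algebraic_over (adjoin_list K cs) y \<Longrightarrow> algebraic_over K y"
    and c: "algebraic_over K c" by simp_all
  have c': "algebraic_over (adjoin_list K cs) c"
    using algebraic_over_mono[OF subset_adjoin_list[OF subfield_subring[OF K]] c] .
  show ?case using adjoin_subfield[OF *(1) c'] algebraic_over_adjoin[OF *(1) c'] *(2) by simp
qed (use K in auto)

text \<open>A root of p is algebraic over the field generated by the finitely many coefficients of
  p, hence over K by the tower property.\<close>

lemma alg_closure_rel_alg_closed:
  fixes K :: "'a::alg_closed_field set"
  assumes K: "is_subfield K" shows "rel_alg_closed (alg_closure_of K)"
  unfolding rel_alg_closed_def
proof (intro ballI impI)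
  fix p :: "'a poly" assume p: "p \<in> polys_over (alg_closure_of K)" "degree p > 0"
  then obtain x where x: "poly p x = 0" using alg_closed_imp_poly_has_root by blast
  have "p \<in> polys_over (adjoin_list K (coeffs p))"
  proof (rule polys_overI)
    fix i show "coeff p i \<in> adjoin_list K (coeffs p)"
      using set_subset_adjoin_list[OF subfield_subring[OF K], of "coeffs p"]
        subringD(1)[OF adjoin_list_subring[OF subfield_subring[OF K]], of "coeffs p"]
        coeff_in_coeffs[of p i] le_degree[of p i]
      by (cases "coeff p i = 0"; cases "p = 0") auto
  qed
  then have "algebraic_over (adjoin_list K (coeffs p)) x"
    unfolding algebraic_over_polys using x p(2) by (intro bexI[of _ p]) auto
  moreover have "\<forall>c\<in>set (coeffs p). algebraic_over K c"
    using p(1) by (auto simp: polys_over_def alg_closure_in_def coeffs_def)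
  ultimately have "algebraic_over K x" using algebraic_over_adjoin_list[OF K] by blast
  then show "\<exists>x\<in>alg_closure_of K. poly p x = 0" using x by (auto simp: alg_closure_in_def)
qed

section \<open>Regular extensions\<close>

text \<open>An embedding does not kill the leading coefficient of m, so every root of the image of m
  is a possible value for x. The extension stays injective because each nonzero element has a
  nonzero multiple in B.\<close>

lemma embedding_extend:
  fixes \<phi> :: "'a::idom \<Rightarrow> 'b::alg_closed_field"
  assumes B: "is_subring B" and \<phi>: "ring_hom_on B \<phi>" "\<And>b. b \<in> B \<Longrightarrow> \<phi> b = 0 \<Longrightarrow> b = 0"
    and m: "minimal_over B m x" and \<xi>: "poly (map_poly \<phi> m) \<xi> = 0"
  obtains \<psi> where "ring_hom_on (adjoin B x) \<psi>" "\<And>b. b \<in> adjoin B x \<Longrightarrow> \<psi> b = 0 \<Longrightarrow> b = 0"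
    "\<And>b. b \<in> B \<Longrightarrow> \<psi> b = \<phi> b" "\<psi> x = \<xi>"
proof -
  have m': "m \<in> polys_over B" "m \<noteq> 0" using m by (auto simp: minimal_over_def)
  have lc: "\<phi> (lead_coeff m) \<noteq> 0" using \<phi>(2) polys_overD[OF m'(1)] m'(2) by (metis leading_coeff_0_iff)
  obtain \<psi> where \<psi>: "ring_hom_on (adjoin B x) \<psi>"
    "\<And>p. p \<in> polys_over B \<Longrightarrow> \<psi> (poly p x) = poly (map_poly \<phi> p) \<xi>" "\<And>a. a \<in> B \<Longrightarrow> \<psi> a = \<phi> a"
    using hom_extend[OF B \<phi>(1) minimal_over_kernel[OF B \<phi>(1) m lc \<xi>]] by metis
  have "\<psi> x = \<xi>" using \<psi>(2)[OF polys_over_X[OF B]] by (simp add: map_poly_pCons ring_hom_onD[OF \<phi>(1) B])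
  moreover have "b = 0" if b: "b \<in> adjoin B x" "\<psi> b = 0" for b
  proof (rule ccontr)
    assume "b \<noteq> 0"
    then obtain w where w: "w \<in> adjoin B x" "b * w \<in> B" "b * w \<noteq> 0"
      using algebraic_multiple_in_base[OF B m b(1)] by blast
    then show False
      using ring_hom_onD(4)[OF \<psi>(1) adjoin_subring[OF B] b(1) w(1)] b(2) \<psi>(3)[OF w(2)] \<phi>(2)[OF w(2)]
      by simp
  qed
  ultimately show ?thesis using that \<psi> by blast
qed

lemma embedding_extend_list:
  fixes \<phi> :: "'a::idom \<Rightarrow> 'b::alg_closed_field"
  assumes B: "is_subring B" and \<phi>: "ring_hom_on B \<phi>" "\<And>b. b \<in> B \<Longrightarrow> \<phi> b = 0 \<Longrightarrow> b = 0"
    and xs: "\<forall>x\<in>set xs. \<exists>p\<in>polys_over B. p \<noteq> 0 \<and> poly p x = 0"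
  shows "\<exists>\<psi>. ring_hom_on (adjoin_list B xs) \<psi> \<and> (\<forall>b\<in>adjoin_list B xs. \<psi> b = 0 \<longrightarrow> b = 0) \<and> (\<forall>b\<in>B. \<psi> b = \<phi> b)"
  using xs
proof (induction xs)
  case (Cons x xs)
  let ?B = "adjoin_list B xs"
  obtain \<psi> where \<psi>: "ring_hom_on ?B \<psi>" "\<forall>b\<in>?B. \<psi> b = 0 \<longrightarrow> b = 0" "\<forall>b\<in>B. \<psi> b = \<phi> b"
    using Cons by auto
  obtain m where m: "minimal_over ?B m x"
    using Cons.prems polys_over_mono[OF subset_adjoin_list[OF B, of xs]] minimal_over_exists[of _ ?B x]
    by (metis list.set_intros(1) subsetD)
  have "\<psi> (lead_coeff m) \<noteq> 0"
    using \<psi>(2) m polys_overD[of m ?B] by (auto simp: minimal_over_def)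
  then have "degree (map_poly \<psi> m) > 0" using map_poly_degree_eq[of \<psi> m] minimal_over_degree[OF m] by simp
  then obtain \<xi> where \<xi>: "poly (map_poly \<psi> m) \<xi> = 0" using alg_closed_imp_poly_has_root by blast
  have inj: "b = 0" if "b \<in> ?B" "\<psi> b = 0" for b using \<psi>(2) that by blast
  obtain \<psi>' where "ring_hom_on (adjoin ?B x) \<psi>'" "\<And>b. b \<in> adjoin ?B x \<Longrightarrow> \<psi>' b = 0 \<Longrightarrow> b = 0"
    "\<And>b. b \<in> ?B \<Longrightarrow> \<psi>' b = \<psi> b"
    using embedding_extend[OF adjoin_list_subring[OF B] \<psi>(1) inj m \<xi>] by metis
  then show ?case using \<psi>(3) subset_adjoin_list[OF B, of xs] by (intro exI[of _ \<psi>']) auto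
qed (use \<phi> in auto)

lemma hom_poly:
  assumes \<phi>: "ring_hom_on A \<phi>" and A: "is_subring A" and p: "p \<in> polys_over A" and x: "x \<in> A"
  shows "\<phi> (poly p x) = poly (map_poly \<phi> p) (\<phi> x)"
proof -
  have "\<phi> (poly p x) = (\<Sum>i\<le>degree p. \<phi> (coeff p i) * \<phi> x ^ i)"
    unfolding poly_altdef using polys_overD[OF p] x
    by (subst ring_hom_on_sum[OF \<phi> A]) (auto simp: ring_hom_onD[OF \<phi> A] subringD[OF A])
  also have "\<dots> = poly (map_poly \<phi> p) (\<phi> x)"
  proof -
    have "poly (map_poly \<phi> p) (\<phi> x) = (\<Sum>i<Suc (degree p). coeff (map_poly \<phi> p) i * \<phi> x ^ i)"
      by (rule poly_sum_below) (use map_poly_degree_leq[of \<phi> p] in auto)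
    then show ?thesis by (simp add: coeff_map_poly ring_hom_onD[OF \<phi> A] lessThan_Suc_atMost)
  qed
  finally show ?thesis .
qed

lemma coeff_pcompose_monom:
  "0 < n \<Longrightarrow> coeff (pcompose q (monom (1 :: 'a::comm_ring_1) n)) (n * i) = coeff q i"
proof (induction q arbitrary: i rule: pCons_induct)
  case (pCons a q)
  then show ?case by (cases i) (simp_all add: pcompose_pCons coeff_monom_mult coeff_pCons split: nat.split)
qed simp

lemma pcompose_pow: "pcompose (p ^ n) q = pcompose p q ^ n" for p :: "'a::comm_ring_1 poly"
  by (induction n) (simp_all add: pcompose_mult pcompose_1)

text \<open>If d is nonzero in the field, the coefficient d a of degree d - 1 yields a itself.
  Otherwise Frobenius turns the power into one of X + a^p, evaluated at X^p, and the argument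
  repeats. The last clause matters because \<open>0 ^ n\<close> is 0 for positive n, which would
  make the claim trivial in characteristic 0.\<close>

lemma linear_power_descends:
  fixes a :: "'a::field"
  assumes E: "is_subfield E" and "[:a, 1:] ^ d \<in> polys_over E" "d > 0"
  shows "\<exists>n. a ^ (CHAR('a) ^ n) \<in> E \<and> (CHAR('a) = 0 \<longrightarrow> n = 0)"
  using assms(2-)
proof (induction d arbitrary: a rule: less_induct)
  case (less d)
  show ?case
  proof (cases "of_nat d = (0::'a)")
    case False
    have "coeff ([:a, 1:] ^ d) (d - 1) = of_nat d * a"
      using less.prems(2) by (cases d) (simp_all add: coeff_linear_poly_power del: power_Suc)
    then have "of_nat d * a \<in> E" using polys_overD[OF less.prems(1)] by metis
    moreover have "of_nat d \<in> E" for d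
      by (induction d) (use subringD[OF subfield_subring[OF E]] in auto)
    ultimately have "(of_nat d * a) / of_nat d \<in> E" by (intro subfield_divide[OF E])
    then show ?thesis using False by (intro exI[of _ 0]) auto
  next
    case True
    let ?p = "CHAR('a)"
    have "?p dvd d" using True by (simp add: of_nat_eq_0_iff_char_dvd)
    then obtain e where e: "d = ?p * e" by blast
    then have pos: "?p > 0" "e > 0" using less.prems(2) by auto
    then have p: "prime ?p" using prime_CHAR_semidom by blast
    have "[:a, 1:] ^ ?p = (monom 1 1 + [:a:]) ^ CHAR('a poly)" by (simp add: monom_altdef)
    also have "\<dots> = monom 1 1 ^ ?p + [:a:] ^ ?p" using p by (subst freshmans_dream) auto
    also have "\<dots> = monom 1 ?p + [:a ^ ?p:]" by (simp add: monom_power poly_const_pow)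
    also have "\<dots> = pcompose [:a ^ ?p, 1:] (monom 1 ?p)" by (simp add: pcompose_pCons)
    finally have "[:a, 1:] ^ d = pcompose ([:a ^ ?p, 1:] ^ e) (monom 1 ?p)"
      by (simp add: e power_mult pcompose_pow)
    then have "coeff ([:a ^ ?p, 1:] ^ e) i \<in> E" for i
      using polys_overD[OF less.prems(1)] coeff_pcompose_monom[OF pos(1)] by metis
    moreover have "e < d" using e pos prime_gt_1_nat[OF p] by simp
    ultimately obtain n where "(a ^ ?p) ^ (?p ^ n) \<in> E" using less.IH[of e "a ^ ?p"] pos(2)
      by (auto simp: polys_over_def)
    then show ?thesis using pos by (intro exI[of _ "Suc n"]) (simp add: power_mult[symmetric])
  qed
qed

text \<open>If c is the only root of m, then m is a constant times a power of X - c, and dividing by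
  the constant leaves that power with coefficients in E.\<close>

lemma conjugate_or_purely_inseparable:
  fixes c :: "'a::alg_closed_field"
  assumes E: "is_subfield E" and m: "minimal_over E m c"
  shows "(\<exists>c'. c' \<noteq> c \<and> poly m c' = 0) \<or> (\<exists>n. c ^ (CHAR('a) ^ n) \<in> E \<and> (CHAR('a) = 0 \<longrightarrow> n = 0))"
proof (cases "\<exists>c'. c' \<noteq> c \<and> poly m c' = 0")
  case False
  note A = subringD[OF subfield_subring[OF E]]
  have m': "m \<in> polys_over E" "m \<noteq> 0" using m by (auto simp: minimal_over_def)
  obtain R where R: "size R = degree m" "m = smult (lead_coeff m) (\<Prod>x\<in>#R. [:-x, 1:])"
    using alg_closed_imp_factorization[OF m'(2)] by blast
  have "x = c" if "x \<in># R" for x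
  proof -
    have "poly m x = 0" by (subst R(2)) (use that in \<open>auto simp: poly_prod_mset image_iff\<close>)
    then show ?thesis using False by blast
  qed
  then have "set_mset R \<subseteq> {c}" by auto
  then have "R = replicate_mset (degree m) c"
    using R(1) by (metis set_mset_subset_singletonD)
  then have mc: "m = smult (lead_coeff m) ([:-c, 1:] ^ degree m)" using R(2) by simp
  have "[:-c, 1:] ^ degree m = smult (inverse (lead_coeff m)) m"
    by (subst (2) mc) (use m'(2) in simp)
  also have "\<dots> \<in> polys_over E"
    using m'(1) polys_overD[OF m'(1)] by (intro polys_over_smult subfield_subring subfield_inverse E)
  finally obtain n where n: "(- c) ^ (CHAR('a) ^ n) \<in> E" "CHAR('a) = 0 \<longrightarrow> n = 0"
    using linear_power_descends[OF E] minimal_over_degree[OF m] by blast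
  \<comment> \<open>The previous lemma was applied to -c; an odd exponent only changes the
    sign.\<close>
  have "c ^ (CHAR('a) ^ n) \<in> E"
    using n(1) A(5)[OF n(1)] by (cases "even (CHAR('a) ^ n)") auto
  then show ?thesis using n(2) by (intro disjI2 exI[of _ n]) simp
qed simp

text \<open>One condition covers both cases of the definition: in characteristic 0 it forces n = 0,
  and then x itself lies in K.\<close>

lemma perfect_closure_iff:
  "x \<in> perfect_closure K \<longleftrightarrow> (\<exists>n. x ^ (CHAR('a) ^ n) \<in> K \<and> (CHAR('a) = 0 \<longrightarrow> n = 0))"
  for x :: "'a::alg_closed_field"
  by (auto simp: perfect_closure_def)

text \<open>
  A shortest relation over the algebraic closure of K, normalized at one place, is fixed by all
  embeddings over E, so its coefficients are purely inseparable over K.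
\<close>

lemma regular_extension:
  fixes K E L :: "'a::alg_closed_field set" and c v :: "'i \<Rightarrow> 'a"
  assumes K: "is_subfield K" and Kbar: "is_subfield (alg_closure_of K)"
    and E: "is_subfield E" "K \<subseteq> E" "E \<subseteq> L" "alg_closure_in E K = K"
    and sep: "separable_over K L"
    and "finite I" "\<And>i. i \<in> I \<Longrightarrow> v i \<in> E" "\<And>i. i \<in> I \<Longrightarrow> c i \<in> alg_closure_of K"
      "\<exists>i\<in>I. c i \<noteq> 0" "(\<Sum>i\<in>I. c i * v i) = 0"
  shows "\<exists>k. (\<forall>i\<in>I. k i \<in> K) \<and> (\<exists>i\<in>I. k i \<noteq> 0) \<and> (\<Sum>i\<in>I. k i * v i) = 0"
  using assms(8-)
proof (induction I arbitrary: c rule: finite_psubset_induct)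
  case (psubset I)
  let ?C = "alg_closure_of K"
  note A = subringD[OF subfield_subring[OF Kbar]] and AK = subringD[OF subfield_subring[OF K]]
  \<comment> \<open>A relation whose coefficient at \<open>i0\<close> is 0 lives on a smaller index
    set. The induction hypothesis applies there, and the missing coefficient is filled in as
    0.\<close>
  have shorter: ?case if d: "\<And>i. i \<in> I \<Longrightarrow> d i \<in> ?C" "\<exists>i\<in>I. d i \<noteq> 0" "(\<Sum>i\<in>I. d i * v i) = 0"
    and i0: "i0 \<in> I" "d i0 = 0" for d i0
  proof -
    have "(\<Sum>i\<in>I - {i0}. d i * v i) = 0"
      using d(3) i0 psubset.hyps by (simp add: sum.remove[of I i0])
    moreover have "\<exists>i\<in>I - {i0}. d i \<noteq> 0" using d(2) i0 by auto
    moreover have "I - {i0} \<subset> I" using i0 by auto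
    ultimately obtain k where k: "\<forall>i\<in>I - {i0}. k i \<in> K" "\<exists>i\<in>I - {i0}. k i \<noteq> 0"
      "(\<Sum>i\<in>I - {i0}. k i * v i) = 0" using psubset.IH[of "I - {i0}" d] d(1) psubset.prems(1) by auto
    have "(\<Sum>i\<in>I. (k(i0 := 0)) i * v i) = (\<Sum>i\<in>I - {i0}. k i * v i)"
      using i0 psubset.hyps by (simp add: sum.remove[of I i0])
    then show ?thesis using k AK(1) by (intro exI[of _ "k(i0 := 0)"]) auto
  qed
  obtain i0 where i0: "i0 \<in> I" "c i0 \<noteq> 0" using psubset.prems by blast
  define b where "b i = c i / c i0" for i
  have b: "b i \<in> ?C" if "i \<in> I" for i
    unfolding b_def using that i0 psubset.prems subfield_divide[OF Kbar] by auto
  have b0: "b i0 = 1" using i0 by (simp add: b_def)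
  have bsum: "(\<Sum>i\<in>I. b i * v i) = 0"
    using psubset.prems(4) i0(2) by (simp add: b_def sum_divide_distrib[symmetric] divide_simps)
  show ?case
  proof (cases "\<forall>i\<in>I. b i \<in> perfect_closure K")
    case True
    show ?thesis
    proof (cases "inj_on v I")
      \<comment> \<open>Linear disjointness speaks of sets of vectors, so the family v can be fed to
        it only when it is injective.\<close>
      case inj: True
      define e where "e x = b (the_inv_into I v x)" for x
      have e: "e (v i) = b i" if "i \<in> I" for i using inj that by (simp add: e_def the_inv_into_f_f)
      have "(\<Sum>x\<in>v ` I. e x * x) = 0" using bsum e by (simp add: sum.reindex[OF inj])
      then have "\<not> lin_indep_over (perfect_closure K) (v ` I)"
        unfolding lin_indep_over_def using True e i0(1) b0 by (auto intro!: exI[of _ e] bexI[of _ i0])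
      then have "\<not> lin_indep_over K (v ` I)"
        using sep psubset.hyps psubset.prems(1) E(3)
        unfolding separable_over_def linearly_disjoint_over_def by blast
      then obtain k where "\<forall>x\<in>v ` I. k x \<in> K" "(\<Sum>x\<in>v ` I. k x * x) = 0" "\<exists>x\<in>v ` I. k x \<noteq> 0"
        unfolding lin_indep_over_def by blast
      then show ?thesis by (intro exI[of _ "k \<circ> v"]) (auto simp: sum.reindex[OF inj])
    next
      case False
      then obtain i j where ij: "i \<in> I" "j \<in> I" "i \<noteq> j" "v i = v j" by (auto simp: inj_on_def)
      \<comment> \<open>A repeated vector gives the relation \<open>v i - v j = 0\<close> over
        K.\<close>
      define k :: "'i \<Rightarrow> 'a" where "k l = (if l = i then 1 else if l = j then -1 else 0)" for l
      have "(\<Sum>l\<in>I. k l * v l) = (\<Sum>l\<in>{i, j}. k l * v l)"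
        using ij psubset.hyps by (intro sum.mono_neutral_right) (auto simp: k_def)
      also have "\<dots> = 0" using ij by (simp add: k_def)
      finally show ?thesis using ij AK by (intro exI[of _ k]) (auto simp: k_def intro!: bexI[of _ i])
    qed
  next
    case False
    then obtain j where j: "j \<in> I" "b j \<notin> perfect_closure K" by blast
    note AE = subfield_subring[OF E(1)]
    have alg: "\<exists>p\<in>polys_over K. p \<noteq> 0 \<and> poly p (b i) = 0" if "i \<in> I" for i
      using b[OF that] by (auto simp: alg_closure_in_def algebraic_over_polys)
    then have algE: "\<exists>p\<in>polys_over E. p \<noteq> 0 \<and> poly p (b i) = 0" if "i \<in> I" for i
      using that polys_over_mono[OF E(2)] by blast
    obtain p0 where p0: "p0 \<in> polys_over E" "p0 \<noteq> 0" "poly p0 (b j) = 0" using algE[OF j(1)] by blast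
    obtain m where m: "minimal_over E m (b j)" using minimal_over_exists[OF p0] .
    \<comment> \<open>A p-power of \<open>b j\<close> inside E would be algebraic over K, hence in K
      by \<open>E(4)\<close>, and \<open>b j\<close> would lie in the perfect closure.\<close>
    have nps: "\<not> (\<exists>n. b j ^ (CHAR('a) ^ n) \<in> E \<and> (CHAR('a) = 0 \<longrightarrow> n = 0))"
    proof (intro notI, elim exE conjE)
      fix n assume n: "b j ^ (CHAR('a) ^ n) \<in> E" "CHAR('a) = 0 \<longrightarrow> n = 0"
      have "b j ^ (CHAR('a) ^ n) \<in> ?C" using A(7)[OF b[OF j(1)]] .
      then have "b j ^ (CHAR('a) ^ n) \<in> alg_closure_in E K" using n(1) by (simp add: alg_closure_in_def)
      then have "b j \<in> perfect_closure K" using n(2) E(4) unfolding perfect_closure_iff by (intro exI[of _ n]) simp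
      then show False using j(2) by contradiction
    qed
    from conjugate_or_purely_inseparable[OF E(1) m] have "\<exists>c'. c' \<noteq> b j \<and> poly m c' = 0"
      by (rule disjE) (assumption, erule notE[OF nps])
    then obtain c' where c': "c' \<noteq> b j" "poly m c' = 0" by blast
    have "ring_hom_on E (\<lambda>x. x)" "\<And>x. x \<in> E \<Longrightarrow> x = 0 \<Longrightarrow> x = 0" "poly (map_poly (\<lambda>x. x) m) c' = 0"
      using c'(2) by (simp_all add: ring_hom_on_def)
    from embedding_extend[OF AE this(1,2) m this(3)] obtain \<psi> where \<psi>: "ring_hom_on (adjoin E (b j)) \<psi>"
      "\<And>x. x \<in> adjoin E (b j) \<Longrightarrow> \<psi> x = 0 \<Longrightarrow> x = 0" "\<And>x. x \<in> E \<Longrightarrow> \<psi> x = x" "\<psi> (b j) = c'"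
      by metis
    obtain il where il: "set il = I" using finite_list[OF psubset.hyps] by blast
    \<comment> \<open>Large enough to contain all coefficients \<open>b i\<close>, so that the
      embedding moving \<open>b j\<close> to a different conjugate and fixing E can be applied to
      the whole relation.\<close>
    let ?B = "adjoin_list (adjoin E (b j)) (map b il)"
    have "\<forall>x\<in>set (map b il). \<exists>p\<in>polys_over (adjoin E (b j)). p \<noteq> 0 \<and> poly p x = 0"
      using algE il polys_over_mono[OF subset_adjoin[OF AE, of "b j"]] by fastforce
    from embedding_extend_list[OF adjoin_subring[OF AE] \<psi>(1,2) this] obtain \<tau> where \<tau>: "ring_hom_on ?B \<tau>" "\<forall>x\<in>adjoin E (b j). \<tau> x = \<psi> x"
      by metis
    note AEb = adjoin_subring[OF AE, of "b j"]
    have B: "is_subring ?B" "E \<subseteq> ?B"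
      using adjoin_list_subring[OF AEb] subset_adjoin_list[OF AEb, of "map b il"] subset_adjoin[OF AE, of "b j"]
      by auto
    have bB: "b i \<in> ?B" if "i \<in> I" for i
      using set_subset_adjoin_list[OF AEb, of "map b il"] il that by auto
    have vB: "v i \<in> ?B" if "i \<in> I" for i using psubset.prems(1) B(2) that by blast
    have \<tau>E: "\<tau> x = x" if "x \<in> E" for x
      using \<tau>(2) \<psi>(3)[OF that] that subset_adjoin[OF AE, of "b j"] by (metis subsetD)
    have \<tau>j: "\<tau> (b j) = c'" using \<tau>(2) \<psi>(4) in_adjoin[OF AE, of "b j"] by simp
    have \<tau>C: "\<tau> (b i) \<in> ?C" if i: "i \<in> I" for i
    proof -
      obtain p where p: "p \<in> polys_over K" "p \<noteq> 0" "poly p (b i) = 0" using alg[OF i] by blast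
      have "map_poly \<tau> p = p" using polys_overD[OF p(1)] E(2) \<tau>E ring_hom_onD(1)[OF \<tau>(1) B(1)]
        by (intro poly_eqI) (auto simp: coeff_map_poly)
      moreover have "p \<in> polys_over ?B" using p(1) E(2) B(2) polys_over_mono[of K ?B] by blast
      ultimately have "poly p (\<tau> (b i)) = \<tau> 0"
        using hom_poly[OF \<tau>(1) B(1) _ bB[OF i], of p] p(3) by simp
      then show ?thesis using p(1,2) ring_hom_onD(1)[OF \<tau>(1) B(1)]
        by (auto simp: alg_closure_in_def algebraic_over_polys)
    qed
    have "\<tau> (\<Sum>i\<in>I. b i * v i) = (\<Sum>i\<in>I. \<tau> (b i) * v i)"
      using bB vB psubset.prems(1) \<tau>E
      by (subst ring_hom_on_sum[OF \<tau>(1) B(1)])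
        (simp_all add: subringD(4)[OF B(1)] ring_hom_onD(4)[OF \<tau>(1) B(1)])
    \<comment> \<open>As \<tau> fixes every \<open>v i\<close>, the image is again a relation.
      Subtracting the original one kills the coefficient at \<open>i0\<close>, where b is 1, but not
      the coefficient at j.\<close>
    then have \<tau>sum: "(\<Sum>i\<in>I. (\<tau> (b i) - b i) * v i) = 0"
      using bsum ring_hom_onD(1)[OF \<tau>(1) B(1)] by (simp add: algebra_simps sum_subtractf)
    show ?thesis
    proof (rule shorter[OF _ _ \<tau>sum i0(1)])
      show "\<tau> (b i) - b i \<in> ?C" if "i \<in> I" for i using A(6)[OF \<tau>C[OF that] b[OF that]] .
      show "\<exists>i\<in>I. \<tau> (b i) - b i \<noteq> 0" using j(1) \<tau>j c'(1) by auto
      show "\<tau> (b i0) - b i0 = 0" using b0 ring_hom_onD(2)[OF \<tau>(1) B(1)] by simp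
    qed
  qed
qed

section \<open>Evaluation of polynomials at matrices\<close>

lemma UNIV_subring: "is_subring (UNIV :: 'a::comm_ring_1 set)"
  by (simp add: is_subring_def)

lemma lookup_map0: "f 0 = 0 \<Longrightarrow> Poly_Mapping.lookup (Poly_Mapping.map f p) k = f (Poly_Mapping.lookup p k)"
  by (simp add: Poly_Mapping.map.rep_eq when_def)

abbreviation scale :: "'a::mult_zero \<Rightarrow> ('m \<Rightarrow>\<^sub>0 'a) \<Rightarrow> ('m \<Rightarrow>\<^sub>0 'a)" where
  "scale c \<equiv> Poly_Mapping.map ((*) c)"

lemma lookup_scale: "Poly_Mapping.lookup (scale c h) m = c * Poly_Mapping.lookup h m"
  by (simp add: lookup_map0)

lemma coeffs_in_arith:
  assumes "is_subring S"
  shows "coeffs_in S 0" "coeffs_in S h \<Longrightarrow> coeffs_in S h' \<Longrightarrow> coeffs_in S (h + h')"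
    "coeffs_in S h \<Longrightarrow> coeffs_in S h' \<Longrightarrow> coeffs_in S (h - h')"
    "c \<in> S \<Longrightarrow> coeffs_in S (Poly_Mapping.single m c)"
    "c \<in> S \<Longrightarrow> coeffs_in S h \<Longrightarrow> coeffs_in S (scale c h)"
  by (auto simp: coeffs_in_def lookup_add lookup_minus lookup_single lookup_scale when_def subringD[OF assms])

lemma coeffs_in_mono: "S \<subseteq> T \<Longrightarrow> coeffs_in S h \<Longrightarrow> coeffs_in T h"
  by (auto simp: coeffs_in_def)

lemma sum_single_lookup:
  "finite T \<Longrightarrow> Poly_Mapping.keys h \<subseteq> T \<Longrightarrow> (\<Sum>m\<in>T. Poly_Mapping.single m (Poly_Mapping.lookup h m)) = h"
  by (intro poly_mapping_eqI)
    (auto simp: lookup_sum lookup_single when_def sum.delta in_keys_iff)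

lemma coeffs_in_induct [consumes 2, case_names zero add]:
  assumes S: "is_subring S" and "coeffs_in S h"
    and 0: "P 0" and add: "\<And>m c h. c \<in> S \<Longrightarrow> coeffs_in S h \<Longrightarrow> P h \<Longrightarrow> P (Poly_Mapping.single m c + h)"
  shows "P h"
proof -
  have "P (\<Sum>m\<in>T. Poly_Mapping.single m (Poly_Mapping.lookup h m)) \<and>
    coeffs_in S (\<Sum>m\<in>T. Poly_Mapping.single m (Poly_Mapping.lookup h m))" if "finite T" for T
    using that
  proof (induction T)
    case (insert m T)
    have "Poly_Mapping.lookup h m \<in> S" using \<open>coeffs_in S h\<close> by (simp add: coeffs_in_def)
    then show ?case using insert add[of _ _ m]
      by (auto intro: coeffs_in_arith(2,4)[OF S])
  qed (use 0 coeffs_in_arith[OF S] in auto)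
  from this[of "Poly_Mapping.keys h"] show ?thesis by (simp add: sum_single_lookup)
qed

lemma coeffs_in_mult:
  fixes h h' :: "'m::monoid_add \<Rightarrow>\<^sub>0 'a::comm_ring_1"
  assumes S: "is_subring S" and h: "coeffs_in S h" and h': "coeffs_in S h'"
  shows "coeffs_in S (h * h')"
proof -
  have 1: "coeffs_in S (Poly_Mapping.single m c * h')" if "c \<in> S" for m c
    using S h'
  proof (induction h' rule: coeffs_in_induct)
    case (add m' c' h')
    then show ?case using that
      by (simp add: distrib_left mult_single coeffs_in_arith[OF S] subringD[OF S])
  qed (simp add: coeffs_in_arith[OF S])
  show ?thesis using S h
    by (induction h rule: coeffs_in_induct) (simp_all add: distrib_right coeffs_in_arith[OF S] 1)
qed

definition gl_var :: "'b^'r^'r \<Rightarrow> 'b \<Rightarrow> ('r \<times> 'r) option \<Rightarrow> 'b" where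
  "gl_var A d v = (case v of None \<Rightarrow> d | Some (i, j) \<Rightarrow> A $ i $ j)"

definition gl_monom :: "'b::comm_ring_1^'r^'r \<Rightarrow> 'b \<Rightarrow> (('r \<times> 'r) option \<Rightarrow>\<^sub>0 nat) \<Rightarrow> 'b" where
  "gl_monom A d m = (\<Prod>v\<in>Poly_Mapping.keys m. gl_var A d v ^ Poly_Mapping.lookup m v)"

lemma gl_eval_monom:
  "gl_eval \<phi> A d h = (\<Sum>m\<in>Poly_Mapping.keys h. \<phi> (Poly_Mapping.lookup h m) * gl_monom A d m)"
  by (simp add: gl_eval_def gl_monom_def gl_var_def)

lemma gl_monom_superset:
  "finite T \<Longrightarrow> Poly_Mapping.keys m \<subseteq> T \<Longrightarrow> gl_monom A d m = (\<Prod>v\<in>T. gl_var A d v ^ Poly_Mapping.lookup m v)"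
  unfolding gl_monom_def by (intro prod.mono_neutral_left) (auto simp: in_keys_iff)

lemma gl_monom_add: "gl_monom A d (m + m') = gl_monom A d m * gl_monom A d m'"
  using keys_add[of m m']
  by (simp add: gl_monom_superset[of "Poly_Mapping.keys m \<union> Poly_Mapping.keys m'"]
      lookup_add power_add prod.distrib)

lemma gl_monom_zero: "gl_monom A d 0 = 1"
  by (simp add: gl_monom_def)

lemma gl_monom_single: "gl_monom A d (Poly_Mapping.single v n) = gl_var A d v ^ n"
  by (simp add: gl_monom_def)

text \<open>
  Partial equivalence relations, as the relations of the tensor product form an ideal only among
  the formal tensors with entries in L.
\<close>

locale ring_per =
  fixes eq :: "'b::comm_ring_1 \<Rightarrow> 'b \<Rightarrow> bool" (infix "\<doteq>" 50)
  assumes sym: "x \<doteq> y \<Longrightarrow> y \<doteq> x" and trans [trans]: "x \<doteq> y \<Longrightarrow> y \<doteq> z \<Longrightarrow> x \<doteq> z"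
    and zero: "0 \<doteq> 0" and one: "1 \<doteq> 1"
    and add: "x \<doteq> y \<Longrightarrow> x' \<doteq> y' \<Longrightarrow> x + x' \<doteq> y + y'"
    and mult: "x \<doteq> y \<Longrightarrow> x' \<doteq> y' \<Longrightarrow> x * x' \<doteq> y * y'"
begin

lemma refl_left: "x \<doteq> y \<Longrightarrow> x \<doteq> x" using sym trans by blast
lemma refl_right: "x \<doteq> y \<Longrightarrow> y \<doteq> y" using sym trans by blast

lemma sum: "(\<And>i. i \<in> I \<Longrightarrow> f i \<doteq> g i) \<Longrightarrow> sum f I \<doteq> sum g I"
  by (induction I rule: infinite_finite_induct) (auto intro: zero add)

lemma prod: "(\<And>i. i \<in> I \<Longrightarrow> f i \<doteq> g i) \<Longrightarrow> prod f I \<doteq> prod g I"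
  by (induction I rule: infinite_finite_induct) (auto intro: one mult)

lemma power: "x \<doteq> y \<Longrightarrow> x ^ n \<doteq> y ^ n"
  by (induction n) (auto intro: one mult)

lemma gl_monom:
  fixes A A' :: "'b^'r^'r"
  assumes "\<And>i j. A $ i $ j \<doteq> A' $ i $ j" "d \<doteq> d'"
  shows "gl_monom A d m \<doteq> gl_monom A' d' m"
  unfolding gl_monom_def
  by (intro prod power) (use assms in \<open>auto simp: gl_var_def split: option.split\<close>)

lemma gl_eval_cong:
  fixes A A' :: "'b^'r^'r"
  assumes "\<And>i j. A $ i $ j \<doteq> A' $ i $ j" "d \<doteq> d'" "\<And>m. \<phi> (Poly_Mapping.lookup h m) \<doteq> \<phi>' (Poly_Mapping.lookup h m)"
  shows "gl_eval \<phi> A d h \<doteq> gl_eval \<phi>' A' d' h"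
  unfolding gl_eval_monom by (intro sum mult gl_monom assms)

definition matrix_eq :: "'b^'n^'m \<Rightarrow> 'b^'n^'m \<Rightarrow> bool" (infix "\<doteq>\<^sub>M" 50) where
  "A \<doteq>\<^sub>M B \<longleftrightarrow> (\<forall>i j. A $ i $ j \<doteq> B $ i $ j)"

lemma matrix_eq_mult: "A \<doteq>\<^sub>M A' \<Longrightarrow> B \<doteq>\<^sub>M B' \<Longrightarrow> A ** B \<doteq>\<^sub>M A' ** B'"
  by (auto simp: matrix_eq_def matrix_matrix_mult_def intro!: sum mult)

lemma matrix_eq_trans [trans]: "A \<doteq>\<^sub>M B \<Longrightarrow> B \<doteq>\<^sub>M C \<Longrightarrow> A \<doteq>\<^sub>M C"
  unfolding matrix_eq_def using trans by blast

lemma matrix_eq_sym: "A \<doteq>\<^sub>M B \<Longrightarrow> B \<doteq>\<^sub>M A"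
  unfolding matrix_eq_def using sym by blast

end

text \<open>The model is c \<mapsto> \<open>tensor c 1\<close>, which respects sums and 0 only up to
  the relations of the tensor product. With equality as the relation the same lemmas give evaluation
  in a field.\<close>

locale ring_per_hom = ring_per eq for eq :: "'b::comm_ring_1 \<Rightarrow> 'b \<Rightarrow> bool" (infix "\<doteq>" 50) +
  fixes S :: "'a::comm_ring_1 set" and \<phi> :: "'a \<Rightarrow> 'b"
  assumes subring: "is_subring S"
    and hom_zero: "\<phi> 0 \<doteq> 0" and hom_one: "\<phi> 1 \<doteq> 1"
    and hom_add: "x \<in> S \<Longrightarrow> y \<in> S \<Longrightarrow> \<phi> (x + y) \<doteq> \<phi> x + \<phi> y"
    and hom_mult: "x \<in> S \<Longrightarrow> y \<in> S \<Longrightarrow> \<phi> (x * y) \<doteq> \<phi> x * \<phi> y"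
begin

lemma hom_refl: "x \<in> S \<Longrightarrow> \<phi> x \<doteq> \<phi> x"
  using refl_left[OF hom_add[of x 0]] subringD(1)[OF subring] by simp

context
  fixes A :: "'b^'r^'r" and d :: 'b
  assumes A: "\<And>i j. A $ i $ j \<doteq> A $ i $ j" and d: "d \<doteq> d"
begin

text \<open>Since \<open>\<phi> 0\<close> is only equivalent to 0, the monomials outside the support
  of h contribute terms that have to be argued away.\<close>

lemma gl_eval_superset:
  assumes "coeffs_in S h" "finite T" "Poly_Mapping.keys h \<subseteq> T"
  shows "gl_eval \<phi> A d h \<doteq> (\<Sum>m\<in>T. \<phi> (Poly_Mapping.lookup h m) * gl_monom A d m)"
proof -
  have M: "gl_monom A d m \<doteq> gl_monom A d m" for m by (intro gl_monom A d)
  have "gl_eval \<phi> A d h \<doteq> gl_eval \<phi> A d h + (\<Sum>m\<in>T - Poly_Mapping.keys h. 0 * gl_monom A d m)"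
    unfolding gl_eval_monom
    using sum[of "Poly_Mapping.keys h" "\<lambda>m. \<phi> (Poly_Mapping.lookup h m) * gl_monom A d m", OF mult[OF hom_refl M]]
      assms(1) by (simp add: coeffs_in_def)
  also have "\<dots> \<doteq> gl_eval \<phi> A d h + (\<Sum>m\<in>T - Poly_Mapping.keys h. \<phi> (Poly_Mapping.lookup h m) * gl_monom A d m)"
    unfolding gl_eval_monom
    by (intro add sum mult M hom_refl)
      (use assms(1) sym[OF hom_zero] in \<open>auto simp: coeffs_in_def in_keys_iff\<close>)
  also have "\<dots> = (\<Sum>m\<in>T. \<phi> (Poly_Mapping.lookup h m) * gl_monom A d m)"
    unfolding gl_eval_monom using assms(2,3) by (metis (no_types, lifting) add.commute sum.subset_diff)
  finally show ?thesis .
qed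

lemma gl_eval_refl: "coeffs_in S h \<Longrightarrow> gl_eval \<phi> A d h \<doteq> gl_eval \<phi> A d h"
  by (intro gl_eval_cong A d hom_refl) (simp add: coeffs_in_def)

lemma gl_eval_add:
  assumes h: "coeffs_in S h" "coeffs_in S h'"
  shows "gl_eval \<phi> A d (h + h') \<doteq> gl_eval \<phi> A d h + gl_eval \<phi> A d h'"
proof -
  let ?T = "Poly_Mapping.keys h \<union> Poly_Mapping.keys h'"
  have M: "gl_monom A d m \<doteq> gl_monom A d m" for m by (intro gl_monom A d)
  have "gl_eval \<phi> A d (h + h') \<doteq> (\<Sum>m\<in>?T. \<phi> (Poly_Mapping.lookup (h + h') m) * gl_monom A d m)"
    using keys_add[of h h'] by (intro gl_eval_superset coeffs_in_arith subring h) auto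
  also have "\<dots> \<doteq> (\<Sum>m\<in>?T. (\<phi> (Poly_Mapping.lookup h m) + \<phi> (Poly_Mapping.lookup h' m)) * gl_monom A d m)"
    unfolding lookup_add using h by (intro sum mult hom_add M) (auto simp: coeffs_in_def)
  also have "\<dots> = (\<Sum>m\<in>?T. \<phi> (Poly_Mapping.lookup h m) * gl_monom A d m) +
      (\<Sum>m\<in>?T. \<phi> (Poly_Mapping.lookup h' m) * gl_monom A d m)"
    by (simp add: distrib_right sum.distrib)
  also have "\<dots> \<doteq> gl_eval \<phi> A d h + gl_eval \<phi> A d h'"
    by (intro add sym[OF gl_eval_superset] h) auto
  finally show ?thesis .
qed

lemma gl_eval_single:
  assumes "c \<in> S" shows "gl_eval \<phi> A d (Poly_Mapping.single m c) \<doteq> \<phi> c * gl_monom A d m"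
proof -
  have "Poly_Mapping.keys (Poly_Mapping.single m c) \<subseteq> {m}" by simp
  from gl_eval_superset[OF coeffs_in_arith(4)[OF subring assms] _ this] show ?thesis by simp
qed

lemma gl_eval_const: "c \<in> S \<Longrightarrow> gl_eval \<phi> A d (Poly_Mapping.single 0 c) \<doteq> \<phi> c"
  using gl_eval_single[of c 0] by (simp add: gl_monom_zero)

lemma gl_eval_var: "gl_eval \<phi> A d (Poly_Mapping.single (Poly_Mapping.single v 1) 1) \<doteq> gl_var A d v"
proof -
  have "gl_eval \<phi> A d (Poly_Mapping.single (Poly_Mapping.single v 1) 1) \<doteq> \<phi> 1 * gl_monom A d (Poly_Mapping.single v 1)"
    by (intro gl_eval_single subringD[OF subring])
  also have "\<dots> \<doteq> 1 * gl_monom A d (Poly_Mapping.single v 1)" by (intro mult hom_one gl_monom A d)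
  finally show ?thesis by (simp add: gl_monom_single)
qed

lemma gl_eval_mult:
  assumes h: "coeffs_in S h" and h': "coeffs_in S h'"
  shows "gl_eval \<phi> A d (h * h') \<doteq> gl_eval \<phi> A d h * gl_eval \<phi> A d h'"
proof -
  note C = coeffs_in_arith[OF subring] coeffs_in_mult[OF subring]
    and per_zero = zero and per_add = add
  have M: "gl_monom A d m \<doteq> gl_monom A d m" for m by (intro gl_monom A d)
  have Z: "gl_eval \<phi> A d 0 = 0" by (simp add: gl_eval_def)
  have 1: "gl_eval \<phi> A d (Poly_Mapping.single m c * h') \<doteq> (\<phi> c * gl_monom A d m) * gl_eval \<phi> A d h'"
    if c: "c \<in> S" for m c
    using subring h'
  proof (induction h' rule: coeffs_in_induct)
    case zero
    show ?case by (simp add: Z per_zero)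
  next
    case (add m' c' h')
    have "gl_eval \<phi> A d (Poly_Mapping.single m c * (Poly_Mapping.single m' c' + h'))
        \<doteq> gl_eval \<phi> A d (Poly_Mapping.single (m + m') (c * c')) + gl_eval \<phi> A d (Poly_Mapping.single m c * h')"
      unfolding distrib_left mult_single
      by (intro gl_eval_add C subringD(4)[OF subring] c add.hyps)
    also have "\<dots> \<doteq> \<phi> (c * c') * gl_monom A d (m + m') + (\<phi> c * gl_monom A d m) * gl_eval \<phi> A d h'"
      by (intro per_add gl_eval_single add.IH subringD(4)[OF subring] c add.hyps)
    also have "\<dots> \<doteq> (\<phi> c * \<phi> c') * gl_monom A d (m + m') + (\<phi> c * gl_monom A d m) * gl_eval \<phi> A d h'"
      by (intro per_add mult hom_mult M c add.hyps hom_refl gl_eval_refl)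
    also have "\<dots> = (\<phi> c * gl_monom A d m) * (\<phi> c' * gl_monom A d m' + gl_eval \<phi> A d h')"
      by (simp add: gl_monom_add algebra_simps)
    also have "\<dots> \<doteq> (\<phi> c * gl_monom A d m) * gl_eval \<phi> A d (Poly_Mapping.single m' c' + h')"
    proof (intro mult hom_refl M c)
      have "gl_eval \<phi> A d (Poly_Mapping.single m' c' + h') \<doteq>
          gl_eval \<phi> A d (Poly_Mapping.single m' c') + gl_eval \<phi> A d h'"
        by (intro gl_eval_add C add.hyps)
      also have "\<dots> \<doteq> \<phi> c' * gl_monom A d m' + gl_eval \<phi> A d h'"
        by (intro per_add gl_eval_single gl_eval_refl add.hyps)
      finally show "\<phi> c' * gl_monom A d m' + gl_eval \<phi> A d h' \<doteq> gl_eval \<phi> A d (Poly_Mapping.single m' c' + h')"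
        by (rule sym)
    qed
    finally show ?case .
  qed
  show ?thesis using subring h
  proof (induction h rule: coeffs_in_induct)
    case zero
    show ?case by (simp add: Z per_zero)
  next
    case (add m c h)
    have "gl_eval \<phi> A d ((Poly_Mapping.single m c + h) * h') \<doteq>
        gl_eval \<phi> A d (Poly_Mapping.single m c * h') + gl_eval \<phi> A d (h * h')"
      unfolding distrib_right by (intro gl_eval_add C add.hyps h')
    also have "\<dots> \<doteq> (\<phi> c * gl_monom A d m) * gl_eval \<phi> A d h' + gl_eval \<phi> A d h * gl_eval \<phi> A d h'"
      by (intro per_add 1 add.hyps add.IH)
    also have "\<dots> = (\<phi> c * gl_monom A d m + gl_eval \<phi> A d h) * gl_eval \<phi> A d h'" by (simp add: distrib_right)
    also have "\<dots> \<doteq> gl_eval \<phi> A d (Poly_Mapping.single m c + h) * gl_eval \<phi> A d h'"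
    proof (intro mult gl_eval_refl h')
      have "gl_eval \<phi> A d (Poly_Mapping.single m c + h) \<doteq>
          gl_eval \<phi> A d (Poly_Mapping.single m c) + gl_eval \<phi> A d h"
        by (intro gl_eval_add C add.hyps)
      also have "\<dots> \<doteq> \<phi> c * gl_monom A d m + gl_eval \<phi> A d h"
        by (intro per_add gl_eval_single gl_eval_refl add.hyps)
      finally show "\<phi> c * gl_monom A d m + gl_eval \<phi> A d h \<doteq> gl_eval \<phi> A d (Poly_Mapping.single m c + h)"
        by (rule sym)
    qed
    finally show ?case .
  qed
qed

end

end

text \<open>For statements in which a variable is replaced by a sum, as in translation by a matrix.
  Monomials do not survive there, but the ring generators can be treated one by one.\<close>

lemma gl_poly_ring_induct [consumes 2, case_names const var add mult]:
  fixes h :: "('r, 'a::comm_ring_1) gl_poly"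
  assumes S: "is_subring S" and "coeffs_in S h"
    and const: "\<And>c. c \<in> S \<Longrightarrow> P (Poly_Mapping.single 0 c)"
    and var: "\<And>v. P (Poly_Mapping.single (Poly_Mapping.single v 1) 1)"
    and add: "\<And>h h'. coeffs_in S h \<Longrightarrow> coeffs_in S h' \<Longrightarrow> P h \<Longrightarrow> P h' \<Longrightarrow> P (h + h')"
    and mult: "\<And>h h'. coeffs_in S h \<Longrightarrow> coeffs_in S h' \<Longrightarrow> P h \<Longrightarrow> P h' \<Longrightarrow> P (h * h')"
  shows "P h"
proof -
  note C = coeffs_in_arith[OF S] subringD[OF S]
  have pw: "P (Poly_Mapping.single (Poly_Mapping.single v n) 1)" for v n
  proof (induction n)
    case 0
    show ?case using const[OF C(7)] by simp
  next
    case (Suc n)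
    have "Poly_Mapping.single (Poly_Mapping.single v (Suc n)) (1::'a) =
      Poly_Mapping.single (Poly_Mapping.single v 1) 1 * Poly_Mapping.single (Poly_Mapping.single v n) 1"
      by (simp add: mult_single single_add[symmetric])
    then show ?case by (simp only:) (intro mult var Suc C)
  qed
  have mon: "P (Poly_Mapping.single (\<Sum>v\<in>T. Poly_Mapping.single v (f v)) 1)" if "finite T"
    for T and f :: "_ \<Rightarrow> nat"
    using that
  proof (induction T)
    case empty
    show ?case using const[OF C(7)] by simp
  next
    case (insert v T)
    have "Poly_Mapping.single (\<Sum>v\<in>insert v T. Poly_Mapping.single v (f v)) (1::'a) =
      Poly_Mapping.single (Poly_Mapping.single v (f v)) 1 * Poly_Mapping.single (\<Sum>v\<in>T. Poly_Mapping.single v (f v)) 1"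
      using insert by (simp add: mult_single)
    then show ?case by (simp only:) (intro mult pw insert.IH C)
  qed
  have single: "P (Poly_Mapping.single m c)" if c: "c \<in> S" for m c
  proof -
    have m: "(\<Sum>v\<in>Poly_Mapping.keys m. Poly_Mapping.single v (Poly_Mapping.lookup m v)) = m"
      by (rule sum_single_lookup) auto
    have "P (Poly_Mapping.single 0 c * Poly_Mapping.single m 1)"
      using mon[of "Poly_Mapping.keys m" "Poly_Mapping.lookup m"] unfolding m
      by (intro mult const c C) auto
    then show ?thesis by (simp add: mult_single)
  qed
  from S \<open>coeffs_in S h\<close> show ?thesis
  proof (induction h rule: coeffs_in_induct)
    case zero
    show ?case using single[OF C(6), of 0] by simp
  next
    case (add m c h)
    then show ?case by (intro assms(5) single C)
  qed
qed

lemma eq_ring_per: "ring_per (=)"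
  by standard auto

lemma id_ring_hom: "is_subring S \<Longrightarrow> ring_per_hom (=) S (\<lambda>c. c)"
  by (simp add: ring_per_hom_def ring_per_hom_axioms_def eq_ring_per)

lemma gl_at_simps:
  fixes A :: "'a::field^'r^'r"
  shows "gl_at A (h + h') = gl_at A h + gl_at A h'"
    and "gl_at A (h * h') = gl_at A h * gl_at A h'"
    and "gl_at A (Poly_Mapping.single 0 c) = c"
    and "gl_at A (Poly_Mapping.single (Poly_Mapping.single v 1) 1) = gl_var A (inverse (det A)) v"
proof -
  interpret ring_per_hom "(=)" "UNIV :: 'a set" "\<lambda>c. c" by (rule id_ring_hom[OF UNIV_subring])
  show "gl_at A (h + h') = gl_at A h + gl_at A h'" "gl_at A (h * h') = gl_at A h * gl_at A h'"
    "gl_at A (Poly_Mapping.single 0 c) = c"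
    "gl_at A (Poly_Mapping.single (Poly_Mapping.single v 1) 1) = gl_var A (inverse (det A)) v"
    unfolding gl_at_def using gl_eval_add gl_eval_mult gl_eval_const gl_eval_var by (auto simp: coeffs_in_def)
qed

lemma gl_at_zero: "gl_at A 0 = 0"
  by (simp add: gl_at_def gl_eval_def)

lemma gl_at_scale: "gl_at A (scale c h) = c * gl_at A h"
  by (simp add: mult_map_scale_conv_mult gl_at_simps)

lemma gl_at_diff: "gl_at A (h - h') = gl_at A h - gl_at A h'"
  using gl_at_simps(1)[of A "h - h'" h'] by simp

lemma gl_at_in_subring:
  fixes A :: "'a::field^'r^'r"
  assumes "is_subring S" "coeffs_in S h" "\<And>i j. A $ i $ j \<in> S" "inverse (det A) \<in> S"
  shows "gl_at A h \<in> S"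
  unfolding gl_at_def gl_eval_monom gl_monom_def gl_var_def
  by (intro subring_sum subring_prod subringD assms(1))
    (use assms in \<open>auto simp: coeffs_in_def intro!: subringD(7) split: option.split\<close>)

lemma gl_eval_hom:
  fixes A :: "'b::comm_ring_1^'r^'r" and \<psi> :: "'b \<Rightarrow> 'c::comm_ring_1"
  assumes \<psi>: "ring_hom_on S \<psi>" and S: "is_subring S" and h: "\<And>m. \<phi> (Poly_Mapping.lookup h m) \<in> S"
    and A: "\<And>i j. A $ i $ j \<in> S" and d: "d \<in> S"
  shows "\<psi> (gl_eval \<phi> A d h) = gl_eval (\<lambda>c. \<psi> (\<phi> c)) (map_matrix \<psi> A) (\<psi> d) h"
proof -
  have v: "gl_var A d v \<in> S" "\<psi> (gl_var A d v) = gl_var (map_matrix \<psi> A) (\<psi> d) v" for v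
    using A d by (auto simp: gl_var_def map_matrix_def split: option.split)
  have prod: "\<psi> (\<Prod>i\<in>I. f i) = (\<Prod>i\<in>I. \<psi> (f i))" if "\<And>i. i \<in> I \<Longrightarrow> f i \<in> S"
    for I :: "('r \<times> 'r) option set" and f
    using that by (induction I rule: infinite_finite_induct)
      (simp_all add: ring_hom_onD[OF \<psi> S] subring_prod[OF S])
  have m: "gl_monom A d m \<in> S" "\<psi> (gl_monom A d m) = gl_monom (map_matrix \<psi> A) (\<psi> d) m" for m
    unfolding gl_monom_def
    by (auto simp: prod v ring_hom_onD[OF \<psi> S] subringD[OF S] intro!: subring_prod[OF S])
  show ?thesis
    unfolding gl_eval_monom using h
    by (subst ring_hom_on_sum[OF \<psi> S]) (auto simp: m ring_hom_onD[OF \<psi> S] subringD[OF S])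
qed

text \<open>A map that vanishes only at 0 leaves unchanged the support, over which
  \<open>gl_eval\<close> sums.\<close>

lemma gl_eval_map_coeffs:
  assumes "\<sigma> 0 = 0" "\<And>x. \<sigma> x = 0 \<Longrightarrow> x = 0"
  shows "gl_eval \<phi> A d (Poly_Mapping.map \<sigma> h) = gl_eval (\<lambda>c. \<phi> (\<sigma> c)) A d h"
proof -
  have "Poly_Mapping.keys (Poly_Mapping.map \<sigma> h) = Poly_Mapping.keys h"
    using assms by (auto simp: in_keys_iff lookup_map0)
  then show ?thesis using assms by (simp add: gl_eval_monom lookup_map0)
qed

lemma coord_ring_subring:
  fixes \<Psi> :: "'a::field^'r^'r"
  assumes S: "is_subring S" shows "is_subring (coord_ring S \<Psi>)"
proof -
  note C = coeffs_in_arith[OF S] coeffs_in_mult[OF S]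
  have mem: "gl_at \<Psi> q \<in> coord_ring S \<Psi>" if "coeffs_in S q" for q using that by (auto simp: coord_ring_def)
  have "gl_at \<Psi> q + gl_at \<Psi> q' \<in> coord_ring S \<Psi>" "gl_at \<Psi> q * gl_at \<Psi> q' \<in> coord_ring S \<Psi>"
    "- gl_at \<Psi> q \<in> coord_ring S \<Psi>"
    if "coeffs_in S q" "coeffs_in S q'" for q q'
    using mem[OF C(2)[OF that]] mem[OF C(6)[OF that]] mem[OF C(3)[OF C(1) that(1)]]
    by (simp_all add: gl_at_simps gl_at_diff[of _ 0, simplified] gl_at_zero)
  moreover have "0 \<in> coord_ring S \<Psi>" "1 \<in> coord_ring S \<Psi>"
    using mem[OF C(4)[of 0 0]] mem[OF C(4)[of 1 0]] subringD(1,2)[OF S]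
    by (simp_all only: gl_at_simps)
  ultimately show ?thesis by (auto simp: is_subring_def coord_ring_def)
qed

lemma coord_ring_base: "is_subring S \<Longrightarrow> S \<subseteq> coord_ring S \<Psi>" for \<Psi> :: "'a::field^'r^'r"
  using coeffs_in_arith(4)[of S _ 0] by (force simp: coord_ring_def gl_at_simps)

lemma coord_ring_gens:
  fixes \<Psi> :: "'a::field^'r^'r"
  assumes S: "is_subring S"
  shows "\<Psi> $ i $ j \<in> coord_ring S \<Psi>" "inverse (det \<Psi>) \<in> coord_ring S \<Psi>"
proof -
  have c: "coeffs_in S (Poly_Mapping.single (Poly_Mapping.single v 1) (1::'a))" for v :: "('r \<times> 'r) option"
    by (intro coeffs_in_arith S subringD[OF S])
  have "gl_var \<Psi> (inverse (det \<Psi>)) v \<in> coord_ring S \<Psi>" for v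
    using c[of v] gl_at_simps(4)[of \<Psi> v] unfolding coord_ring_def by (metis (mono_tags, lifting) mem_Collect_eq)
  from this[of "Some (i, j)"] this[of None]
  show "\<Psi> $ i $ j \<in> coord_ring S \<Psi>" "inverse (det \<Psi>) \<in> coord_ring S \<Psi>" by (simp_all add: gl_var_def)
qed

section \<open>Descent\<close>

text \<open>V stands for the span of \<open>J0\<close> over M, but may be any set containing
  \<open>J0\<close> that is closed under sums and scalars; in the applications it is the kernel of
  an evaluation. Subtracting a multiple of an element of minimal support removes a monomial, which
  drives the induction.\<close>

lemma descent:
  fixes J :: "('m \<Rightarrow>\<^sub>0 'a::field) set"
  assumes M: "is_subfield M" and J: "\<And>h g. h \<in> J \<Longrightarrow> g \<in> J \<Longrightarrow> h - g \<in> J"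
    "\<And>c h. c \<in> M \<Longrightarrow> h \<in> J \<Longrightarrow> scale c h \<in> J" "\<And>h. h \<in> J \<Longrightarrow> coeffs_in M h"
    and minimal: "\<And>h. h \<in> J \<Longrightarrow> h \<noteq> 0 \<Longrightarrow>
      (\<And>g. g \<in> J \<Longrightarrow> g \<noteq> 0 \<Longrightarrow> Poly_Mapping.keys g \<subseteq> Poly_Mapping.keys h \<Longrightarrow> Poly_Mapping.keys g = Poly_Mapping.keys h) \<Longrightarrow>
      \<exists>c\<in>M. c \<noteq> 0 \<and> scale c h \<in> J0"
    and V: "0 \<in> V" "\<And>h g. h \<in> V \<Longrightarrow> g \<in> V \<Longrightarrow> h + g \<in> V" "\<And>c h. c \<in> M \<Longrightarrow> h \<in> V \<Longrightarrow> scale c h \<in> V" "J0 \<subseteq> V"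
  shows "J \<subseteq> V"
proof
  fix h assume "h \<in> J"
  then show "h \<in> V"
  proof (induction "card (Poly_Mapping.keys h)" arbitrary: h rule: less_induct)
    case less
    note S = subfield_subring[OF M]
    show ?case
    proof (cases "h = 0")
      case False
      \<comment> \<open>Fewest monomials inside the support of h implies minimality under inclusion,
        as the hypothesis \<open>minimal\<close> requires.\<close>
      obtain g where g: "g \<in> J \<and> g \<noteq> 0 \<and> Poly_Mapping.keys g \<subseteq> Poly_Mapping.keys h"
        and gmin: "\<And>g'. g' \<in> J \<and> g' \<noteq> 0 \<and> Poly_Mapping.keys g' \<subseteq> Poly_Mapping.keys h \<Longrightarrow>
          card (Poly_Mapping.keys g) \<le> card (Poly_Mapping.keys g')"
        using ex_has_least_nat[of "\<lambda>g. g \<in> J \<and> g \<noteq> 0 \<and> Poly_Mapping.keys g \<subseteq> Poly_Mapping.keys h" h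
          "\<lambda>g. card (Poly_Mapping.keys g)"] less.prems False by auto
      have "\<exists>c\<in>M. c \<noteq> 0 \<and> scale c g \<in> J0"
      proof (rule minimal)
        fix g' assume g': "g' \<in> J" "g' \<noteq> 0" "Poly_Mapping.keys g' \<subseteq> Poly_Mapping.keys g"
        then have "card (Poly_Mapping.keys g) \<le> card (Poly_Mapping.keys g')" using gmin g by auto
        then show "Poly_Mapping.keys g' = Poly_Mapping.keys g" using g'(3) by (intro card_seteq) auto
      qed (use g in auto)
      then obtain c where c: "c \<in> M" "c \<noteq> 0" "scale c g \<in> J0" by blast
      obtain m where m: "m \<in> Poly_Mapping.keys g" using g by (metis all_not_in_conv keys_eq_empty)
      define q where "q = Poly_Mapping.lookup h m / Poly_Mapping.lookup g m"
      have q: "q \<in> M" unfolding q_def using J(3) g less.prems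
        by (intro subfield_divide[OF M]) (auto simp: coeffs_in_def)
      define h' where "h' = h - scale q g"
      have h': "h' \<in> J" unfolding h'_def using J q g less.prems by blast
      have "Poly_Mapping.lookup g x = 0" if "Poly_Mapping.lookup h x = 0" for x
        using g that by (metis in_keys_iff subsetD)
      then have "Poly_Mapping.keys h' \<subseteq> Poly_Mapping.keys h"
        by (auto simp: h'_def in_keys_iff lookup_minus lookup_scale)
      moreover have "m \<notin> Poly_Mapping.keys h'" "m \<in> Poly_Mapping.keys h"
        using m g by (auto simp: h'_def q_def in_keys_iff lookup_minus lookup_scale)
      ultimately have "Poly_Mapping.keys h' \<subset> Poly_Mapping.keys h" by blast
      then have "card (Poly_Mapping.keys h') < card (Poly_Mapping.keys h)" by (intro psubset_card_mono) auto
      then have h'V: "h' \<in> V" using less.hyps h' by blast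
      have "h = h' + scale (q / c) (scale c g)"
        using c(2) by (intro poly_mapping_eqI) (simp add: h'_def lookup_add lookup_minus lookup_scale)
      moreover have "scale (q / c) (scale c g) \<in> V"
        using c q V(3,4) subfield_divide[OF M] by blast
      ultimately show ?thesis using V(2) h'V by metis
    qed (use V in simp)
  qed
qed

text \<open>Scaled so that one coefficient is 1, an element of minimal support equals its image
  under \<sigma>: the difference has lost that monomial, so it is 0. All its coefficients are
  therefore fixed.\<close>

lemma descent_fixed:
  fixes J :: "('m \<Rightarrow>\<^sub>0 'a::field) set"
  assumes M: "is_subfield M" and J: "\<And>h g. h \<in> J \<Longrightarrow> g \<in> J \<Longrightarrow> h - g \<in> J"
    "\<And>c h. c \<in> M \<Longrightarrow> h \<in> J \<Longrightarrow> scale c h \<in> J" "\<And>h. h \<in> J \<Longrightarrow> coeffs_in M h"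
    and \<sigma>: "\<sigma> 0 = 0" "\<sigma> 1 = 1" "\<And>h. h \<in> J \<Longrightarrow> Poly_Mapping.map \<sigma> h \<in> J"
    and V: "0 \<in> V" "\<And>h g. h \<in> V \<Longrightarrow> g \<in> V \<Longrightarrow> h + g \<in> V" "\<And>c h. c \<in> M \<Longrightarrow> h \<in> V \<Longrightarrow> scale c h \<in> V"
      "\<And>h. h \<in> J \<Longrightarrow> coeffs_in (fixed_field \<sigma> M) h \<Longrightarrow> h \<in> V"
  shows "J \<subseteq> V"
proof (rule descent[OF M J, where ?J0.0 = "{h \<in> J. coeffs_in (fixed_field \<sigma> M) h}"])
  fix h assume h: "h \<in> J" "h \<noteq> 0"
    and min: "\<And>g. g \<in> J \<Longrightarrow> g \<noteq> 0 \<Longrightarrow> Poly_Mapping.keys g \<subseteq> Poly_Mapping.keys h \<Longrightarrow> Poly_Mapping.keys g = Poly_Mapping.keys h"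
  obtain m where m: "m \<in> Poly_Mapping.keys h" using h by (metis all_not_in_conv keys_eq_empty)
  define c where "c = inverse (Poly_Mapping.lookup h m)"
  have c: "c \<in> M" "c \<noteq> 0"
    using J(3)[OF h(1)] m subfield_inverse[OF M] by (auto simp: c_def coeffs_in_def in_keys_iff)
  define g where "g = scale c h"
  have g: "g \<in> J" unfolding g_def using J(2) c h by blast
  have keys: "Poly_Mapping.keys g = Poly_Mapping.keys h"
    using c(2) by (auto simp: g_def in_keys_iff lookup_scale)
  have gm: "Poly_Mapping.lookup g m = 1" using m by (simp add: g_def c_def lookup_scale in_keys_iff)
  define d where "d = Poly_Mapping.map \<sigma> g - g"
  have d: "d \<in> J" unfolding d_def using J(1) \<sigma>(3) g by blast
  have "Poly_Mapping.keys d \<subseteq> Poly_Mapping.keys g"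
    using \<sigma>(1) by (auto simp: d_def in_keys_iff lookup_minus lookup_map0)
  moreover have "m \<notin> Poly_Mapping.keys d"
    using gm \<sigma>(1,2) by (simp add: d_def in_keys_iff lookup_minus lookup_map0)
  ultimately have "d = 0" using min[OF d] m keys by blast
  then have "\<sigma> (Poly_Mapping.lookup g k) = Poly_Mapping.lookup g k" for k
    using \<sigma>(1) by (metis d_def eq_iff_diff_eq_0 lookup_map0)
  then have "coeffs_in (fixed_field \<sigma> M) g"
    using J(3)[OF g] by (simp add: coeffs_in_def fixed_field_def)
  then show "\<exists>c\<in>M. c \<noteq> 0 \<and> scale c h \<in> {h \<in> J. coeffs_in (fixed_field \<sigma> M) h}"
    using c g by (auto simp: g_def)
qed (use V in auto)

section \<open>Tensors\<close>

lemma det_in_subring: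
  fixes A :: "'a::comm_ring_1^'n^'n"
  assumes S: "is_subring S" and A: "\<And>i j. A $ i $ j \<in> S"
  shows "det A \<in> S"
proof -
  have "of_int n \<in> S" for n
    by (induction n rule: int_induct[where k = 0]) (auto simp: subringD[OF S])
  then show ?thesis unfolding det_def
    by (intro subring_sum[OF S] subringD(4)[OF S] subring_prod[OF S] A)
qed

lemma matrix_inv_field:
  fixes A :: "'a::field^'n^'n"
  assumes "det A \<noteq> 0"
  shows "A ** matrix_inv A = mat 1" "matrix_inv A ** A = mat 1"
    "det (matrix_inv A) = inverse (det A)"
proof -
  have "invertible A" using assms by (simp add: invertible_det_nz)
  then have *: "A ** matrix_inv A = mat 1 \<and> matrix_inv A ** A = mat 1"
    unfolding invertible_def matrix_inv_def by (rule someI_ex)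
  then show "A ** matrix_inv A = mat 1" "matrix_inv A ** A = mat 1" by auto
  have "det A * det (matrix_inv A) = 1" using * by (metis det_I det_mul)
  then show "det (matrix_inv A) = inverse (det A)" by (metis inverse_unique)
qed

text \<open>Cramer's rule expresses each column of the inverse by determinants with entries in
  S.\<close>

lemma matrix_inv_in_subfield:
  fixes A :: "'a::field^'n^'n"
  assumes S: "is_subfield S" and A: "\<And>i j. A $ i $ j \<in> S" and d: "det A \<noteq> 0"
  shows "matrix_inv A $ i $ j \<in> S"
proof -
  note R = subfield_subring[OF S]
  define x where "x = (\<chi> k. matrix_inv A $ k $ j)"
  define e :: "'a^'n" where "e = (\<chi> k. if k = j then 1 else 0)"
  have "A *v x = e"
  proof (simp add: vec_eq_iff, intro allI)
    fix k
    have "(A *v x) $ k = (A ** matrix_inv A) $ k $ j"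
      by (simp add: matrix_vector_mult_def matrix_matrix_mult_def x_def)
    then show "(A *v x) $ k = e $ k" by (simp add: matrix_inv_field(1)[OF d] mat_def e_def)
  qed
  then have "x $ i = det (\<chi> a b. if b = i then e $ a else A $ a $ b) / det A"
    using cramer[OF d, of x e] by simp
  also have "\<dots> \<in> S"
    by (intro subfield_divide[OF S] det_in_subring[OF R])
      (auto simp: A e_def subringD[OF R])
  finally show ?thesis by (simp add: x_def)
qed

lemma matrix_mult_in_subring:
  fixes A :: "'a::comm_ring_1^'n^'m" and B :: "'a^'k^'n"
  assumes "is_subring S" "\<And>i j. A $ i $ j \<in> S" "\<And>i j. B $ i $ j \<in> S"
  shows "(A ** B) $ i $ j \<in> S"
  unfolding matrix_matrix_mult_def using assms by (auto intro!: subring_sum subringD)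

lemma GL_overD:
  fixes A :: "'a::field^'r^'r"
  shows
  "A \<in> GL_over S \<Longrightarrow> A $ i $ j \<in> S" "A \<in> GL_over S \<Longrightarrow> det A \<noteq> 0"
  by (auto simp: GL_over_def mat_entries_def)

lemma GL_overI:
  fixes A :: "'a::field^'r^'r"
  shows "(\<And>i j. A $ i $ j \<in> S) \<Longrightarrow> det A \<noteq> 0 \<Longrightarrow> A \<in> GL_over S"
  by (auto simp: GL_over_def mat_entries_def)

lemma tensor_frag: "tensor a b = frag_of (Tensor_Gen a b)"
  by (simp add: tensor_def)

lemma tensor_mult: "tensor a b * tensor c d = tensor (a * c) (b * d)"
  by (simp add: tensor_def mult_single)

lemma tensor_one: "tensor 1 1 = 1"
  by (simp add: tensor_def zero_tensor_gen_def[symmetric])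

text \<open>The two slots have separate ranges because a homomorphism of the coordinate ring will be
  applied to the right entries only, while the left entries remain arbitrary.\<close>

definition formal_tensors :: "'a set \<Rightarrow> 'a set \<Rightarrow> 'a formal_tensor set" where
  "formal_tensors L L' = {x. Poly_Mapping.keys x \<subseteq> {Tensor_Gen a b |a b. a \<in> L \<and> b \<in> L'}}"

lemma tensor_in_formal: "a \<in> L \<Longrightarrow> b \<in> L' \<Longrightarrow> tensor a b \<in> formal_tensors L L'"
  by (auto simp: formal_tensors_def tensor_def)

lemma formal_tensors_induct [consumes 1, case_names zero tensor diff]:
  assumes "x \<in> formal_tensors L L'" "P 0" "\<And>a b. a \<in> L \<Longrightarrow> b \<in> L' \<Longrightarrow> P (tensor a b)"
    "\<And>x y. P x \<Longrightarrow> P y \<Longrightarrow> P (x - y)"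
  shows "P x"
proof -
  have "Poly_Mapping.keys x \<subseteq> {Tensor_Gen a b |a b. a \<in> L \<and> b \<in> L'}"
    using assms(1) by (simp add: formal_tensors_def)
  then show ?thesis
    by (induction rule: frag_induction) (use assms in \<open>auto simp: tensor_frag\<close>)
qed

lemma formal_tensors_diff:
  "x \<in> formal_tensors L L' \<Longrightarrow> y \<in> formal_tensors L L' \<Longrightarrow> x - y \<in> formal_tensors L L'"
  using keys_diff[of x y] by (auto simp: formal_tensors_def)

lemma formal_tensors_add:
  "x \<in> formal_tensors L L' \<Longrightarrow> y \<in> formal_tensors L L' \<Longrightarrow> x + y \<in> formal_tensors L L'"
  using keys_add[of x y] by (auto simp: formal_tensors_def)

lemma formal_tensors_subring:
  assumes L: "is_subring L" and L': "is_subring L'"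
  shows "is_subring (formal_tensors L L')"
proof -
  have z: "0 \<in> formal_tensors L L'" by (simp add: formal_tensors_def)
  have o: "1 \<in> formal_tensors L L'"
    using tensor_in_formal[of 1 L 1 L'] subringD(2) L L' by (auto simp: tensor_one)
  have m: "- x \<in> formal_tensors L L'" if "x \<in> formal_tensors L L'" for x
    using formal_tensors_diff[OF z that] by simp
  have p: "x * y \<in> formal_tensors L L'" if x: "x \<in> formal_tensors L L'" and y: "y \<in> formal_tensors L L'" for x y
    using x
  proof (induction rule: formal_tensors_induct)
    case (tensor a b)
    show ?case using y
    proof (induction rule: formal_tensors_induct)
      case (tensor c d)
      then show ?case using \<open>a \<in> L\<close> \<open>b \<in> L'\<close>
        by (simp add: tensor_mult tensor_in_formal subringD(4)[OF L] subringD(4)[OF L'])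
    qed (simp_all add: z right_diff_distrib formal_tensors_diff)
  qed (simp_all add: z left_diff_distrib formal_tensors_diff)
  show ?thesis unfolding is_subring_def using z o m p formal_tensors_add by blast
qed

lemma tensor_relations_add:
  assumes "x \<in> tensor_relations K L" "y \<in> tensor_relations K L"
  shows "x + y \<in> tensor_relations K L"
  using tensor_relations.diff[OF assms(1) tensor_relations.diff[OF tensor_relations.zero assms(2)]] by simp

text \<open>A pure tensor times a generating relation is again a generating relation of the same
  kind, so the relations form an ideal of the formal tensors over L.\<close>

lemma tensor_relations_mult:
  assumes L: "is_subring L" and x: "x \<in> formal_tensors L L" and t: "t \<in> tensor_relations K L"
  shows "x * t \<in> tensor_relations K L"
  using x
proof (induction rule: formal_tensors_induct)
  case (tensor c d)
  note m = subringD(4)[OF L]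
  show ?case using t
  proof induction
    case (add_left a a' b)
    then show ?case
      using tensor_relations.add_left[of "c * a" L "c * a'" "d * b" K] tensor m
      by (simp add: right_diff_distrib tensor_mult distrib_left)
  next
    case (add_right a b b')
    then show ?case
      using tensor_relations.add_right[of "c * a" L "d * b" "d * b'" K] tensor m
      by (simp add: right_diff_distrib tensor_mult distrib_left)
  next
    case (balanced k a b)
    then show ?case
      using tensor_relations.balanced[of k K "c * a" L "d * b"] tensor m
      by (simp add: right_diff_distrib tensor_mult mult.left_commute)
  qed (auto simp: right_diff_distrib intro: tensor_relations.intros)
qed (auto simp: left_diff_distrib intro: tensor_relations.intros)

definition tensor_eq :: "'a::field set \<Rightarrow> 'a set \<Rightarrow> 'a formal_tensor \<Rightarrow> 'a formal_tensor \<Rightarrow> bool" where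
  "tensor_eq K L x y \<longleftrightarrow> x \<in> formal_tensors L L \<and> y \<in> formal_tensors L L \<and> x - y \<in> tensor_relations K L"

text \<open>The map that specializes the right factor by \<phi>, keeps the left one and multiplies.
  It respects the relations over V when \<phi> is K-linear on V, and products when \<phi> is
  multiplicative on the right entries.\<close>

definition tensor_apply :: "('a::field \<Rightarrow> 'a) \<Rightarrow> 'a formal_tensor \<Rightarrow> 'a" where
  "tensor_apply \<phi> t =
     (\<Sum>k\<in>Poly_Mapping.keys t. of_int (Poly_Mapping.lookup t k) * (case k of Tensor_Gen a b \<Rightarrow> a * \<phi> b))"

lemma tensor_apply_superset:
  "finite T \<Longrightarrow> Poly_Mapping.keys t \<subseteq> T \<Longrightarrow>
    tensor_apply \<phi> t = (\<Sum>k\<in>T. of_int (Poly_Mapping.lookup t k) * (case k of Tensor_Gen a b \<Rightarrow> a * \<phi> b))"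
  unfolding tensor_apply_def by (intro sum.mono_neutral_left) (auto simp: in_keys_iff)

lemma tensor_apply_diff: "tensor_apply \<phi> (x - y) = tensor_apply \<phi> x - tensor_apply \<phi> y"
  using keys_diff[of x y]
  by (simp add: tensor_apply_superset[of "Poly_Mapping.keys x \<union> Poly_Mapping.keys y"]
      lookup_minus left_diff_distrib sum_subtractf)

lemma tensor_apply_zero: "tensor_apply \<phi> 0 = 0"
  by (simp add: tensor_apply_def)

lemma tensor_apply_add: "tensor_apply \<phi> (x + y) = tensor_apply \<phi> x + tensor_apply \<phi> y"
  using tensor_apply_diff[of \<phi> "x + y" y] by simp

lemma tensor_apply_tensor: "tensor_apply \<phi> (tensor a b) = a * \<phi> b"
  by (simp add: tensor_apply_def tensor_def)

lemma tensor_apply_hom: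
  assumes S: "is_subring S" and \<phi>: "ring_hom_on S \<phi>"
  shows "ring_hom_on (formal_tensors UNIV S) (tensor_apply \<phi>)"
proof -
  have "tensor_apply \<phi> (x * y) = tensor_apply \<phi> x * tensor_apply \<phi> y"
    if x: "x \<in> formal_tensors UNIV S" and y: "y \<in> formal_tensors UNIV S" for x y
    using x
  proof (induction rule: formal_tensors_induct)
    case (tensor a b)
    show ?case using y
    proof (induction rule: formal_tensors_induct)
      case (tensor c d)
      then show ?case using \<open>b \<in> S\<close>
        by (simp add: tensor_mult tensor_apply_tensor ring_hom_onD[OF \<phi> S])
    qed (simp_all add: tensor_apply_zero right_diff_distrib tensor_apply_diff)
  qed (simp_all add: tensor_apply_zero left_diff_distrib tensor_apply_diff)
  moreover have "tensor_apply \<phi> 1 = 1"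
    using tensor_apply_tensor[of \<phi> 1 1] ring_hom_onD[OF \<phi> S] by (simp add: tensor_one)
  ultimately show ?thesis by (simp add: ring_hom_on_def tensor_apply_add)
qed

section \<open>Linear maps on subspaces, and the induced maps on tensors\<close>

definition linear_on :: "'a::field set \<Rightarrow> 'a set \<Rightarrow> ('a \<Rightarrow> 'a) \<Rightarrow> bool" where
  "linear_on K V \<phi> \<longleftrightarrow> V \<noteq> {} \<and> (\<forall>x\<in>V. \<forall>y\<in>V. x + y \<in> V \<and> \<phi> (x + y) = \<phi> x + \<phi> y) \<and>
     (\<forall>c\<in>K. \<forall>x\<in>V. c * x \<in> V \<and> \<phi> (c * x) = c * \<phi> x)"

lemma tensor_apply_relations:
  assumes \<phi>: "linear_on K V \<phi>" and t: "t \<in> tensor_relations K V"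
  shows "tensor_apply \<phi> t = 0"
  using t
proof induction
  case (add_left a a' b)
  show ?case by (simp add: tensor_apply_diff tensor_apply_add tensor_apply_tensor algebra_simps)
next
  case (add_right a b b')
  then show ?case using \<phi> by (simp add: tensor_apply_diff tensor_apply_add tensor_apply_tensor algebra_simps linear_on_def)
next
  case (balanced c a b)
  then show ?case using \<phi> by (simp add: tensor_apply_diff tensor_apply_tensor linear_on_def)
qed (simp_all add: tensor_apply_zero tensor_apply_diff)

text \<open>The derivation of a relation mentions only finitely many elements of L. A linear map
  given on a subspace thus has to be extended to finitely many vectors, and no basis of L over K is
  invoked.\<close>

lemma tensor_relations_finite:
  "t \<in> tensor_relations K L \<Longrightarrow> \<exists>S. finite S \<and> S \<subseteq> L \<and> (\<forall>V. S \<subseteq> V \<longrightarrow> t \<in> tensor_relations K V)"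
proof (induction rule: tensor_relations.induct)
  case zero
  show ?case by (intro exI[of _ "{}"]) (auto intro: tensor_relations.zero)
next
  case (diff x y)
  then obtain S S' where "finite S" "S \<subseteq> L" "\<forall>V. S \<subseteq> V \<longrightarrow> x \<in> tensor_relations K V"
    "finite S'" "S' \<subseteq> L" "\<forall>V. S' \<subseteq> V \<longrightarrow> y \<in> tensor_relations K V" by blast
  then show ?case by (intro exI[of _ "S \<union> S'"]) (auto intro: tensor_relations.diff)
next
  case (add_left a a' b)
  then show ?case by (intro exI[of _ "{a, a', b}"]) (auto intro: tensor_relations.add_left)
next
  case (add_right a b b')
  then show ?case by (intro exI[of _ "{a, b, b'}"]) (auto intro: tensor_relations.add_right)
next
  case (balanced c a b)
  then show ?case by (intro exI[of _ "{a, b}"]) (auto intro: tensor_relations.balanced)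
qed

lemma linear_on_extend:
  assumes K: "is_subfield K" and "finite S" and \<phi>: "linear_on K V \<phi>"
  shows "\<exists>V' \<psi>. linear_on K V' \<psi> \<and> V \<union> S \<subseteq> V' \<and> (\<forall>v\<in>V. \<psi> v = \<phi> v)"
  using assms(2)
proof (induction S)
  case empty
  show ?case using \<phi> by blast
next
  case (insert x S)
  then obtain V' \<psi> where 1: "linear_on K V' \<psi>" "V \<union> S \<subseteq> V'" "\<forall>v\<in>V. \<psi> v = \<phi> v" by blast
  note A = subringD[OF subfield_subring[OF K]]
  have V': "u + v \<in> V'" "\<psi> (u + v) = \<psi> u + \<psi> v" if "u \<in> V'" "v \<in> V'" for u v
    using 1 that by (auto simp: linear_on_def)
  have cV': "c * v \<in> V'" "\<psi> (c * v) = c * \<psi> v" if "c \<in> K" "v \<in> V'" for c v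
    using 1 that by (auto simp: linear_on_def)
  have dV': "u - v \<in> V'" if "u \<in> V'" "v \<in> V'" for u v
    using V'(1)[of u "-1 * v"] cV'(1)[of "-1" v] that A(2,5) by auto
  obtain v0 where "v0 \<in> V'" using 1 by (auto simp: linear_on_def)
  then have zV': "0 \<in> V'" using cV'(1)[of 0 v0] A by simp
  show ?case
  proof (cases "x \<in> V'")
    case True
    then show ?thesis using 1 by blast
  next
    case False
    have uniq: "v = v'" if "v + c * x = v' + c' * x" "v \<in> V'" "v' \<in> V'" "c \<in> K" "c' \<in> K" for v v' c c'
    proof (rule ccontr)
      assume "v \<noteq> v'"
      then have "c \<noteq> c'" using that(1) by auto
      have "(c - c') * x = v' - v" using that(1) by (simp add: algebra_simps)
      then have "x = inverse (c - c') * (v' - v)" using \<open>c \<noteq> c'\<close> by (simp add: field_simps)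
      moreover have "inverse (c - c') \<in> K" using that A(6) subfield_inverse[OF K] by blast
      ultimately show False using False cV'(1) dV' that by blast
    qed
    define W where "W = {v + c * x |v c. v \<in> V' \<and> c \<in> K}"
    \<comment> \<open>The new vector x is sent to 0. The component in \<open>V'\<close> is unique
      because x lies outside \<open>V'\<close>.\<close>
    define \<theta> where "\<theta> u = \<psi> (THE v. v \<in> V' \<and> (\<exists>c\<in>K. u = v + c * x))" for u
    have \<theta>: "\<theta> (v + c * x) = \<psi> v" if "v \<in> V'" "c \<in> K" for v c
      unfolding \<theta>_def using that uniq by (intro arg_cong[of _ _ \<psi>] the_equality) blast+
    have WI: "v + c * x \<in> W" if "v \<in> V'" "c \<in> K" for v c using that by (auto simp: W_def)
    have "u + w \<in> W \<and> \<theta> (u + w) = \<theta> u + \<theta> w" if uW: "u \<in> W" "w \<in> W" for u w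
    proof -
      obtain v c v' c' where uw: "u = v + c * x" "w = v' + c' * x" "v \<in> V'" "v' \<in> V'" "c \<in> K" "c' \<in> K"
        using uW by (auto simp: W_def)
      have e: "u + w = (v + v') + (c + c') * x" using uw by (simp add: algebra_simps)
      show ?thesis unfolding e using uw V' A(3) by (simp add: \<theta> WI)
    qed
    moreover have "k * u \<in> W \<and> \<theta> (k * u) = k * \<theta> u" if kK: "k \<in> K" "u \<in> W" for k u
    proof -
      obtain v c where u: "u = v + c * x" "v \<in> V'" "c \<in> K" using kK by (auto simp: W_def)
      have e: "k * u = k * v + (k * c) * x" using u by (simp add: algebra_simps)
      show ?thesis unfolding e using u kK cV' A(4) by (simp add: \<theta> WI)
    qed
    moreover have sub: "V' \<subseteq> W" "\<forall>v\<in>V'. \<theta> v = \<psi> v"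
      using \<theta>[of _ 0] A(1) by (force simp: W_def)+
    moreover have "0 + 1 * x \<in> W" by (intro WI zV' A)
    ultimately have "linear_on K W \<theta>" "V \<union> insert x S \<subseteq> W" "\<forall>v\<in>V. \<theta> v = \<phi> v"
      using zV' 1(2,3) unfolding linear_on_def by auto
    then show ?thesis by blast
  qed
qed

definition tensor_map :: "('a::field \<Rightarrow> 'a) \<Rightarrow> 'a formal_tensor \<Rightarrow> 'a formal_tensor" where
  "tensor_map \<sigma> = frag_extend (\<lambda>k. case k of Tensor_Gen a b \<Rightarrow> tensor (\<sigma> a) (\<sigma> b))"

lemma tensor_map_tensor: "tensor_map \<sigma> (tensor a b) = tensor (\<sigma> a) (\<sigma> b)"
  by (simp add: tensor_map_def tensor_frag)

lemma tensor_map_diff: "tensor_map \<sigma> (x - y) = tensor_map \<sigma> x - tensor_map \<sigma> y"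
  by (simp add: tensor_map_def frag_extend_diff)

lemma tensor_map_zero: "tensor_map \<sigma> 0 = 0"
  by (simp add: tensor_map_def)

lemma tensor_map_hom:
  assumes \<sigma>: "ring_hom_on UNIV \<sigma>"
  shows "ring_hom_on UNIV (tensor_map \<sigma>)"
proof -
  have s: "\<sigma> 1 = 1" "\<sigma> (a * b) = \<sigma> a * \<sigma> b" for a b using \<sigma> by (auto simp: ring_hom_on_def)
  have U: "x \<in> formal_tensors UNIV UNIV" for x :: "'a formal_tensor"
  proof -
    have "k \<in> {Tensor_Gen a b |a b. a \<in> UNIV \<and> b \<in> UNIV}" for k :: "'a tensor_gen" by (cases k) auto
    then show ?thesis by (auto simp: formal_tensors_def)
  qed
  have "tensor_map \<sigma> (x * y) = tensor_map \<sigma> x * tensor_map \<sigma> y" for x y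
    using U[of x]
  proof (induction rule: formal_tensors_induct)
    case (tensor a b)
    show ?case using U[of y]
    proof (induction rule: formal_tensors_induct)
      case (tensor c d)
      then show ?case by (simp add: tensor_mult tensor_map_tensor s)
    qed (simp_all add: tensor_map_zero right_diff_distrib tensor_map_diff)
  qed (simp_all add: tensor_map_zero left_diff_distrib tensor_map_diff)
  moreover have "tensor_map \<sigma> 1 = 1" using tensor_map_tensor[of \<sigma> 1 1] by (simp add: tensor_one s)
  moreover have "tensor_map \<sigma> (x + y) = tensor_map \<sigma> x + tensor_map \<sigma> y" for x y
    using tensor_map_diff[of \<sigma> "x + y" y] by simp
  ultimately show ?thesis by (simp add: ring_hom_on_def)
qed

lemma tensor_map_relations:
  assumes \<sigma>: "ring_hom_on UNIV \<sigma>" "\<sigma> ` K \<subseteq> K" "\<sigma> ` L \<subseteq> L" and t: "t \<in> tensor_relations K L"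
  shows "tensor_map \<sigma> t \<in> tensor_relations K L"
proof -
  have s: "\<sigma> (a + b) = \<sigma> a + \<sigma> b" "\<sigma> (a * b) = \<sigma> a * \<sigma> b" for a b using \<sigma>(1) by (auto simp: ring_hom_on_def)
  have sK: "a \<in> K \<Longrightarrow> \<sigma> a \<in> K" and sL: "a \<in> L \<Longrightarrow> \<sigma> a \<in> L" for a using \<sigma>(2,3) by auto
  show ?thesis using t
    by induction (auto simp: tensor_map_zero tensor_map_diff tensor_map_tensor s sK sL
      intro: tensor_relations.intros)
qed

section \<open>The equations of the group\<close>

lemma map_matrix_hom_mult:
  fixes A :: "'a::comm_ring_1^'n^'m" and B :: "'a^'k^'n" and \<sigma> :: "'a \<Rightarrow> 'b::comm_ring_1"
  assumes \<sigma>: "ring_hom_on UNIV \<sigma>"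
  shows "map_matrix \<sigma> (A ** B) = map_matrix \<sigma> A ** map_matrix \<sigma> B"
  by (simp add: vec_eq_iff matrix_matrix_mult_def ring_hom_on_sum[OF \<sigma> UNIV_subring]
      ring_hom_onD[OF \<sigma> UNIV_subring])

lemma det_map_matrix_hom:
  fixes A :: "'a::comm_ring_1^'n^'n" and \<sigma> :: "'a \<Rightarrow> 'b::comm_ring_1"
  assumes \<sigma>: "ring_hom_on S \<sigma>" and S: "is_subring S" and A: "\<And>i j. A $ i $ j \<in> S"
  shows "det (map_matrix \<sigma> A) = \<sigma> (det A)"
proof -
  have i: "of_int n \<in> S \<and> \<sigma> (of_int n) = of_int n" for n
    by (induction n rule: int_induct[where k = 0]) (simp_all add: ring_hom_onD[OF \<sigma> S] subringD[OF S])
  have p: "\<sigma> (prod f I) = (\<Prod>i\<in>I. \<sigma> (f i))" if "\<And>i. f i \<in> S" for f :: "'n \<Rightarrow> 'a" and I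
    using that by (induction I rule: infinite_finite_induct)
      (simp_all add: ring_hom_onD[OF \<sigma> S] subring_prod[OF S])
  show ?thesis unfolding det_def
    by (subst ring_hom_on_sum[OF \<sigma> S])
      (simp_all add: i p A subringD(4)[OF S] subring_prod[OF S] ring_hom_onD(4)[OF \<sigma> S])
qed

lemma field_hom_nonzero:
  fixes \<sigma> :: "'a::field \<Rightarrow> 'b::field"
  assumes "ring_hom_on UNIV \<sigma>" "\<sigma> x = 0" shows "x = 0"
proof (rule ccontr)
  assume "x \<noteq> 0"
  have "\<sigma> (x * inverse x) = \<sigma> x * \<sigma> (inverse x)" "\<sigma> 1 = 1" using assms(1) by (auto simp: ring_hom_on_def)
  then show False using \<open>x \<noteq> 0\<close> assms(2) by simp
qed

lemma field_hom_inverse: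
  fixes \<sigma> :: "'a::field \<Rightarrow> 'b::field"
  assumes "ring_hom_on UNIV \<sigma>" shows "\<sigma> (inverse x) = inverse (\<sigma> x)"
proof (cases "x = 0")
  case True
  then show ?thesis using ring_hom_onD(1)[OF assms] by (simp add: is_subring_def)
next
  case False
  have "\<sigma> (x * inverse x) = \<sigma> x * \<sigma> (inverse x)" "\<sigma> 1 = 1" using assms(1) by (auto simp: ring_hom_on_def)
  then show ?thesis using False by (simp add: inverse_unique)
qed

context ring_per_hom
begin

lemma hom_sum: "(\<And>i. i \<in> I \<Longrightarrow> f i \<in> S) \<Longrightarrow> \<phi> (sum f I) \<doteq> (\<Sum>i\<in>I. \<phi> (f i))"
proof (induction I rule: infinite_finite_induct)
  case (insert i I)
  then have "\<phi> (f i + sum f I) \<doteq> \<phi> (f i) + \<phi> (sum f I)"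
    by (intro hom_add subring_sum[OF subring]) auto
  also have "\<dots> \<doteq> \<phi> (f i) + (\<Sum>i\<in>I. \<phi> (f i))"
    using insert by (intro add hom_refl) auto
  finally show ?case using insert by simp
qed (simp_all add: hom_zero)

lemma hom_matrix_mult:
  fixes A :: "'a^'n^'m" and B :: "'a^'k^'n"
  assumes "\<And>i j. A $ i $ j \<in> S" "\<And>i j. B $ i $ j \<in> S"
  shows "map_matrix \<phi> (A ** B) \<doteq>\<^sub>M map_matrix \<phi> A ** map_matrix \<phi> B"
  unfolding matrix_eq_def
proof (intro allI)
  fix i j
  have "\<phi> (\<Sum>k\<in>UNIV. A $ i $ k * B $ k $ j) \<doteq> (\<Sum>k\<in>UNIV. \<phi> (A $ i $ k * B $ k $ j))"
    by (intro hom_sum subringD[OF subring] assms)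
  also have "\<dots> \<doteq> (\<Sum>k\<in>UNIV. \<phi> (A $ i $ k) * \<phi> (B $ k $ j))"
    by (intro sum hom_mult assms)
  finally show "map_matrix \<phi> (A ** B) $ i $ j \<doteq> (map_matrix \<phi> A ** map_matrix \<phi> B) $ i $ j"
    by (simp add: matrix_matrix_mult_def)
qed

lemma hom_matrix_refl:
  fixes A :: "'a^'n^'m"
  shows "(\<And>i j. A $ i $ j \<in> S) \<Longrightarrow> map_matrix \<phi> A \<doteq>\<^sub>M map_matrix \<phi> A"
  by (simp add: matrix_eq_def hom_refl)

lemma hom_matrix_id: "map_matrix \<phi> (mat 1 :: 'a^'n^'n) \<doteq>\<^sub>M mat 1"
  by (simp add: matrix_eq_def mat_def hom_zero hom_one)

end

section \<open>Equality in the tensor product and the two embeddings of L\<close>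

locale tensor_pair =
  fixes K L :: "'a::field set"
  assumes K: "is_subfield K" and L: "is_subfield L" and KL: "K \<subseteq> L"
begin

abbreviation teq (infix "\<doteq>" 50) where "teq \<equiv> tensor_eq K L"

lemmas LR = subringD[OF subfield_subring[OF L]]
lemmas FT = subringD[OF formal_tensors_subring[OF subfield_subring[OF L] subfield_subring[OF L]]]

lemma teq_refl: "x \<in> formal_tensors L L \<Longrightarrow> x \<doteq> x"
  by (simp add: tensor_eq_def tensor_relations.zero)

lemma teq_per: "ring_per (\<doteq>)"
proof
  fix x y assume "x \<doteq> y"
  then show "y \<doteq> x"
    using tensor_relations.diff[OF tensor_relations.zero, of "x - y" K L] by (simp add: tensor_eq_def)
next
  fix x y z assume "x \<doteq> y" "y \<doteq> z"
  then show "x \<doteq> z" using tensor_relations_add[of "x - y" K L "y - z"] by (simp add: tensor_eq_def)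
next
  fix x y x' y' assume *: "x \<doteq> y" "x' \<doteq> y'"
  then have "(x - y) + (x' - y') \<in> tensor_relations K L"
    by (intro tensor_relations_add) (auto simp: tensor_eq_def)
  then have "x + x' - (y + y') \<in> tensor_relations K L" by (simp add: algebra_simps)
  then show "x + x' \<doteq> y + y'" using * by (auto simp: tensor_eq_def intro: FT)
  have "x * (x' - y') + y' * (x - y) \<in> tensor_relations K L"
    using * by (intro tensor_relations_add tensor_relations_mult[OF subfield_subring[OF L]]) (auto simp: tensor_eq_def)
  then have "x * x' - y * y' \<in> tensor_relations K L" by (simp add: algebra_simps)
  then show "x * x' \<doteq> y * y'" using * by (auto simp: tensor_eq_def intro: FT)
qed (use FT in \<open>auto intro: teq_refl\<close>)

lemma teq_tensor: "a \<in> L \<Longrightarrow> b \<in> L \<Longrightarrow> tensor a b \<doteq> tensor a b"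
  by (intro teq_refl tensor_in_formal)

lemma teq_add_left: "a \<in> L \<Longrightarrow> a' \<in> L \<Longrightarrow> b \<in> L \<Longrightarrow> tensor (a + a') b \<doteq> tensor a b + tensor a' b"
  using tensor_relations.add_left[of a L a' b K]
  by (auto simp: tensor_eq_def diff_diff_eq intro!: FT tensor_in_formal LR)

lemma teq_add_right: "a \<in> L \<Longrightarrow> b \<in> L \<Longrightarrow> b' \<in> L \<Longrightarrow> tensor a (b + b') \<doteq> tensor a b + tensor a b'"
  using tensor_relations.add_right[of a L b b' K]
  by (auto simp: tensor_eq_def diff_diff_eq intro!: FT tensor_in_formal LR)

lemma teq_balanced: "c \<in> K \<Longrightarrow> a \<in> L \<Longrightarrow> b \<in> L \<Longrightarrow> tensor (c * a) b \<doteq> tensor a (c * b)"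
  using tensor_relations.balanced[of c K a L b] KL
  by (auto simp: tensor_eq_def intro!: tensor_in_formal LR)

sublocale left: ring_per_hom "(\<doteq>)" L "\<lambda>c. tensor c 1"
proof (intro ring_per_hom.intro teq_per ring_per_hom_axioms.intro)
  \<comment> \<open>The vanishing of \<open>tensor 0 1\<close> is not a generating relation; it
    comes from additivity applied to 0 + 0.\<close>
  have "tensor (0 + 0) 1 \<doteq> tensor 0 1 + tensor 0 1" by (intro teq_add_left LR)
  then have "tensor 0 1 - (tensor 0 1 + tensor 0 1) \<in> tensor_relations K L" by (simp add: tensor_eq_def)
  then have "0 - (tensor 0 1 - (tensor 0 1 + tensor 0 1)) \<in> tensor_relations K L"
    by (rule tensor_relations.diff[OF tensor_relations.zero])
  then show "tensor 0 1 \<doteq> 0" using tensor_in_formal[OF LR(1,2)] FT(1) by (simp add: tensor_eq_def)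
  show "tensor 1 1 \<doteq> 1" using teq_tensor[OF LR(2,2)] by (simp add: tensor_one)
qed (use L subfield_subring teq_add_left LR(2) in \<open>auto simp: tensor_mult intro!: teq_tensor LR\<close>)

sublocale right: ring_per_hom "(\<doteq>)" L "\<lambda>c. tensor 1 c"
proof (intro ring_per_hom.intro teq_per ring_per_hom_axioms.intro)
  have "tensor 1 (0 + 0) \<doteq> tensor 1 0 + tensor 1 0" by (intro teq_add_right LR)
  then have "tensor 1 0 - (tensor 1 0 + tensor 1 0) \<in> tensor_relations K L" by (simp add: tensor_eq_def)
  then have "0 - (tensor 1 0 - (tensor 1 0 + tensor 1 0)) \<in> tensor_relations K L"
    by (rule tensor_relations.diff[OF tensor_relations.zero])
  then show "tensor 1 0 \<doteq> 0" using tensor_in_formal[OF LR(2,1)] FT(1) by (simp add: tensor_eq_def)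
  show "tensor 1 1 \<doteq> 1" using teq_tensor[OF LR(2,2)] by (simp add: tensor_one)
qed (use L subfield_subring teq_add_right LR(2) in \<open>auto simp: tensor_mult intro!: teq_tensor LR\<close>)

lemma teq_base: "c \<in> K \<Longrightarrow> tensor c 1 \<doteq> tensor 1 c"
  using teq_balanced[of c 1 1] LR(2) by simp

end

locale gamma_pair = tensor_pair K L for K L :: "'a::field set" +
  fixes \<Psi> :: "'a^'r^'r"
  assumes Psi: "\<Psi> \<in> GL_over L"
begin

abbreviation "\<iota>1 \<equiv> map_matrix (\<lambda>x. tensor x 1)"
abbreviation "\<iota>2 \<equiv> map_matrix (\<lambda>x. tensor 1 x)"
abbreviation "Y \<equiv> \<iota>1 (matrix_inv \<Psi>) ** \<iota>2 \<Psi>"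
abbreviation "dY \<equiv> tensor (det \<Psi>) (inverse (det \<Psi>))"
abbreviation "T \<equiv> gl_eval (\<lambda>c. tensor c 1) Y dY"

lemma gl_at_tensor_T: "gl_at_tensor \<Psi> h = T h"
  by (simp add: gl_at_tensor_def)

lemma PsiL: "\<Psi> $ i $ j \<in> L" "det \<Psi> \<noteq> 0" using GL_overD[OF Psi] by auto

lemma invL: "matrix_inv \<Psi> $ i $ j \<in> L" by (rule matrix_inv_in_subfield[OF L PsiL])

lemma detL: "det \<Psi> \<in> L" "inverse (det \<Psi>) \<in> L"
  using det_in_subring[OF subfield_subring[OF L] PsiL(1)] subfield_inverse[OF L] by auto

lemma YM: "left.matrix_eq Y Y"
  by (intro left.matrix_eq_mult left.hom_matrix_refl right.hom_matrix_refl invL PsiL)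

lemma Y: "Y $ i $ j \<doteq> Y $ i $ j" using YM by (simp add: left.matrix_eq_def)

lemma dY: "dY \<doteq> dY" by (intro teq_tensor detL)

lemmas T_refl = left.gl_eval_refl[OF Y dY]
lemmas T_add = left.gl_eval_add[OF Y dY]
lemmas T_mult = left.gl_eval_mult[OF Y dY]
lemmas T_const = left.gl_eval_const[OF Y dY]
lemmas T_var = left.gl_eval_var[OF Y dY]

lemmas CL = coeffs_in_arith[OF subfield_subring[OF L]] coeffs_in_mult[OF subfield_subring[OF L]]

text \<open>The kernel of the L-algebra map X \<mapsto> Y, with L acting through the left factor.
  Enlarging the coefficients from F to L makes room for polynomials such as q(\<Psi>X).\<close>

definition J :: "('r, 'a) gl_poly set" where
  "J = {h. coeffs_in L h \<and> T h \<in> tensor_relations K L}"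

lemma J_iff: "h \<in> J \<longleftrightarrow> coeffs_in L h \<and> T h \<doteq> 0"
  using T_refl[of h] FT(1) by (auto simp: J_def tensor_eq_def)

lemma J_diff: assumes "h \<in> J" "g \<in> J" shows "h - g \<in> J"
proof -
  have c: "coeffs_in L h" "coeffs_in L g" "coeffs_in L (h - g)" using assms by (auto simp: J_def CL)
  have "T ((h - g) + g) \<doteq> T (h - g) + T g" by (rule T_add[OF c(3,2)])
  then have "T h \<doteq> T (h - g) + T g" by simp
  moreover have "T g \<doteq> 0" "T h \<doteq> 0" using assms by (auto simp: J_iff)
  ultimately have "0 \<doteq> T (h - g) + T g" using left.sym left.trans by blast
  also have "\<dots> \<doteq> T (h - g) + 0" by (intro left.add T_refl c \<open>T g \<doteq> 0\<close>)
  finally have "T (h - g) \<doteq> 0" using left.sym by simp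
  then show ?thesis using c by (simp add: J_iff)
qed

lemma J_scale: assumes "c \<in> L" "h \<in> J" shows "scale c h \<in> J"
proof -
  have h: "coeffs_in L h" "T h \<doteq> 0" using assms by (auto simp: J_iff)
  have "T (Poly_Mapping.single 0 c * h) \<doteq> T (Poly_Mapping.single 0 c) * T h"
    by (intro T_mult CL assms h)
  also have "\<dots> \<doteq> tensor c 1 * 0" by (intro left.mult T_const assms h)
  finally show ?thesis using h assms by (simp add: J_iff mult_map_scale_conv_mult[symmetric] CL)
qed

text \<open>The map \<sigma> \<otimes> \<sigma> fixes Y: the inverse of \<Psi> acquires the inverse
  of \<Phi> on its right, \<Psi> acquires \<Phi> on its left, and these cancel because elements of K
  pass from one tensor factor to the other. Hence applying \<sigma> to the coefficients of h applies
  \<sigma> \<otimes> \<sigma> to its value.\<close>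

lemma J_sigma:
  assumes \<sigma>: "ring_hom_on UNIV \<sigma>" "\<sigma> ` K \<subseteq> K" "\<sigma> ` L \<subseteq> L"
    and Phi: "\<Phi> \<in> GL_over K" and fund: "map_matrix \<sigma> \<Psi> = \<Phi> ** \<Psi>" and h: "h \<in> J"
  shows "Poly_Mapping.map \<sigma> h \<in> J"
proof -
  have s0: "\<sigma> 0 = 0" using ring_hom_onD(1)[OF \<sigma>(1)] by (simp add: is_subring_def)
  have s1: "\<sigma> 1 = 1" using \<sigma>(1) by (simp add: ring_hom_on_def)
  have hL: "coeffs_in L h" using h by (simp add: J_def)
  have mapL: "coeffs_in L (Poly_Mapping.map \<sigma> h)"
    using hL \<sigma>(3) s0 by (auto simp: coeffs_in_def lookup_map0)
  have PhiK: "\<Phi> $ i $ j \<in> K" "\<Phi> $ i $ j \<in> L" "det \<Phi> \<noteq> 0" for i j using GL_overD[OF Phi] KL by auto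
  have PhiinvK: "matrix_inv \<Phi> $ i $ j \<in> K" "matrix_inv \<Phi> $ i $ j \<in> L" for i j
    using matrix_inv_in_subfield[OF K PhiK(1,3)] KL by auto
  have dPhiK: "det \<Phi> \<in> K" "det \<Phi> \<in> L"
    using det_in_subring[OF subfield_subring[OF K] PhiK(1)] KL by auto
  have detm: "\<sigma> (det \<Psi>) = det \<Phi> * det \<Psi>"
    using det_map_matrix_hom[OF \<sigma>(1) UNIV_subring, of \<Psi>] by (simp add: fund det_mul)
  have inv: "map_matrix \<sigma> (matrix_inv \<Psi>) = matrix_inv \<Psi> ** matrix_inv \<Phi>"
  proof -
    have "map_matrix \<sigma> (matrix_inv \<Psi>) ** (\<Phi> ** \<Psi>) = map_matrix \<sigma> (matrix_inv \<Psi> ** \<Psi>)"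
      by (simp add: map_matrix_hom_mult[OF \<sigma>(1)] fund)
    also have "\<dots> = mat 1" by (simp add: matrix_inv_field(2)[OF PsiL(2)] vec_eq_iff mat_def s0 s1)
    finally have "map_matrix \<sigma> (matrix_inv \<Psi>) ** (\<Phi> ** \<Psi>) ** (matrix_inv \<Psi> ** matrix_inv \<Phi>) =
      matrix_inv \<Psi> ** matrix_inv \<Phi>" by simp
    moreover have "(\<Phi> ** \<Psi>) ** (matrix_inv \<Psi> ** matrix_inv \<Phi>) = \<Phi> ** (\<Psi> ** matrix_inv \<Psi>) ** matrix_inv \<Phi>"
      by (simp only: matrix_mul_assoc)
    then have "(\<Phi> ** \<Psi>) ** (matrix_inv \<Psi> ** matrix_inv \<Phi>) = mat 1"
      by (simp add: matrix_inv_field(1)[OF PsiL(2)] matrix_inv_field(1)[OF PhiK(3)])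
    ultimately show ?thesis by (metis matrix_mul_assoc matrix_mul_rid)
  qed
  note tm = tensor_map_hom[OF \<sigma>(1)]
  have "tensor_map \<sigma> (T h) = gl_eval (\<lambda>c. tensor_map \<sigma> (tensor c 1)) (map_matrix (tensor_map \<sigma>) Y) (tensor_map \<sigma> dY) h"
    by (rule gl_eval_hom[OF tm UNIV_subring]) auto
  also have "map_matrix (tensor_map \<sigma>) Y = \<iota>1 (map_matrix \<sigma> (matrix_inv \<Psi>)) ** \<iota>2 (map_matrix \<sigma> \<Psi>)"
    by (simp add: map_matrix_hom_mult[OF tm]) (simp add: map_matrix_def tensor_map_tensor s1)
  also have "tensor_map \<sigma> dY = tensor (\<sigma> (det \<Psi>)) (inverse (\<sigma> (det \<Psi>)))"
    by (simp add: tensor_map_tensor field_hom_inverse[OF \<sigma>(1)])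
  also have "(\<lambda>c. tensor_map \<sigma> (tensor c 1)) = (\<lambda>c. tensor (\<sigma> c) 1)" by (simp add: tensor_map_tensor s1)
  finally have map: "tensor_map \<sigma> (T h) = gl_eval (\<lambda>c. tensor (\<sigma> c) 1)
    (\<iota>1 (matrix_inv \<Psi> ** matrix_inv \<Phi>) ** \<iota>2 (\<Phi> ** \<Psi>)) (tensor (\<sigma> (det \<Psi>)) (inverse (\<sigma> (det \<Psi>)))) h"
    by (simp add: inv fund)
  have "left.matrix_eq (\<iota>1 (matrix_inv \<Psi> ** matrix_inv \<Phi>) ** \<iota>2 (\<Phi> ** \<Psi>))
      ((\<iota>1 (matrix_inv \<Psi>) ** \<iota>1 (matrix_inv \<Phi>)) ** (\<iota>2 \<Phi> ** \<iota>2 \<Psi>))"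
    by (intro left.matrix_eq_mult left.hom_matrix_mult right.hom_matrix_mult invL PhiinvK PhiK PsiL)
  \<comment> \<open>This is where \<Phi> changes sides: its entries lie in K.\<close>
  also have "left.matrix_eq \<dots> ((\<iota>1 (matrix_inv \<Psi>) ** \<iota>1 (matrix_inv \<Phi>)) ** (\<iota>1 \<Phi> ** \<iota>2 \<Psi>))"
    by (intro left.matrix_eq_mult left.hom_matrix_refl right.hom_matrix_refl invL PhiinvK PsiL)
      (simp add: left.matrix_eq_def left.sym[OF teq_base[OF PhiK(1)]])
  also have "(\<iota>1 (matrix_inv \<Psi>) ** \<iota>1 (matrix_inv \<Phi>)) ** (\<iota>1 \<Phi> ** \<iota>2 \<Psi>) =
      \<iota>1 (matrix_inv \<Psi>) ** (\<iota>1 (matrix_inv \<Phi>) ** \<iota>1 \<Phi>) ** \<iota>2 \<Psi>"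
    by (simp only: matrix_mul_assoc)
  also have "left.matrix_eq \<dots> (\<iota>1 (matrix_inv \<Psi>) ** mat 1 ** \<iota>2 \<Psi>)"
  proof (intro left.matrix_eq_mult left.hom_matrix_refl right.hom_matrix_refl invL PsiL)
    have "left.matrix_eq (\<iota>1 (matrix_inv \<Phi>) ** \<iota>1 \<Phi>) (\<iota>1 (matrix_inv \<Phi> ** \<Phi>))"
      by (intro left.matrix_eq_sym[OF left.hom_matrix_mult] PhiinvK PhiK)
    also have "matrix_inv \<Phi> ** \<Phi> = mat 1" by (rule matrix_inv_field(2)[OF PhiK(3)])
    also have "left.matrix_eq (\<iota>1 (mat 1)) (mat 1)" by (rule left.hom_matrix_id)
    finally show "left.matrix_eq (\<iota>1 (matrix_inv \<Phi>) ** \<iota>1 \<Phi>) (mat 1)" .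
  qed
  finally have M: "left.matrix_eq (\<iota>1 (matrix_inv \<Psi> ** matrix_inv \<Phi>) ** \<iota>2 (\<Phi> ** \<Psi>)) Y" by simp
  \<comment> \<open>The same for the determinant: det \<Phi> moves to the right factor and cancels
    against its inverse.\<close>
  have "tensor (det \<Phi> * det \<Psi>) (inverse (det \<Phi>) * inverse (det \<Psi>)) \<doteq>
      tensor (det \<Psi>) (det \<Phi> * (inverse (det \<Phi>) * inverse (det \<Psi>)))"
    by (intro teq_balanced dPhiK detL LR subfield_inverse[OF L])
  then have D: "tensor (\<sigma> (det \<Psi>)) (inverse (\<sigma> (det \<Psi>))) \<doteq> dY"
    using PhiK(3) by (simp add: detm mult.assoc[symmetric] inverse_mult_distrib)
  have "T (Poly_Mapping.map \<sigma> h) = gl_eval (\<lambda>c. tensor (\<sigma> c) 1) Y dY h"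
    by (rule gl_eval_map_coeffs) (use s0 field_hom_nonzero[OF \<sigma>(1)] in auto)
  also have "\<dots> \<doteq> tensor_map \<sigma> (T h)"
    unfolding map
  proof (rule left.sym, rule left.gl_eval_cong)
    show "tensor (\<sigma> (Poly_Mapping.lookup h m)) 1 \<doteq> tensor (\<sigma> (Poly_Mapping.lookup h m)) 1" for m
      using hL \<sigma>(3) by (intro teq_tensor LR) (auto simp: coeffs_in_def)
  qed (use M D in \<open>auto simp: left.matrix_eq_def\<close>)
  finally have 1: "T (Poly_Mapping.map \<sigma> h) \<doteq> tensor_map \<sigma> (T h)" .
  have "tensor_map \<sigma> (T h) \<in> tensor_relations K L"
    using tensor_map_relations[OF \<sigma>] h by (simp add: J_def)
  then have "tensor_map \<sigma> (T h) \<doteq> 0" using left.refl_right[OF 1] FT(1) by (simp add: tensor_eq_def)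
  then show ?thesis using left.trans[OF 1] mapL by (simp add: J_iff)
qed

lemma J_spanned:
  assumes \<sigma>: "ring_hom_on UNIV \<sigma>" "\<sigma> ` K \<subseteq> K" "\<sigma> ` L \<subseteq> L"
    and Phi: "\<Phi> \<in> GL_over K" and fund: "map_matrix \<sigma> \<Psi> = \<Phi> ** \<Psi>"
    and V: "0 \<in> V" "\<And>h g. h \<in> V \<Longrightarrow> g \<in> V \<Longrightarrow> h + g \<in> V" "\<And>c h. c \<in> L \<Longrightarrow> h \<in> V \<Longrightarrow> scale c h \<in> V"
      "Gamma_ideal (fixed_field \<sigma> L) K L \<Psi> \<subseteq> V"
  shows "J \<subseteq> V"
proof (rule descent_fixed[OF L J_diff J_scale _ _ _ J_sigma[OF \<sigma> Phi fund] V(1-3)])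
  show "\<sigma> 0 = 0" using ring_hom_onD(1)[OF \<sigma>(1)] by (simp add: is_subring_def)
  show "\<sigma> 1 = 1" using \<sigma>(1) by (simp add: ring_hom_on_def)
  show "h \<in> V" if "h \<in> J" "coeffs_in (fixed_field \<sigma> L) h" for h
    using that V(4) by (auto simp: Gamma_ideal_def J_def gl_at_tensor_T)
qed (auto simp: J_def)

text \<open>Here h is q(\<Psi>X). Its value at Y is q of the right copy of \<Psi>, since the left
  copy of \<Psi> times Y is the right copy; in this way the relations of \<Psi> over K become
  elements of J.\<close>

lemma translate:
  assumes "coeffs_in K q"
  shows "\<exists>h. coeffs_in L h \<and> (\<forall>\<gamma>. det \<gamma> \<noteq> 0 \<longrightarrow> gl_at \<gamma> h = gl_at (\<Psi> ** \<gamma>) q) \<and> T h \<doteq> tensor 1 (gl_at \<Psi> q)"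
  using subfield_subring[OF K] assms
proof (induction q rule: gl_poly_ring_induct)
  case (const c)
  then have c: "c \<in> L" using KL by auto
  have "T (Poly_Mapping.single 0 c) \<doteq> tensor 1 c" using left.trans[OF T_const[OF c] teq_base[OF const]] .
  then show ?case using c by (intro exI[of _ "Poly_Mapping.single 0 c"]) (auto simp: gl_at_simps intro: CL)
next
  case (var v)
  let ?x = "\<lambda>v. Poly_Mapping.single (Poly_Mapping.single v 1) (1 :: 'a)"
  let ?c = "Poly_Mapping.single (0 :: ('r \<times> 'r) option \<Rightarrow>\<^sub>0 nat)"
  show ?case
  proof (cases v)
    case None
    let ?h = "?c (inverse (det \<Psi>)) * ?x None"
    have "T ?h \<doteq> T (?c (inverse (det \<Psi>))) * T (?x None)" by (intro T_mult CL detL LR)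
    also have "\<dots> \<doteq> tensor (inverse (det \<Psi>)) 1 * gl_var Y dY None"
      by (intro left.mult T_const T_var detL)
    also have "\<dots> = tensor 1 (inverse (det \<Psi>))" using PsiL(2) by (simp add: gl_var_def tensor_mult)
    finally have "T ?h \<doteq> tensor 1 (inverse (det \<Psi>))" .
    moreover have "coeffs_in L ?h" by (intro CL detL LR)
    ultimately show ?thesis unfolding None
      by (intro exI[of _ ?h]) (simp only: gl_at_simps, simp add: gl_var_def det_mul)
  next
    case (Some ij)
    obtain i j where v: "v = Some (i, j)" using Some by (cases ij) auto
    let ?h = "\<Sum>k\<in>UNIV. ?c (\<Psi> $ i $ k) * ?x (Some (k, j))"
    have hk: "coeffs_in L (?c (\<Psi> $ i $ k) * ?x (Some (k, j)))" for k by (intro CL PsiL LR)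
    \<comment> \<open>T is additive only up to \<open>\<doteq>\<close>, so an entry of \<Psi>X is
      assembled summand by summand, with coefficients, tensor and values tracked together.\<close>
    have sumI: "coeffs_in L (\<Sum>k\<in>I. ?c (\<Psi> $ i $ k) * ?x (Some (k, j))) \<and>
        T (\<Sum>k\<in>I. ?c (\<Psi> $ i $ k) * ?x (Some (k, j))) \<doteq> (\<Sum>k\<in>I. T (?c (\<Psi> $ i $ k) * ?x (Some (k, j)))) \<and>
        gl_at \<gamma> (\<Sum>k\<in>I. ?c (\<Psi> $ i $ k) * ?x (Some (k, j))) = (\<Sum>k\<in>I. \<Psi> $ i $ k * \<gamma> $ k $ j)"
      if "finite I" for I \<gamma>
      using that
    proof (induction I)
      case empty
      show ?case using CL(1) left.zero by (simp add: gl_eval_def gl_at_zero)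
    next
      case (insert k I)
      let ?s = "\<Sum>k\<in>I. ?c (\<Psi> $ i $ k) * ?x (Some (k, j))"
      have "T (?c (\<Psi> $ i $ k) * ?x (Some (k, j)) + ?s) \<doteq> T (?c (\<Psi> $ i $ k) * ?x (Some (k, j))) + T ?s"
        using insert hk by (intro T_add) auto
      also have "\<dots> \<doteq> T (?c (\<Psi> $ i $ k) * ?x (Some (k, j))) + (\<Sum>k\<in>I. T (?c (\<Psi> $ i $ k) * ?x (Some (k, j))))"
        using insert hk by (intro left.add T_refl) auto
      finally show ?case
        using insert hk[of k] by (simp add: CL gl_at_simps gl_at_simps(4)[simplified] gl_var_def)
    qed
    have "T ?h \<doteq> (\<Sum>k\<in>UNIV. T (?c (\<Psi> $ i $ k) * ?x (Some (k, j))))" using sumI[of UNIV] by simp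
    also have "\<dots> \<doteq> (\<Sum>k\<in>UNIV. tensor (\<Psi> $ i $ k) 1 * Y $ k $ j)"
    proof (intro left.sum)
      fix k
      have "T (?c (\<Psi> $ i $ k) * ?x (Some (k, j))) \<doteq> T (?c (\<Psi> $ i $ k)) * T (?x (Some (k, j)))"
        by (intro T_mult CL PsiL LR)
      also have "\<dots> \<doteq> tensor (\<Psi> $ i $ k) 1 * gl_var Y dY (Some (k, j))"
        by (intro left.mult T_const T_var PsiL)
      finally show "T (?c (\<Psi> $ i $ k) * ?x (Some (k, j))) \<doteq> tensor (\<Psi> $ i $ k) 1 * Y $ k $ j"
        by (simp add: gl_var_def)
    qed
    also have "\<dots> = (\<iota>1 \<Psi> ** Y) $ i $ j" by (simp add: matrix_matrix_mult_def)
    also have "\<dots> \<doteq> \<iota>2 \<Psi> $ i $ j"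
    proof -
      have "left.matrix_eq ((\<iota>1 \<Psi> ** \<iota>1 (matrix_inv \<Psi>)) ** \<iota>2 \<Psi>) (\<iota>1 (\<Psi> ** matrix_inv \<Psi>) ** \<iota>2 \<Psi>)"
        by (intro left.matrix_eq_mult left.matrix_eq_sym[OF left.hom_matrix_mult] right.hom_matrix_refl PsiL invL)
      also have "\<Psi> ** matrix_inv \<Psi> = mat 1" by (rule matrix_inv_field(1)[OF PsiL(2)])
      also have "left.matrix_eq (\<iota>1 (mat 1) ** \<iota>2 \<Psi>) (mat 1 ** \<iota>2 \<Psi>)"
        by (intro left.matrix_eq_mult left.hom_matrix_id right.hom_matrix_refl PsiL)
      finally show ?thesis by (simp add: matrix_mul_assoc left.matrix_eq_def)
    qed
    finally have "T ?h \<doteq> tensor 1 (\<Psi> $ i $ j)" by simp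
    then show ?thesis unfolding v using sumI[of UNIV]
      by (intro exI[of _ ?h]) (simp only: gl_at_simps, simp add: gl_var_def matrix_matrix_mult_def)
  qed
next
  case (add q q')
  then obtain h h' where h: "coeffs_in L h" "\<forall>\<gamma>. det \<gamma> \<noteq> 0 \<longrightarrow> gl_at \<gamma> h = gl_at (\<Psi> ** \<gamma>) q" "T h \<doteq> tensor 1 (gl_at \<Psi> q)"
    and h': "coeffs_in L h'" "\<forall>\<gamma>. det \<gamma> \<noteq> 0 \<longrightarrow> gl_at \<gamma> h' = gl_at (\<Psi> ** \<gamma>) q'" "T h' \<doteq> tensor 1 (gl_at \<Psi> q')"
    by blast
  have qL: "gl_at \<Psi> q \<in> L" "gl_at \<Psi> q' \<in> L"
    by (rule gl_at_in_subring[OF subfield_subring[OF L] coeffs_in_mono[OF KL] PsiL(1) detL(2)], fact)+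
  have "T (h + h') \<doteq> T h + T h'" by (intro T_add h h')
  also have "\<dots> \<doteq> tensor 1 (gl_at \<Psi> q) + tensor 1 (gl_at \<Psi> q')" by (intro left.add h h')
  also have "\<dots> \<doteq> tensor 1 (gl_at \<Psi> q + gl_at \<Psi> q')" by (intro left.sym[OF right.hom_add] qL)
  finally show ?case using h h' by (intro exI[of _ "h + h'"]) (simp add: gl_at_simps CL)
next
  case (mult q q')
  then obtain h h' where h: "coeffs_in L h" "\<forall>\<gamma>. det \<gamma> \<noteq> 0 \<longrightarrow> gl_at \<gamma> h = gl_at (\<Psi> ** \<gamma>) q" "T h \<doteq> tensor 1 (gl_at \<Psi> q)"
    and h': "coeffs_in L h'" "\<forall>\<gamma>. det \<gamma> \<noteq> 0 \<longrightarrow> gl_at \<gamma> h' = gl_at (\<Psi> ** \<gamma>) q'" "T h' \<doteq> tensor 1 (gl_at \<Psi> q')"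
    by blast
  have "T (h * h') \<doteq> T h * T h'" by (intro T_mult h h')
  also have "\<dots> \<doteq> tensor 1 (gl_at \<Psi> q) * tensor 1 (gl_at \<Psi> q')" by (intro left.mult h h')
  finally show ?case using h h' by (intro exI[of _ "h * h'"]) (simp add: gl_at_simps CL tensor_mult)
qed

lemma Gamma_stable:
  assumes \<sigma>: "ring_hom_on UNIV \<sigma>" "\<sigma> ` K \<subseteq> K" "\<sigma> ` L \<subseteq> L"
    and Phi: "\<Phi> \<in> GL_over K" and fund: "map_matrix \<sigma> \<Psi> = \<Phi> ** \<Psi>"
    and \<gamma>: "\<gamma> \<in> Gamma_points (fixed_field \<sigma> L) K L \<Psi> R"
    and q: "coeffs_in K q" "gl_at \<Psi> q = 0"
  shows "gl_at (\<Psi> ** \<gamma>) q = 0"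
proof -
  obtain h where h: "coeffs_in L h" "\<And>\<gamma>. det \<gamma> \<noteq> 0 \<Longrightarrow> gl_at \<gamma> h = gl_at (\<Psi> ** \<gamma>) q" "T h \<doteq> tensor 1 0"
    using translate[OF q(1)] q(2) by auto
  then have "h \<in> J" using left.trans[OF h(3) right.hom_zero] by (simp add: J_iff)
  moreover have "J \<subseteq> {h. gl_at \<gamma> h = 0}"
    using \<gamma> by (intro J_spanned[OF \<sigma> Phi fund])
      (auto simp: gl_at_zero gl_at_simps gl_at_scale Gamma_points_def)
  moreover have "det \<gamma> \<noteq> 0" using \<gamma> by (auto simp: Gamma_points_def GL_over_def)
  ultimately show ?thesis using h(2) by auto
qed

text \<open>A defines a homomorphism \<phi> of the coordinate ring with \<Psi> \<mapsto> A, and a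
  \<otimes> b \<mapsto> a \<phi>(b) sends Y to the inverse of \<Psi> times A. The difficulty is that
  the value of g vanishes as a tensor over L, where \<phi> is not defined. So \<phi> is first
  extended K-linearly to the finitely many elements of L that this vanishing involves.\<close>

lemma quotient_point:
  assumes A: "det A \<noteq> 0" "\<And>q. coeffs_in K q \<Longrightarrow> gl_at \<Psi> q = 0 \<Longrightarrow> gl_at A q = 0"
    and g: "g \<in> Gamma_ideal F K L \<Psi>" and F: "F \<subseteq> L"
  shows "gl_at (matrix_inv \<Psi> ** A) g = 0"
proof -
  note RK = subfield_subring[OF K]
  let ?S = "coord_ring K \<Psi>"
  note CK = coeffs_in_arith[OF RK] coeffs_in_mult[OF RK] subringD[OF RK]
  have mem: "gl_at \<Psi> q \<in> ?S" if "coeffs_in K q" for q using that by (auto simp: coord_ring_def)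
  have S: "is_subring ?S" by (rule coord_ring_subring[OF RK])
  define \<phi> where "\<phi> x = gl_at A (SOME q. coeffs_in K q \<and> x = gl_at \<Psi> q)" for x
  have \<phi>: "\<phi> (gl_at \<Psi> q) = gl_at A q" if q: "coeffs_in K q" for q
  proof -
    define q' where "q' = (SOME q'. coeffs_in K q' \<and> gl_at \<Psi> q = gl_at \<Psi> q')"
    have q': "coeffs_in K q' \<and> gl_at \<Psi> q = gl_at \<Psi> q'" unfolding q'_def by (rule someI[of _ q]) (use q in auto)
    have "gl_at A (q - q') = 0" using q q' by (intro A(2)) (auto simp: gl_at_diff CK)
    then show ?thesis unfolding \<phi>_def q'_def[symmetric] by (simp add: gl_at_diff)
  qed
  have const: "c \<in> ?S" "\<phi> c = c" if "c \<in> K" for c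
    using mem[of "Poly_Mapping.single 0 c"] \<phi>[of "Poly_Mapping.single 0 c"] that by (simp_all only: gl_at_simps CK)
  have hom: "ring_hom_on ?S \<phi>"
    unfolding ring_hom_on_def
  proof (intro conjI ballI)
    show "\<phi> 1 = 1" using const(2) CK by auto
    fix x y assume "x \<in> ?S" "y \<in> ?S"
    then obtain q q' where q: "coeffs_in K q" "coeffs_in K q'" "x = gl_at \<Psi> q" "y = gl_at \<Psi> q'"
      by (auto simp: coord_ring_def)
    show "\<phi> (x + y) = \<phi> x + \<phi> y" "\<phi> (x * y) = \<phi> x * \<phi> y"
      using \<phi>[OF CK(2)[OF q(1,2)]] \<phi>[OF CK(6)[OF q(1,2)]] \<phi>[OF q(1)] \<phi>[OF q(2)] q(3,4)
      by (simp_all add: gl_at_simps)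
  qed
  have lin: "linear_on K ?S \<phi>"
    unfolding linear_on_def using subringD[OF S] ring_hom_onD[OF hom S] const by auto
  have gF: "coeffs_in F g" and gT: "T g \<in> tensor_relations K L"
    using g by (auto simp: Gamma_ideal_def gl_at_tensor_T)
  obtain D where D: "finite D" "\<And>V. D \<subseteq> V \<Longrightarrow> T g \<in> tensor_relations K V"
    using tensor_relations_finite[OF gT] by blast
  obtain V \<psi> where V: "linear_on K V \<psi>" "?S \<union> D \<subseteq> V" "\<And>x. x \<in> ?S \<Longrightarrow> \<psi> x = \<phi> x"
    using linear_on_extend[OF K D(1) lin] by blast
  have zero: "tensor_apply \<psi> (T g) = 0" using tensor_apply_relations[OF V(1)] D(2) V(2) by simp
  \<comment> \<open>The linear extension is known to be multiplicative only on the coordinate ring;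
    that suffices, because the right entries of \<open>T g\<close> lie there.\<close>
  have hom': "ring_hom_on ?S \<psi>"
    using hom V(3) subringD[OF S] by (simp add: ring_hom_on_def)
  let ?P = "formal_tensors UNIV ?S"
  note ah = tensor_apply_hom[OF S hom']
  have P: "is_subring ?P" by (rule formal_tensors_subring[OF UNIV_subring S])
  have ent: "\<Psi> $ i $ j \<in> ?S" "\<psi> (\<Psi> $ i $ j) = A $ i $ j" for i j
  proof -
    have c: "coeffs_in K (Poly_Mapping.single (Poly_Mapping.single (Some (i, j)) 1) (1::'a))" by (intro CK)
    show "\<Psi> $ i $ j \<in> ?S" using mem[OF c] by (simp only: gl_at_simps) (simp add: gl_var_def)
    then show "\<psi> (\<Psi> $ i $ j) = A $ i $ j"
      using \<phi>[OF c] V(3) by (simp only: gl_at_simps) (simp add: gl_var_def)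
  qed
  have detS: "inverse (det \<Psi>) \<in> ?S" "\<psi> (inverse (det \<Psi>)) = inverse (det A)"
  proof -
    have c: "coeffs_in K (Poly_Mapping.single (Poly_Mapping.single None 1) (1::'a))" by (intro CK)
    show "inverse (det \<Psi>) \<in> ?S" using mem[OF c] by (simp only: gl_at_simps) (simp add: gl_var_def)
    then show "\<psi> (inverse (det \<Psi>)) = inverse (det A)"
      using \<phi>[OF c] V(3) by (simp only: gl_at_simps) (simp add: gl_var_def)
  qed
  have one: "1 \<in> ?S" "\<psi> 1 = 1" using subringD(2)[OF S] hom' by (auto simp: ring_hom_on_def)
  have YP: "Y $ i $ j \<in> ?P" for i j
    by (intro matrix_mult_in_subring[OF P]) (auto intro!: tensor_in_formal ent one)
  have "tensor_apply \<psi> (T g) =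
      gl_eval (\<lambda>c. tensor_apply \<psi> (tensor c 1)) (map_matrix (tensor_apply \<psi>) Y) (tensor_apply \<psi> dY) g"
    by (rule gl_eval_hom[OF ah P]) (auto intro!: tensor_in_formal one detS YP)
  also have "map_matrix (tensor_apply \<psi>) Y = matrix_inv \<Psi> ** A"
  proof -
    have "tensor_apply \<psi> (Y $ i $ j) = (\<Sum>k\<in>UNIV. tensor_apply \<psi> (tensor (matrix_inv \<Psi> $ i $ k) 1 * tensor 1 (\<Psi> $ k $ j)))" for i j
      unfolding matrix_matrix_mult_def
      by (simp, subst ring_hom_on_sum[OF ah P]) (auto intro!: tensor_in_formal subringD(4)[OF P] ent one)
    then show ?thesis
      by (simp add: vec_eq_iff tensor_mult tensor_apply_tensor ent matrix_matrix_mult_def)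
  qed
  also have "tensor_apply \<psi> dY = inverse (det (matrix_inv \<Psi> ** A))"
    using PsiL(2) A(1) by (simp add: tensor_apply_tensor detS det_mul matrix_inv_field(3))
  also have "(\<lambda>c. tensor_apply \<psi> (tensor c 1)) = (\<lambda>c. c)" by (simp add: tensor_apply_tensor one)
  finally show ?thesis using zero by (simp add: gl_at_def)
qed

end

section \<open>Periodic elements and fraction fields\<close>

lemma UNIV_subfield: "is_subfield (UNIV :: 'a::field set)"
  by (simp add: is_subfield_def)

lemma funpow_hom: "ring_hom_on UNIV \<sigma> \<Longrightarrow> ring_hom_on UNIV (\<sigma> ^^ n)"
  for \<sigma> :: "'a::comm_ring_1 \<Rightarrow> 'a"
  by (induction n) (auto simp: ring_hom_on_def)

lemma field_hom_inj:
  fixes \<sigma> :: "'a::field \<Rightarrow> 'b::field"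
  assumes "ring_hom_on UNIV \<sigma>" shows "inj \<sigma>"
proof (rule injI)
  fix x y assume "\<sigma> x = \<sigma> y"
  then have "\<sigma> (x - y) = 0" using ring_hom_onD(6)[OF assms UNIV_subring] by simp
  then show "x = y" using field_hom_nonzero[OF assms] by fastforce
qed

lemma field_aut_hom:
  assumes "field_aut_on \<sigma> UNIV" shows "ring_hom_on UNIV \<sigma>"
proof -
  have h: "\<sigma> (x + y) = \<sigma> x + \<sigma> y" "\<sigma> (x * y) = \<sigma> x * \<sigma> y" "inj \<sigma>" for x y
    using assms by (auto simp: field_aut_on_def bij_betw_def)
  have "\<sigma> 0 = 0" using h(1)[of 0 0] by (metis add_0 add_right_cancel)
  then have "\<sigma> 1 \<noteq> 0" using h(3) by (metis injD zero_neq_one)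
  moreover have "\<sigma> 1 * \<sigma> 1 = \<sigma> 1" using h(2)[of 1 1] by simp
  ultimately show ?thesis using h by (simp add: ring_hom_on_def)
qed

lemma funpow_fixed_mult: "(f ^^ n) x = x \<Longrightarrow> (f ^^ (n * k)) x = x"
proof (induction k)
  case (Suc k)
  then show ?case by (simp add: funpow_add)
qed simp

text \<open>Two periodic elements have the product of their periods as a common period.\<close>

lemma periodic_subring:
  assumes \<sigma>: "ring_hom_on UNIV \<sigma>"
  shows "is_subring (\<Union>n\<in>{1..}. fixed_field (\<sigma> ^^ n) UNIV)"
proof -
  have common: "\<exists>n\<ge>1. (\<sigma> ^^ n) x = x \<and> (\<sigma> ^^ n) y = y"
    if "n \<ge> 1" "m \<ge> 1" "(\<sigma> ^^ n) x = x" "(\<sigma> ^^ m) y = y" for n m x y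
    using that funpow_fixed_mult[of n \<sigma> x m] funpow_fixed_mult[of m \<sigma> y n]
    by (intro exI[of _ "n * m"]) (auto simp: mult.commute)
  note h = ring_hom_onD[OF funpow_hom[OF \<sigma>] UNIV_subring]
  have "x + y \<in> (\<Union>n\<in>{1..}. fixed_field (\<sigma> ^^ n) UNIV) \<and> x * y \<in> (\<Union>n\<in>{1..}. fixed_field (\<sigma> ^^ n) UNIV)"
    if xy: "x \<in> (\<Union>n\<in>{1..}. fixed_field (\<sigma> ^^ n) UNIV)" "y \<in> (\<Union>n\<in>{1..}. fixed_field (\<sigma> ^^ n) UNIV)" for x y
  proof -
    obtain n where "n \<ge> 1" "(\<sigma> ^^ n) x = x" "(\<sigma> ^^ n) y = y"
      using xy common by (auto simp: fixed_field_def) metis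
    then show ?thesis by (auto simp: fixed_field_def h intro!: bexI[of _ n])
  qed
  then show ?thesis unfolding is_subring_def by (auto simp: fixed_field_def h)
qed

text \<open>A power of \<open>\<sigma>\<close> fixing the coefficients permutes the roots, so every root is periodic.\<close>

lemma periodic_rel_alg_closed:
  fixes \<sigma> :: "'a::alg_closed_field \<Rightarrow> 'a"
  assumes \<sigma>: "ring_hom_on UNIV \<sigma>"
  shows "rel_alg_closed (\<Union>n\<in>{1..}. fixed_field (\<sigma> ^^ n) UNIV)"
  unfolding rel_alg_closed_def
proof (intro ballI impI)
  fix p :: "'a poly" assume p: "p \<in> polys_over (\<Union>n\<in>{1..}. fixed_field (\<sigma> ^^ n) UNIV)" "degree p > 0"
  have "\<forall>i. \<exists>n\<ge>1. (\<sigma> ^^ n) (coeff p i) = coeff p i"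
    using polys_overD[OF p(1)] by (auto simp: fixed_field_def)
  then obtain n where n: "\<And>i. n i \<ge> 1" "\<And>i. (\<sigma> ^^ n i) (coeff p i) = coeff p i" by metis
  \<comment> \<open>A common multiple of the periods of the coefficients, so that the N-th power of
    \<sigma> fixes p.\<close>
  define N where "N = (\<Prod>i\<le>degree p. n i)"
  have N: "N \<ge> 1" unfolding N_def by (metis One_nat_def Suc_leI n(1) less_eq_Suc_le prod_pos)
  define s where "s = \<sigma> ^^ N"
  have s: "ring_hom_on UNIV s" unfolding s_def by (rule funpow_hom[OF \<sigma>])
  have sc: "s (coeff p i) = coeff p i" for i
  proof (cases "i \<le> degree p")
    case True
    then have "N = n i * (\<Prod>j\<in>{..degree p} - {i}. n j)" by (simp add: N_def prod.remove)
    then show ?thesis using funpow_fixed_mult[OF n(2)] by (simp add: s_def)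
  next
    case False
    then show ?thesis using ring_hom_onD(1)[OF s UNIV_subring] by (simp add: coeff_eq_0)
  qed
  have map: "map_poly s p = p"
    by (intro poly_eqI) (simp add: coeff_map_poly sc ring_hom_onD(1)[OF s UNIV_subring])
  obtain y where y: "poly p y = 0" using p(2) alg_closed_imp_poly_has_root by blast
  have roots: "poly p ((s ^^ j) y) = 0" for j
  proof (induction j)
    case (Suc j)
    then show ?case
      using hom_poly[OF s UNIV_subring, of p "(s ^^ j) y"] ring_hom_onD(1)[OF s UNIV_subring]
      by (simp add: map polys_over_def)
  qed (use y in simp)
  have "finite (range (\<lambda>j. (s ^^ j) y))"
    using roots p(2) by (intro finite_subset[OF _ poly_roots_finite[of p]]) auto
  then have "\<not> inj (\<lambda>j. (s ^^ j) y)" using finite_imageD infinite_UNIV_nat by blast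
  then obtain i j where ij: "(s ^^ i) y = (s ^^ j) y" "i \<noteq> j" by (auto simp: inj_on_def)
  have "\<exists>i j. i < j \<and> (s ^^ i) y = (s ^^ j) y"
    using ij by (metis linorder_neqE_nat)
  then obtain i j where ij: "(s ^^ i) y = (s ^^ j) y" "i < j" by blast
  \<comment> \<open>Finiteness of the set of roots only shows that the orbit of y is eventually
    periodic; injectivity of \<open>s ^^ i\<close> cancels the first i steps.\<close>
  have "(s ^^ i) ((s ^^ (j - i)) y) = (s ^^ i) y"
    using ij by (metis add_diff_inverse_nat comp_apply funpow_add less_not_sym)
  then have "(s ^^ (j - i)) y = y" using field_hom_inj[OF funpow_hom[OF s]] by (metis injD)
  then have "(\<sigma> ^^ (N * (j - i))) y = y" by (simp add: s_def funpow_mult mult.commute)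
  moreover have "N * (j - i) \<ge> 1" using N ij(2) by simp
  ultimately show "\<exists>x\<in>\<Union>n\<in>{1..}. fixed_field (\<sigma> ^^ n) UNIV. poly p x = 0"
    using y by (auto simp: fixed_field_def)
qed

section \<open>Fraction fields and generated fields\<close>

lemma fraction_field_subfield:
  assumes R: "is_subring R" shows "is_subfield (fraction_field R)"
proof -
  note A = subringD[OF R]
  have m: "a / b \<in> fraction_field R" if "a \<in> R" "b \<in> R" "b \<noteq> 0" for a b
    using that by (auto simp: fraction_field_def)
  have "a / b + c / d \<in> fraction_field R" "a / b * (c / d) \<in> fraction_field R"
    "- (a / b) \<in> fraction_field R" "inverse (a / b) \<in> fraction_field R"
    if "a \<in> R" "b \<in> R" "b \<noteq> 0" "c \<in> R" "d \<in> R" "d \<noteq> 0" for a b c d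
  proof -
    have "a / b + c / d = (a * d + c * b) / (b * d)" using that by (simp add: add_frac_eq)
    then show "a / b + c / d \<in> fraction_field R" using that A by (auto intro!: m)
    show "a / b * (c / d) \<in> fraction_field R" using that A by (auto intro!: m simp: times_divide_times_eq)
    have "- (a / b) = (- a) / b" by simp
    then show "- (a / b) \<in> fraction_field R" using that A by (metis m)
    show "inverse (a / b) \<in> fraction_field R"
      using that m[of b a] m[of 0 1] A(1,2) by (cases "a = 0") auto
  qed
  moreover have "0 \<in> fraction_field R" "1 \<in> fraction_field R"
    using m[of 0 1] m[of 1 1] A by auto
  ultimately show ?thesis unfolding is_subfield_def by (auto simp: fraction_field_def)
qed

lemma fraction_field_base: "is_subring R \<Longrightarrow> R \<subseteq> fraction_field R"
  using subringD(2)[of R] by (force simp: fraction_field_def)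

lemma field_adjoin_subfield: "is_subfield (field_adjoin K S)"
  unfolding field_adjoin_def is_subfield_def by auto

lemma field_adjoin_subset: "K \<subseteq> field_adjoin K S" "S \<subseteq> field_adjoin K S"
  by (auto simp: field_adjoin_def)

lemma field_adjoin_least: "is_subfield E \<Longrightarrow> K \<subseteq> E \<Longrightarrow> S \<subseteq> E \<Longrightarrow> field_adjoin K S \<subseteq> E"
  by (auto simp: field_adjoin_def)

section \<open>The action\<close>

text \<open>The coefficients of the translate remain in S, which makes it possible to translate by
  \<gamma> repeatedly.\<close>

lemma right_translate:
  fixes \<gamma> :: "'a::field^'r^'r"
  assumes S: "is_subring S" and \<gamma>: "\<And>i j. \<gamma> $ i $ j \<in> S" "inverse (det \<gamma>) \<in> S" and q: "coeffs_in S q"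
  shows "\<exists>h. coeffs_in S h \<and> (\<forall>X. gl_at X h = gl_at (X ** \<gamma>) q)"
  using S q
proof (induction q rule: gl_poly_ring_induct)
  case (const c)
  then show ?case
    by (intro exI[of _ "Poly_Mapping.single 0 c"]) (auto simp: gl_at_simps intro: coeffs_in_arith S)
next
  case (var v)
  let ?x = "\<lambda>v. Poly_Mapping.single (Poly_Mapping.single v 1) (1 :: 'a)"
  let ?c = "Poly_Mapping.single (0 :: ('r \<times> 'r) option \<Rightarrow>\<^sub>0 nat)"
  note C = coeffs_in_arith[OF S] coeffs_in_mult[OF S] subringD(2)[OF S]
  show ?case
  proof (cases v)
    case None
    have "coeffs_in S (?c (inverse (det \<gamma>)) * ?x None)" by (intro C \<gamma>)
    then show ?thesis unfolding None
      by (intro exI[of _ "?c (inverse (det \<gamma>)) * ?x None"])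
        (simp only: gl_at_simps, simp add: gl_var_def det_mul)
  next
    case (Some ij)
    obtain i j where v: "v = Some (i, j)" using Some by (cases ij) auto
    let ?h = "\<lambda>I. \<Sum>k\<in>I. ?c (\<gamma> $ k $ j) * ?x (Some (i, k))"
    have "coeffs_in S (?h I) \<and> gl_at X (?h I) = (\<Sum>k\<in>I. X $ i $ k * \<gamma> $ k $ j)" if "finite I" for I X
      using that
    proof (induction I)
      case (insert k I)
      have "coeffs_in S (?c (\<gamma> $ k $ j) * ?x (Some (i, k)))" by (intro C \<gamma>)
      then show ?case
        using insert by (simp add: C gl_at_simps gl_at_simps(4)[simplified] gl_var_def)
    qed (simp add: gl_at_zero C)
    from this[of UNIV] show ?thesis unfolding v
      by (intro exI[of _ "?h UNIV"]) (simp only: gl_at_simps, simp add: gl_var_def matrix_matrix_mult_def)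
  qed
next
  case (add q q')
  then obtain h h' where "coeffs_in S h" "\<forall>X. gl_at X h = gl_at (X ** \<gamma>) q"
    "coeffs_in S h'" "\<forall>X. gl_at X h' = gl_at (X ** \<gamma>) q'" by blast
  then show ?case by (intro exI[of _ "h + h'"]) (simp add: gl_at_simps coeffs_in_arith[OF S])
next
  case (mult q q')
  then obtain h h' where "coeffs_in S h" "\<forall>X. gl_at X h = gl_at (X ** \<gamma>) q"
    "coeffs_in S h'" "\<forall>X. gl_at X h' = gl_at (X ** \<gamma>) q'" by blast
  then show ?case by (intro exI[of _ "h * h'"]) (simp add: gl_at_simps coeffs_in_mult[OF S])
qed

text \<open>Functions on matrices instead of formal polynomials: the same function has many
  representatives, and linear dependence is wanted between functions.\<close>

definition fun_span :: "('b \<Rightarrow> 'a::comm_ring_1) set \<Rightarrow> ('b \<Rightarrow> 'a) set" where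
  "fun_span E = {f. \<exists>c. \<forall>x. f x = (\<Sum>e\<in>E. c e * e x)}"

lemma fun_spanI: "(\<And>x. f x = (\<Sum>e\<in>E. c e * e x)) \<Longrightarrow> f \<in> fun_span E"
  by (auto simp: fun_span_def)

lemma fun_span_add: "f \<in> fun_span E \<Longrightarrow> g \<in> fun_span E \<Longrightarrow> (\<lambda>x. f x + g x) \<in> fun_span E"
proof -
  assume "f \<in> fun_span E" "g \<in> fun_span E"
  then obtain c d where "\<And>x. f x = (\<Sum>e\<in>E. c e * e x)" "\<And>x. g x = (\<Sum>e\<in>E. d e * e x)"
    by (auto simp: fun_span_def)
  then show ?thesis by (intro fun_spanI[where c = "\<lambda>e. c e + d e"]) (simp add: distrib_right sum.distrib)
qed

lemma fun_span_scale: "f \<in> fun_span E \<Longrightarrow> (\<lambda>x. a * f x) \<in> fun_span E"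
proof -
  assume "f \<in> fun_span E"
  then obtain c where "\<And>x. f x = (\<Sum>e\<in>E. c e * e x)" by (auto simp: fun_span_def)
  then show ?thesis by (intro fun_spanI[where c = "\<lambda>e. a * c e"]) (simp add: sum_distrib_left mult.assoc)
qed

lemma fun_span_zero: "(\<lambda>x. 0) \<in> fun_span E"
  by (rule fun_spanI[where c = "\<lambda>_. 0"]) simp

lemma fun_span_base: "finite E \<Longrightarrow> f \<in> E \<Longrightarrow> f \<in> fun_span E"
  by (rule fun_spanI[where c = "\<lambda>e. if e = f then 1 else 0"]) (simp add: if_distrib[of "\<lambda>c. c * _"] sum.delta cong: if_cong)

lemma fun_span_sum:
  "(\<And>i. i \<in> I \<Longrightarrow> f i \<in> fun_span E) \<Longrightarrow> (\<lambda>x. \<Sum>i\<in>I. f i x) \<in> fun_span E"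
  by (induction I rule: infinite_finite_induct) (auto intro: fun_span_zero fun_span_add)

lemma fun_span_mono:
  assumes "f \<in> fun_span E" "E \<subseteq> E'" "finite E'" shows "f \<in> fun_span E'"
proof -
  obtain c where c: "\<And>x. f x = (\<Sum>e\<in>E. c e * e x)" using assms by (auto simp: fun_span_def)
  have "(\<lambda>x. \<Sum>e\<in>E. c e * e x) \<in> fun_span E'"
    using assms by (intro fun_span_sum fun_span_scale fun_span_base) auto
  then show ?thesis using c by (simp add: fun_span_def)
qed

lemma fun_span_mult:
  assumes "f \<in> fun_span E" "g \<in> fun_span E'" "finite E" "finite E'"
  shows "(\<lambda>x. f x * g x) \<in> fun_span ((\<lambda>(e, e') x. e x * e' x) ` (E \<times> E'))"
proof -
  obtain c d where cd: "\<And>x. f x = (\<Sum>e\<in>E. c e * e x)" "\<And>x. g x = (\<Sum>e\<in>E'. d e * e x)"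
    using assms by (auto simp: fun_span_def)
  have "f x * g x = (\<Sum>e\<in>E. \<Sum>e'\<in>E'. (c e * d e') * (e x * e' x))" for x
    by (simp add: cd sum_product mult_ac)
  moreover have "(\<lambda>x. \<Sum>e\<in>E. \<Sum>e'\<in>E'. (c e * d e') * (e x * e' x)) \<in>
      fun_span ((\<lambda>(e, e') x. e x * e' x) ` (E \<times> E'))"
    using assms(3,4) by (intro fun_span_sum fun_span_scale fun_span_base) (auto intro!: image_eqI)
  ultimately show ?thesis by simp
qed

text \<open>The translates of a constant, of a matrix entry or of the inverse determinant lie in a
  finite-dimensional space that does not depend on the translating matrix. Sums and products lead to
  unions and pairwise products of spanning sets.\<close>

lemma translates_finite_dim:
  fixes q :: "('r::finite, 'a::field) gl_poly" and P :: "'k \<Rightarrow> 'a^'r^'r"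
  shows "\<exists>E. finite E \<and> (\<forall>k. (\<lambda>X. gl_at (X ** P k) q) \<in> fun_span E)"
proof -
  have "coeffs_in UNIV q" by (simp add: coeffs_in_def)
  with UNIV_subring show ?thesis
  proof (induction q rule: gl_poly_ring_induct)
    case (const c)
    have "(\<lambda>X. gl_at (X ** P k) (Poly_Mapping.single 0 c)) \<in> fun_span {\<lambda>_. c}" for k
      unfolding gl_at_simps by (rule fun_span_base) auto
    then show ?case by blast
  next
    case (var v)
    show ?case
    proof (cases v)
      case None
      have "(\<lambda>X. inverse (det (P k)) * inverse (det X)) \<in> fun_span {\<lambda>X. inverse (det X)}" for k
        by (intro fun_span_scale fun_span_base) auto
      then show ?thesis unfolding None gl_at_simps
        by (intro exI[of _ "{\<lambda>X. inverse (det X)}"]) (auto simp: gl_var_def det_mul mult.commute)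
    next
      case (Some ij)
      obtain i j where v: "v = Some (i, j)" using Some by (cases ij) auto
      let ?E = "range (\<lambda>l (X :: 'a^'r^'r). X $ i $ l)"
      have "(\<lambda>X. \<Sum>l\<in>UNIV. P k $ l $ j * X $ i $ l) \<in> fun_span ?E" for k
        by (intro fun_span_sum fun_span_scale fun_span_base) auto
      then show ?thesis unfolding v gl_at_simps
        by (intro exI[of _ ?E]) (auto simp: gl_var_def matrix_matrix_mult_def mult.commute)
    qed
  next
    case (add q q')
    then obtain E E' where E: "finite E" "finite E'" "\<And>k. (\<lambda>X. gl_at (X ** P k) q) \<in> fun_span E"
      "\<And>k. (\<lambda>X. gl_at (X ** P k) q') \<in> fun_span E'" by blast
    have "(\<lambda>X. gl_at (X ** P k) q + gl_at (X ** P k) q') \<in> fun_span (E \<union> E')" for k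
      using E by (intro fun_span_add) (auto intro: fun_span_mono)
    then show ?case using E(1,2) by (intro exI[of _ "E \<union> E'"]) (simp add: gl_at_simps)
  next
    case (mult q q')
    then obtain E E' where E: "finite E" "finite E'" "\<And>k. (\<lambda>X. gl_at (X ** P k) q) \<in> fun_span E"
      "\<And>k. (\<lambda>X. gl_at (X ** P k) q') \<in> fun_span E'" by blast
    let ?E = "(\<lambda>(e, e') x. e x * e' x) ` (E \<times> E')"
    have "(\<lambda>X. gl_at (X ** P k) q * gl_at (X ** P k) q') \<in> fun_span ?E" for k
      by (rule fun_span_mult[OF E(3,4,1,2)])
    then show ?case using E(1,2) by (intro exI[of _ ?E]) (simp add: gl_at_simps)
  qed
qed

text \<open>
  The translates of q by the powers of \<open>\<gamma>\<close> are linearly dependent. As \<open>\<gamma>\<close> is invertible, the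
  relation can be shifted so that its first term is q itself.
\<close>

lemma translation_injective:
  fixes \<gamma> \<Psi> :: "'a::field^'r^'r"
  assumes \<gamma>: "det \<gamma> \<noteq> 0" and zero: "\<And>k. gl_at (((\<lambda>X. X ** \<gamma>) ^^ Suc k) \<Psi>) q = 0"
  shows "gl_at \<Psi> q = 0"
proof -
  let ?R = "\<lambda>k. (\<lambda>X. X ** \<gamma>) ^^ k"
  have R: "?R k X = X ** ?R k (mat 1)" for k X
    by (induction k) (simp_all add: matrix_mul_assoc)
  obtain E where E: "finite E" "\<And>k. (\<lambda>X. gl_at (X ** ?R k (mat 1)) q) \<in> fun_span E"
    using translates_finite_dim[of "\<lambda>k. ?R k (mat 1)" q] by blast
  have "\<forall>k. \<exists>c. \<forall>X. gl_at (?R k X) q = (\<Sum>e\<in>E. c e * e X)"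
    using E(2) by (simp add: fun_span_def R[symmetric])
  from choice[OF this] obtain M where M: "\<And>k X. gl_at (?R k X) q = (\<Sum>e\<in>E. M k e * e X)" by blast
  \<comment> \<open>One translate more than there are spanning functions.\<close>
  obtain c where c: "\<exists>k\<in>{..card E}. c k \<noteq> 0" "\<forall>e\<in>E. (\<Sum>k\<in>{..card E}. c k * M k e) = 0"
    using homogeneous_solution[OF UNIV_subfield E(1), of "{..card E}" M] by (auto simp del: sum.atMost_Suc)
  have rel: "(\<Sum>k\<le>card E. c k * gl_at (?R k X) q) = 0" for X
  proof -
    have "(\<Sum>k\<le>card E. c k * gl_at (?R k X) q) = (\<Sum>k\<le>card E. \<Sum>e\<in>E. (c k * M k e) * e X)"
      by (simp add: M sum_distrib_left mult.assoc)
    also have "\<dots> = (\<Sum>e\<in>E. (\<Sum>k\<le>card E. c k * M k e) * e X)"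
      by (subst sum.swap) (simp add: sum_distrib_right)
    finally show ?thesis using c(2) by simp
  qed
  define k0 where "k0 = (LEAST k. c k \<noteq> 0)"
  have k0: "c k0 \<noteq> 0" "\<And>k. k < k0 \<Longrightarrow> c k = 0"
    unfolding k0_def using c(1) LeastI[of "\<lambda>k. c k \<noteq> 0"] not_less_Least by blast+
  have "k0 \<le> card E" using c(1) k0(2) by (metis atMost_iff le_trans not_le_imp_less)
  \<comment> \<open>The relation holds at every X, so it can be read where
    \<open>?R k0 X = \<Psi>\<close>. There the terms before \<open>k0\<close> have coefficient 0,
    and those after it are values at \<Psi> times positive powers of \<gamma>, which vanish by
    assumption.\<close>
  have "\<exists>X. ?R k X = \<Psi>" for k
  proof (induction k)
    case (Suc k)
    then obtain X where "?R k X = \<Psi>" by blast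
    then have "?R (Suc k) (X ** matrix_inv \<gamma>) = \<Psi>"
      unfolding funpow_Suc_right
      by (simp add: matrix_mul_assoc[symmetric] matrix_inv_field(2)[OF \<gamma>])
    then show ?case by blast
  qed simp
  then obtain X where X: "?R k0 X = \<Psi>" by blast
  have others: "c k * gl_at (?R k X) q = 0" if "k \<noteq> k0" for k
  proof (cases "k < k0")
    case False
    then have "k0 < k" using that by simp
    then obtain j where "k = Suc (k0 + j)" using less_imp_Suc_add by blast
    then have "k = Suc j + k0" by simp
    then have "?R k X = ?R (Suc j) \<Psi>" by (simp only: funpow_add comp_apply X)
    then show ?thesis using zero by simp
  qed (use k0 in simp)
  have "(\<Sum>k\<le>card E. c k * gl_at (?R k X) q) = (\<Sum>k\<in>{k0}. c k * gl_at (?R k X) q)"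
    by (rule sum.mono_neutral_right) (use \<open>k0 \<le> card E\<close> others in blast)+
  then show ?thesis using rel[of X] k0(1) X by simp
qed

text \<open>By \<open>regular_extension\<close>, the support of a relation over the closure of K
  carries a nonzero relation over K. For minimal support the two are proportional, which is what
  \<open>descent\<close> asks for.\<close>

lemma relations_from_base:
  fixes K E L :: "'a::alg_closed_field set" and \<Psi> :: "'a^'r^'r"
  assumes K: "is_subfield K" and Kbar: "is_subfield (alg_closure_of K)"
    and E: "is_subfield E" "K \<subseteq> E" "E \<subseteq> L" "alg_closure_in E K = K" and sep: "separable_over K L"
    and Psi: "\<And>i j. \<Psi> $ i $ j \<in> E"
    and V: "0 \<in> V" "\<And>h g. h \<in> V \<Longrightarrow> g \<in> V \<Longrightarrow> h + g \<in> V"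
      "\<And>c h. c \<in> alg_closure_of K \<Longrightarrow> h \<in> V \<Longrightarrow> scale c h \<in> V"
      "\<And>h. coeffs_in K h \<Longrightarrow> gl_at \<Psi> h = 0 \<Longrightarrow> h \<in> V"
    and q: "coeffs_in (alg_closure_of K) q" "gl_at \<Psi> q = 0"
  shows "q \<in> V"
proof -
  let ?C = "alg_closure_of K"
  let ?J = "{h. coeffs_in ?C h \<and> gl_at \<Psi> h = 0}"
  note C = coeffs_in_arith[OF subfield_subring[OF Kbar]]
  have KC: "K \<subseteq> ?C" using algebraic_over_base[OF subfield_subring[OF K]] by (auto simp: alg_closure_in_def)
  have "?J \<subseteq> V"
  proof (rule descent[OF Kbar, where ?J0.0 = "{h \<in> ?J. coeffs_in K h}"])
    fix h assume h: "h \<in> ?J" "h \<noteq> 0"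
      and min: "\<And>g. g \<in> ?J \<Longrightarrow> g \<noteq> 0 \<Longrightarrow> Poly_Mapping.keys g \<subseteq> Poly_Mapping.keys h \<Longrightarrow> Poly_Mapping.keys g = Poly_Mapping.keys h"
    let ?I = "Poly_Mapping.keys h" and ?v = "gl_monom \<Psi> (inverse (det \<Psi>))"
    have d: "inverse (det \<Psi>) \<in> E"
      by (intro subfield_inverse[OF E(1)] det_in_subring[OF subfield_subring[OF E(1)]] Psi)
    have v: "?v m \<in> E" for m
      unfolding gl_monom_def gl_var_def
      by (intro subring_prod[OF subfield_subring[OF E(1)]] subringD(7)[OF subfield_subring[OF E(1)]])
        (auto simp: Psi d split: option.split)
    have "\<exists>k. (\<forall>i\<in>?I. k i \<in> K) \<and> (\<exists>i\<in>?I. k i \<noteq> 0) \<and> (\<Sum>i\<in>?I. k i * ?v i) = 0"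
    proof (rule regular_extension[OF K Kbar E sep, where c = "Poly_Mapping.lookup h"])
      show "\<exists>i\<in>?I. Poly_Mapping.lookup h i \<noteq> 0" using h(2) by (metis all_not_in_conv in_keys_iff keys_eq_empty)
      show "(\<Sum>i\<in>?I. Poly_Mapping.lookup h i * ?v i) = 0" using h(1) by (simp add: gl_at_def gl_eval_monom)
    qed (use h v in \<open>auto simp: coeffs_in_def\<close>)
    then obtain k where k: "\<And>i. i \<in> ?I \<Longrightarrow> k i \<in> K" "\<exists>i\<in>?I. k i \<noteq> 0" "(\<Sum>i\<in>?I. k i * ?v i) = 0" by blast
    define g where "g = (\<Sum>m\<in>?I. Poly_Mapping.single m (k m))"
    have lg: "Poly_Mapping.lookup g m = (if m \<in> ?I then k m else 0)" for m
      by (simp add: g_def lookup_sum lookup_single when_def sum.delta)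
    have gK: "coeffs_in K g" using k(1) subringD(1)[OF subfield_subring[OF K]] by (simp add: coeffs_in_def lg)
    have keys: "Poly_Mapping.keys g \<subseteq> ?I" by (auto simp: in_keys_iff lg split: if_splits)
    have "gl_at \<Psi> g = (\<Sum>m\<in>?I. Poly_Mapping.lookup g m * ?v m)"
      unfolding gl_at_def gl_eval_monom using keys by (intro sum.mono_neutral_left) (auto simp: in_keys_iff)
    then have "gl_at \<Psi> g = 0" using k(3) by (simp add: lg)
    then have gJ: "g \<in> ?J" using coeffs_in_mono[OF KC gK] by simp
    obtain m where m: "m \<in> ?I" "k m \<noteq> 0" using k(2) by blast
    have "g \<noteq> 0" using m lg by (metis lookup_zero)
    define a where "a = Poly_Mapping.lookup h m / k m"
    have a: "a \<noteq> 0" "a \<in> ?C" unfolding a_def using m h(1) k(1) KC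
      by (auto simp: in_keys_iff coeffs_in_def intro!: subfield_divide[OF Kbar])
    define h' where "h' = h - scale a g"
    have "h' \<in> ?J" using h(1) gJ a(2) by (simp add: h'_def C gl_at_diff gl_at_scale)
    moreover have "Poly_Mapping.keys h' \<subseteq> ?I" "m \<notin> Poly_Mapping.keys h'"
      using m by (auto simp: h'_def in_keys_iff lookup_minus lookup_scale lg a_def)
    ultimately have "h' = 0" using min m(1) by blast
    then have "scale (inverse a) h = g"
      using a(1) by (intro poly_mapping_eqI) (simp add: h'_def lookup_scale)
    moreover have "inverse a \<in> ?C" "inverse a \<noteq> 0" using a subfield_inverse[OF Kbar] by auto
    ultimately show "\<exists>c\<in>?C. c \<noteq> 0 \<and> scale c h \<in> {h \<in> ?J. coeffs_in K h}" using gJ gK by blast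
  qed (use V C in \<open>auto simp: gl_at_diff gl_at_scale\<close>)
  then show ?thesis using q by blast
qed

section \<open>Well-definedness of the action\<close>

lemma act_ring_eq:
  fixes \<Psi> \<gamma> :: "'a::field^'r^'r"
  assumes S: "is_subring S" and stable: "\<And>q. coeffs_in S q \<Longrightarrow> gl_at \<Psi> q = 0 \<Longrightarrow> gl_at (\<Psi> ** \<gamma>) q = 0"
    and h: "coeffs_in S h"
  shows "act_ring S \<Psi> \<gamma> (gl_at \<Psi> h) = gl_at (\<Psi> ** \<gamma>) h"
  unfolding act_ring_def
proof (rule the_equality)
  fix y assume "\<exists>h'. coeffs_in S h' \<and> gl_at \<Psi> h = gl_at \<Psi> h' \<and> y = gl_at (\<Psi> ** \<gamma>) h'"
  then obtain h' where h': "coeffs_in S h'" "gl_at \<Psi> h = gl_at \<Psi> h'" "y = gl_at (\<Psi> ** \<gamma>) h'" by blast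
  have "gl_at (\<Psi> ** \<gamma>) (h' - h) = 0"
    using h h' by (intro stable) (simp_all add: gl_at_diff coeffs_in_arith[OF S])
  then show "y = gl_at (\<Psi> ** \<gamma>) h" using h' by (simp add: gl_at_diff)
qed (use h in blast)

text \<open>Both directions of \<open>stable\<close> are used: one makes the value independent of
  the representing fraction, the other keeps the denominators nonzero.\<close>

lemma act_field_eq:
  fixes \<Psi> \<gamma> :: "'a::field^'r^'r"
  assumes S: "is_subring S" and stable: "\<And>q. coeffs_in S q \<Longrightarrow> gl_at \<Psi> q = 0 \<longleftrightarrow> gl_at (\<Psi> ** \<gamma>) q = 0"
    and ab: "coeffs_in S a" "coeffs_in S b" "gl_at \<Psi> b \<noteq> 0"
  shows "act_field S \<Psi> \<gamma> (gl_at \<Psi> a / gl_at \<Psi> b) = gl_at (\<Psi> ** \<gamma>) a / gl_at (\<Psi> ** \<gamma>) b"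
  unfolding act_field_def
proof (rule the_equality)
  have act: "act_ring S \<Psi> \<gamma> (gl_at \<Psi> h) = gl_at (\<Psi> ** \<gamma>) h" if "coeffs_in S h" for h
    using act_ring_eq[OF S _ that] stable by blast
  show "\<exists>x\<in>coord_ring S \<Psi>. \<exists>y\<in>coord_ring S \<Psi>. y \<noteq> 0 \<and> gl_at \<Psi> a / gl_at \<Psi> b = x / y \<and>
      gl_at (\<Psi> ** \<gamma>) a / gl_at (\<Psi> ** \<gamma>) b = act_ring S \<Psi> \<gamma> x / act_ring S \<Psi> \<gamma> y"
    using ab act by (intro bexI[of _ "gl_at \<Psi> a"] bexI[of _ "gl_at \<Psi> b"]) (auto simp: coord_ring_def)
  fix y assume "\<exists>u\<in>coord_ring S \<Psi>. \<exists>w\<in>coord_ring S \<Psi>. w \<noteq> 0 \<and> gl_at \<Psi> a / gl_at \<Psi> b = u / w \<and>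
      y = act_ring S \<Psi> \<gamma> u / act_ring S \<Psi> \<gamma> w"
  then obtain a' b' where ab': "coeffs_in S a'" "coeffs_in S b'" "gl_at \<Psi> b' \<noteq> 0"
    "gl_at \<Psi> a / gl_at \<Psi> b = gl_at \<Psi> a' / gl_at \<Psi> b'" "y = gl_at (\<Psi> ** \<gamma>) a' / gl_at (\<Psi> ** \<gamma>) b'"
    by (auto simp: coord_ring_def act)
  have "coeffs_in S (a * b' - a' * b)" using ab ab' by (intro coeffs_in_arith coeffs_in_mult S)
  moreover have "gl_at \<Psi> (a * b' - a' * b) = 0" using ab ab' by (simp add: gl_at_diff gl_at_simps frac_eq_eq)
  ultimately have "gl_at (\<Psi> ** \<gamma>) (a * b' - a' * b) = 0" using stable by blast
  moreover have "gl_at (\<Psi> ** \<gamma>) b \<noteq> 0" "gl_at (\<Psi> ** \<gamma>) b' \<noteq> 0" using stable ab ab' by auto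
  ultimately show "y = gl_at (\<Psi> ** \<gamma>) a / gl_at (\<Psi> ** \<gamma>) b"
    using ab' by (simp add: gl_at_diff gl_at_simps frac_eq_eq)
qed

text \<open>
  The points of a variety over a relatively algebraically closed k are dense: specialize the
  coordinates of a generic point B.
\<close>

lemma specialize_matrix:
  fixes B :: "'a::field^'r^'r"
  assumes k: "is_subring k" "rel_alg_closed k" and B: "det B \<noteq> 0" and g: "coeffs_in k g" "gl_at B g \<noteq> 0"
  shows "\<exists>\<gamma>\<in>GL_over k. gl_at \<gamma> g \<noteq> 0 \<and> (\<forall>h. coeffs_in k h \<longrightarrow> gl_at B h = 0 \<longrightarrow> gl_at \<gamma> h = 0)"
proof -
  \<comment> \<open>The inverse determinant is adjoined together with the entries, so that its image
    inverts the determinant of the specialized matrix.\<close>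
  obtain xs where xs: "set xs = insert (inverse (det B)) (range (\<lambda>(i, j). B $ i $ j))"
    using finite_list[of "insert (inverse (det B)) (range (\<lambda>(i, j). B $ i $ j))"] by auto
  let ?A = "adjoin_list k xs"
  have A: "is_subring ?A" "k \<subseteq> ?A" by (rule adjoin_list_subring[OF k(1)], rule subset_adjoin_list[OF k(1)])
  have BA: "inverse (det B) \<in> ?A" "B $ i $ j \<in> ?A" for i j
    using set_subset_adjoin_list[OF k(1), of xs] xs by auto
  have gA: "gl_at B g \<in> ?A" by (intro gl_at_in_subring A BA coeffs_in_mono[OF A(2)] g)
  obtain \<phi> where \<phi>: "ring_hom_on ?A \<phi>" "\<phi> ` ?A \<subseteq> k" "\<forall>a\<in>k. \<phi> a = a" "\<phi> (gl_at B g) \<noteq> 0"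
    using specialize[OF k gA g(2)] by blast
  define \<gamma> where "\<gamma> = map_matrix \<phi> B"
  have dA: "det B \<in> ?A" by (rule det_in_subring[OF A(1) BA(2)])
  have det: "det \<gamma> = \<phi> (det B)"
    unfolding \<gamma>_def by (rule det_map_matrix_hom[OF \<phi>(1) A(1) BA(2)])
  have dinv: "det \<gamma> * \<phi> (inverse (det B)) = 1"
    using ring_hom_onD(4)[OF \<phi>(1) A(1) dA BA(1)] ring_hom_onD(2)[OF \<phi>(1) A(1)] B det by simp
  then have \<gamma>0: "det \<gamma> \<noteq> 0" and inv: "\<phi> (inverse (det B)) = inverse (det \<gamma>)"
    by (auto simp: inverse_unique)
  have ev: "\<phi> (gl_at B h) = gl_at \<gamma> h" if h: "coeffs_in k h" for h
  proof -
    have "\<phi> (gl_at B h) = gl_eval (\<lambda>c. \<phi> c) \<gamma> (inverse (det \<gamma>)) h"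
      unfolding gl_at_def \<gamma>_def inv[unfolded \<gamma>_def, symmetric]
      using gl_eval_hom[OF \<phi>(1) A(1), of "\<lambda>c. c" h B "inverse (det B)"] h A(2) BA
      by (auto simp: coeffs_in_def)
    also have "\<dots> = gl_at \<gamma> h"
      unfolding gl_at_def gl_eval_monom using h \<phi>(3) by (simp add: coeffs_in_def)
    finally show ?thesis .
  qed
  have "\<gamma> \<in> GL_over k" using \<phi>(2) BA(2) \<gamma>0 by (intro GL_overI) (auto simp: \<gamma>_def)
  moreover have "gl_at \<gamma> g \<noteq> 0" using \<phi>(4) ev[OF g(1)] by simp
  moreover have "gl_at \<gamma> h = 0" if "coeffs_in k h" "gl_at B h = 0" for h
    using ev[OF that(1)] that(2) ring_hom_onD(1)[OF \<phi>(1) A(1)] by simp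
  ultimately show ?thesis by blast
qed

theorem theorem4p4p6:
  fixes F K L Kbar Fbar \<Lambda> \<Lambda>tilde :: "'a::alg_closed_field set"
    and \<sigma> \<sigma>bar :: "'a \<Rightarrow> 'a"
    and \<Phi> \<Psi> :: "'a^'r^'r"
    and \<Gamma> :: "('a^'r^'r) set"
    and Fn :: "nat \<Rightarrow> 'a set"
  defines "Kbar \<equiv> alg_closure_of K"
    and "Fbar \<equiv> alg_closure_of F"
    and "\<Lambda> \<equiv> field_adjoin K (mat_entries \<Psi>)"
    and "\<Lambda>tilde \<equiv> fraction_field (coord_ring Kbar \<Psi>)"
    and "\<Gamma> \<equiv> Gamma_points F K L \<Psi> Fbar"
    and "Fn \<equiv> \<lambda>n. fixed_field (\<sigma>bar ^^ n) UNIV"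
  assumes Lbar: "alg_closure_of L = UNIV"
    and admissible: "sigma_admissible F K L \<sigma>"
    and Phi: "\<Phi> \<in> GL_over K"
    and Psi: "\<Psi> \<in> GL_over L"
    and fundamental: "map_matrix \<sigma> \<Psi> = \<Phi> ** \<Psi>"
    and alg_closed_in: "alg_closure_in \<Lambda> K = K"
    and extension: "field_aut_on \<sigma>bar UNIV" "\<And>x. x \<in> L \<Longrightarrow> \<sigma>bar x = \<sigma> x"
    and admissible_n: "\<And>n. n \<ge> 1 \<Longrightarrow> sigma_admissible (Fn n) Kbar UNIV (\<sigma>bar ^^ n)"
    and Fbar_union: "Fbar = (\<Union>n\<in>{1..}. Fn n)"
  shows "{f \<in> \<Lambda>tilde. \<forall>\<gamma>\<in>\<Gamma>. act_field Kbar \<Psi> \<gamma> f = f} = Kbar \<and>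
      {f \<in> \<Lambda>. \<forall>\<gamma>\<in>\<Gamma>. act_field Kbar \<Psi> \<gamma> f = f} = K"
proof -
  have F: "is_subfield F" and K: "is_subfield K" and L: "is_subfield L" and FK: "F \<subseteq> K" and KL: "K \<subseteq> L"
    and autL: "field_aut_on \<sigma> L" and autK: "field_aut_on \<sigma> K" and FL: "F = fixed_field \<sigma> L"
    and sep: "separable_over K L"
    using admissible unfolding sigma_admissible_def by blast+
  have Kbar: "is_subfield Kbar" using admissible_n[of 1] by (simp add: sigma_admissible_def)
  note RK = subfield_subring[OF K] and RC = subfield_subring[OF Kbar] and RL = subfield_subring[OF L]
  have \<sigma>: "ring_hom_on UNIV \<sigma>bar" by (rule field_aut_hom[OF extension(1)])
  have \<sigma>K: "\<sigma>bar ` K \<subseteq> K" and \<sigma>L: "\<sigma>bar ` L \<subseteq> L"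
    using autK autL extension(2) KL by (auto simp: field_aut_on_def bij_betw_def)
  have F_fix: "F = fixed_field \<sigma>bar L" using FL extension(2) by (auto simp: fixed_field_def)
  have fund: "map_matrix \<sigma>bar \<Psi> = \<Phi> ** \<Psi>"
    using fundamental GL_overD(1)[OF Psi] extension(2) by (simp add: vec_eq_iff)
  have KC: "K \<subseteq> Kbar"
    using algebraic_over_base[OF RK] by (auto simp: Kbar_def alg_closure_in_def)
  have FC: "Fbar \<subseteq> Kbar"
    using algebraic_over_mono[OF FK] by (auto simp: Fbar_def Kbar_def alg_closure_in_def)
  \<comment> \<open>The description of the closure of F by periodic elements supplies both
    properties.\<close>
  have Fb: "is_subring Fbar" "rel_alg_closed Fbar"
    using periodic_subring[OF \<sigma>] periodic_rel_alg_closed[OF \<sigma>] unfolding Fbar_union Fn_def by auto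
  have Kclosed: "rel_alg_closed Kbar" unfolding Kbar_def by (rule alg_closure_rel_alg_closed[OF K])
  have PsiL: "\<Psi> $ i $ j \<in> L" "det \<Psi> \<noteq> 0" for i j using GL_overD[OF Psi] by auto
  interpret gamma_pair K L \<Psi> using K L KL Psi by unfold_locales
  have \<Lambda>: "is_subfield \<Lambda>" "K \<subseteq> \<Lambda>" "\<Psi> $ i $ j \<in> \<Lambda>" "\<Lambda> \<subseteq> L" for i j
  proof -
    show "is_subfield \<Lambda>" "K \<subseteq> \<Lambda>" unfolding \<Lambda>_def by (rule field_adjoin_subfield, rule field_adjoin_subset)
    show "\<Psi> $ i $ j \<in> \<Lambda>"
      using field_adjoin_subset(2)[of "mat_entries \<Psi>" K] unfolding \<Lambda>_def by (auto simp: mat_entries_def)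
    show "\<Lambda> \<subseteq> L" unfolding \<Lambda>_def using PsiL KL by (intro field_adjoin_least[OF L]) (auto simp: mat_entries_def)
  qed
  have stable: "gl_at (\<Psi> ** \<gamma>) q = 0"
    if \<gamma>: "\<gamma> \<in> \<Gamma>" and q: "coeffs_in Kbar q" "gl_at \<Psi> q = 0" for \<gamma> :: "'a^'r^'r" and q
  proof -
    have g: "\<gamma> \<in> Gamma_points (fixed_field \<sigma>bar L) K L \<Psi> Fbar" using \<gamma> F_fix by (simp add: \<Gamma>_def)
    have "q \<in> {q. gl_at (\<Psi> ** \<gamma>) q = 0}"
      by (rule relations_from_base[OF K Kbar[unfolded Kbar_def] \<Lambda>(1,2,4) alg_closed_in sep \<Lambda>(3)])
        (use Gamma_stable[OF \<sigma> \<sigma>K \<sigma>L Phi fund g] q in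
          \<open>auto simp: Kbar_def gl_at_zero gl_at_simps gl_at_scale\<close>)
    then show ?thesis by simp
  qed
  have \<Gamma>GL: "\<gamma> $ i $ j \<in> Fbar" "\<gamma> $ i $ j \<in> Kbar" "det \<gamma> \<noteq> 0" "inverse (det \<gamma>) \<in> Kbar"
    if "\<gamma> \<in> \<Gamma>" for \<gamma> :: "'a^'r^'r" and i j
  proof -
    have g: "\<gamma> \<in> GL_over Fbar" using that by (simp add: \<Gamma>_def Gamma_points_def)
    show e: "\<gamma> $ i $ j \<in> Fbar" "\<gamma> $ i $ j \<in> Kbar" "det \<gamma> \<noteq> 0" for i j using GL_overD[OF g] FC by auto
    show "inverse (det \<gamma>) \<in> Kbar" by (intro subfield_inverse[OF Kbar] det_in_subring[OF RC] e)
  qed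
  \<comment> \<open>The converse direction is what allows \<gamma> to act on fractions.\<close>
  have iff: "gl_at \<Psi> q = 0 \<longleftrightarrow> gl_at (\<Psi> ** \<gamma>) q = 0" if \<gamma>: "\<gamma> \<in> \<Gamma>" and q: "coeffs_in Kbar q" for \<gamma> q
  proof
    \<comment> \<open>If q vanishes at \<Psi>\<gamma>, then q(X\<gamma>) vanishes at \<Psi>.
      Stability carries this to \<Psi>\<gamma>, and so on along all positive powers of
      \<gamma>.\<close>
    have pow: "gl_at (((\<lambda>X. X ** \<gamma>) ^^ Suc k) \<Psi>) q = 0" if "coeffs_in Kbar q" "gl_at (\<Psi> ** \<gamma>) q = 0" for k q
      using that
    proof (induction k arbitrary: q)
      case (Suc k)
      obtain h where h: "coeffs_in Kbar h" "\<And>X. gl_at X h = gl_at (X ** \<gamma>) q"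
        using right_translate[OF RC \<Gamma>GL(2,4)[OF \<gamma>] Suc.prems(1)] by blast
      have "gl_at (\<Psi> ** \<gamma>) h = 0" using stable[OF \<gamma> h(1)] h(2) Suc.prems(2) by simp
      then have "gl_at (((\<lambda>X. X ** \<gamma>) ^^ Suc k) \<Psi>) h = 0" by (rule Suc.IH[OF h(1)])
      then show ?case using h(2) by simp
    qed simp
    assume "gl_at (\<Psi> ** \<gamma>) q = 0"
    then show "gl_at \<Psi> q = 0" using translation_injective[OF \<Gamma>GL(3)[OF \<gamma>]] pow[OF q] by blast
  qed (use stable \<gamma> q in blast)
  have act: "act_field Kbar \<Psi> \<gamma> (gl_at \<Psi> a / gl_at \<Psi> b) = gl_at (\<Psi> ** \<gamma>) a / gl_at (\<Psi> ** \<gamma>) b"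
    if "\<gamma> \<in> \<Gamma>" "coeffs_in Kbar a" "coeffs_in Kbar b" "gl_at \<Psi> b \<noteq> 0" for \<gamma> a b
    using act_field_eq[OF RC _ that(2-4)] iff[OF that(1)] by blast
  note CR = coord_ring_subring[OF RC, of \<Psi>]
  have Q: "is_subfield \<Lambda>tilde" "Kbar \<subseteq> \<Lambda>tilde"
    unfolding \<Lambda>tilde_def using fraction_field_subfield[OF CR] fraction_field_base[OF CR] coord_ring_base[OF RC, of \<Psi>] by auto
  have fixK: "act_field Kbar \<Psi> \<gamma> c = c" if "\<gamma> \<in> \<Gamma>" "c \<in> Kbar" for \<gamma> c
    using act[OF that(1) coeffs_in_arith(4)[OF RC that(2), of 0] coeffs_in_arith(4)[OF RC subringD(2)[OF RC], of 0]]
    by (simp only: gl_at_simps) simp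
  have main: "f \<in> Kbar" if f: "f \<in> \<Lambda>tilde" and fixed: "\<forall>\<gamma>\<in>\<Gamma>. act_field Kbar \<Psi> \<gamma> f = f" for f
  proof -
    obtain a b where ab: "coeffs_in Kbar a" "coeffs_in Kbar b" "gl_at \<Psi> b \<noteq> 0" "f = gl_at \<Psi> a / gl_at \<Psi> b"
      using f by (auto simp: \<Lambda>tilde_def fraction_field_def coord_ring_def)
    obtain A where A: "A \<in> GL_over Kbar" "gl_at A b \<noteq> 0"
      "\<And>q. coeffs_in Kbar q \<Longrightarrow> gl_at \<Psi> q = 0 \<Longrightarrow> gl_at A q = 0"
      using specialize_matrix[OF RC Kclosed PsiL(2) ab(2,3)] by blast
    have A': "A $ i $ j \<in> Kbar" "det A \<noteq> 0" "inverse (det A) \<in> Kbar" for i j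
    proof -
      show e: "A $ i $ j \<in> Kbar" "det A \<noteq> 0" for i j using GL_overD[OF A(1)] by auto
      show "inverse (det A) \<in> Kbar" by (intro subfield_inverse[OF Kbar] det_in_subring[OF RC] e)
    qed
    define B where "B = matrix_inv \<Psi> ** A"
    have PB: "\<Psi> ** B = A" by (simp add: B_def matrix_mul_assoc matrix_inv_field(1)[OF PsiL(2)])
    have B0: "det B \<noteq> 0" using A'(2) PB by (metis det_mul mult_zero_right)
    have BG: "gl_at B g = 0" if "g \<in> Gamma_ideal F K L \<Psi>" for g
      unfolding B_def
    proof (rule quotient_point[OF A'(2) _ that])
      show "gl_at A q = 0" if "coeffs_in K q" "gl_at \<Psi> q = 0" for q
        using A(3)[OF coeffs_in_mono[OF KC that(1)] that(2)] .
    qed (use FK KL in blast)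
    \<comment> \<open>Only the polynomial identity of \<open>translate\<close> is wanted, for a and
      b with coefficients in the closure of K; taking both fields to be the whole type lifts the
      restriction to K.\<close>
    interpret U: gamma_pair UNIV UNIV \<Psi>
      using UNIV_subfield PsiL(2) by unfold_locales (auto simp: GL_over_def)
    have "coeffs_in UNIV a" "coeffs_in UNIV b" by (simp_all add: coeffs_in_def)
    then obtain ha hb where h: "\<And>\<gamma>. det \<gamma> \<noteq> 0 \<Longrightarrow> gl_at \<gamma> ha = gl_at (\<Psi> ** \<gamma>) a"
      "\<And>\<gamma>. det \<gamma> \<noteq> 0 \<Longrightarrow> gl_at \<gamma> hb = gl_at (\<Psi> ** \<gamma>) b" using U.translate by metis
    define H where "H = scale (gl_at \<Psi> b) ha - scale (gl_at \<Psi> a) hb"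
    have H: "gl_at \<gamma> H = gl_at \<Psi> b * gl_at (\<Psi> ** \<gamma>) a - gl_at \<Psi> a * gl_at (\<Psi> ** \<gamma>) b" if "det \<gamma> \<noteq> 0" for \<gamma>
      using h that by (simp add: H_def gl_at_diff gl_at_scale)
    let ?I = "{h. \<forall>\<gamma>\<in>\<Gamma>. gl_at \<gamma> h = 0}"
    have "gl_at \<gamma> H = 0" if \<gamma>: "\<gamma> \<in> \<Gamma>" for \<gamma>
    proof -
      have "gl_at (\<Psi> ** \<gamma>) a / gl_at (\<Psi> ** \<gamma>) b = gl_at \<Psi> a / gl_at \<Psi> b"
        using fixed \<gamma> act[OF \<gamma> ab(1-3)] ab(4) by simp
      moreover have "gl_at (\<Psi> ** \<gamma>) b \<noteq> 0" using iff[OF \<gamma> ab(2)] ab(3) by blast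
      ultimately show ?thesis using H[OF \<Gamma>GL(3)[OF \<gamma>]] ab(3) by (simp add: frac_eq_eq mult.commute)
    qed
    then have HI: "H \<in> ?I" by simp
    have "?I \<subseteq> {h. gl_at B h = 0}"
    \<comment> \<open>The fixed field of \<sigma> is the term n = 1 of the union, so the
      coefficients obtained by this descent lie in the closure of F.\<close>
    proof (rule descent_fixed[OF UNIV_subfield, where \<sigma> = \<sigma>bar])
      show "\<sigma>bar 0 = 0" "\<sigma>bar 1 = 1" using ring_hom_onD(1,2)[OF \<sigma> UNIV_subring] by auto
      show "Poly_Mapping.map \<sigma>bar h \<in> ?I" if h: "h \<in> ?I" for h
      proof (intro CollectI ballI)
        fix \<gamma> assume \<gamma>: "\<gamma> \<in> \<Gamma>"
        have surj: "surj \<sigma>bar" using extension(1) by (simp add: field_aut_on_def bij_betw_def)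
        \<comment> \<open>\<sigma> permutes the points of \<Gamma>: the image of h takes at \<gamma>
          the value \<sigma>(h(\<delta>)), which is 0 once \<delta> is known to be a point.\<close>
        define \<delta> where "\<delta> = map_matrix (inv \<sigma>bar) \<gamma>"
        have \<delta>: "map_matrix \<sigma>bar \<delta> = \<gamma>" by (simp add: \<delta>_def vec_eq_iff surj_f_inv_f[OF surj])
        have det\<delta>: "\<sigma>bar (det \<delta>) = det \<gamma>" using det_map_matrix_hom[OF \<sigma> UNIV_subring, of \<delta>] by (simp add: \<delta>)
        have ev: "\<sigma>bar (gl_at \<delta> g) = gl_at \<gamma> (Poly_Mapping.map \<sigma>bar g)" for g
        proof -
          have "\<sigma>bar (gl_at \<delta> g) = gl_eval (\<lambda>c. \<sigma>bar c) (map_matrix \<sigma>bar \<delta>) (\<sigma>bar (inverse (det \<delta>))) g"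
            unfolding gl_at_def by (rule gl_eval_hom[OF \<sigma> UNIV_subring]) auto
          also have "\<dots> = gl_at \<gamma> (Poly_Mapping.map \<sigma>bar g)"
            using field_hom_nonzero[OF \<sigma>] ring_hom_onD(1)[OF \<sigma> UNIV_subring]
            by (simp add: gl_at_def gl_eval_map_coeffs \<delta> field_hom_inverse[OF \<sigma>] det\<delta>)
          finally show ?thesis .
        qed
        have "\<delta> \<in> \<Gamma>"
        proof -
          \<comment> \<open>\<sigma> commutes with its powers and is injective, so an entry of
            \<delta> inherits the period of the corresponding entry of \<gamma>.\<close>
          have "\<delta> $ i $ j \<in> Fbar" for i j
          proof -
            obtain n where n: "n \<ge> 1" "(\<sigma>bar ^^ n) (\<gamma> $ i $ j) = \<gamma> $ i $ j"
              using \<Gamma>GL(1)[OF \<gamma>, of i j] by (auto simp: Fbar_union Fn_def fixed_field_def)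
            have d: "\<sigma>bar (\<delta> $ i $ j) = \<gamma> $ i $ j" by (simp add: \<delta>_def surj_f_inv_f[OF surj])
            then have "\<sigma>bar ((\<sigma>bar ^^ n) (\<delta> $ i $ j)) = \<sigma>bar (\<delta> $ i $ j)" using n(2) by (metis funpow_swap1)
            then have "(\<sigma>bar ^^ n) (\<delta> $ i $ j) = \<delta> $ i $ j" using field_hom_inj[OF \<sigma>] by (metis injD)
            then show ?thesis using n(1) by (auto simp: Fbar_union Fn_def fixed_field_def)
          qed
          moreover have "det \<delta> \<noteq> 0"
            using det\<delta> \<Gamma>GL(3)[OF \<gamma>] ring_hom_onD(1)[OF \<sigma> UNIV_subring] by auto
          moreover have "gl_at \<delta> g = 0" if g: "g \<in> Gamma_ideal F K L \<Psi>" for g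
          proof -
            \<comment> \<open>The equations of \<Gamma> have coefficients in F, hence are invariant
              under \<sigma>.\<close>
            have "\<sigma>bar (Poly_Mapping.lookup g m) = Poly_Mapping.lookup g m" for m
              using g F_fix by (auto simp: Gamma_ideal_def coeffs_in_def fixed_field_def)
            then have "Poly_Mapping.map \<sigma>bar g = g"
              using ring_hom_onD(1)[OF \<sigma> UNIV_subring] by (intro poly_mapping_eqI) (simp add: lookup_map0)
            then have "\<sigma>bar (gl_at \<delta> g) = 0" using ev[of g] g \<gamma> by (simp add: \<Gamma>_def Gamma_points_def)
            then show ?thesis by (rule field_hom_nonzero[OF \<sigma>])
          qed
          ultimately show ?thesis by (auto simp: \<Gamma>_def Gamma_points_def intro: GL_overI)
        qed
        then have "gl_at \<delta> h = 0" using h by blast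
        then show "gl_at \<gamma> (Poly_Mapping.map \<sigma>bar h) = 0"
          using ev[of h] ring_hom_onD(1)[OF \<sigma> UNIV_subring] by simp
      qed
      show "h \<in> {h. gl_at B h = 0}" if h: "h \<in> ?I" "coeffs_in (fixed_field \<sigma>bar UNIV) h" for h
      proof (rule ccontr)
        assume nz: "h \<notin> {h. gl_at B h = 0}"
        have "fixed_field \<sigma>bar UNIV \<subseteq> Fbar" unfolding Fbar_union Fn_def by force
        then have hF: "coeffs_in Fbar h" using coeffs_in_mono h(2) by blast
        \<comment> \<open>Specializing B preserves the equations of \<Gamma>, whose coefficients lie
          in F, and the nonvanishing of h; the resulting point of \<Gamma> contradicts the choice of
          h.\<close>
        obtain \<gamma> where \<gamma>: "\<gamma> \<in> GL_over Fbar" "gl_at \<gamma> h \<noteq> 0"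
          "\<And>g. coeffs_in Fbar g \<Longrightarrow> gl_at B g = 0 \<Longrightarrow> gl_at \<gamma> g = 0"
          using specialize_matrix[OF Fb B0 hF] nz by blast
        have FFb: "F \<subseteq> Fbar"
          using algebraic_over_base[OF subfield_subring[OF F]] by (auto simp: Fbar_def alg_closure_in_def)
        have "gl_at \<gamma> g = 0" if "g \<in> Gamma_ideal F K L \<Psi>" for g
          using BG[OF that] \<gamma>(3)[OF coeffs_in_mono[OF FFb]] that by (auto simp: Gamma_ideal_def)
        then have "\<gamma> \<in> \<Gamma>" using \<gamma>(1) by (simp add: \<Gamma>_def Gamma_points_def)
        then show False using h(1) \<gamma>(2) by blast
      qed
    qed (auto simp: gl_at_zero gl_at_simps gl_at_diff gl_at_scale coeffs_in_def)
    then have "gl_at B H = 0" using HI by blast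
    \<comment> \<open>As \<Psi>B = A, the value H(B) is b(\<Psi>) a(A) - a(\<Psi>) b(A).\<close>
    then have "gl_at \<Psi> b * gl_at A a = gl_at \<Psi> a * gl_at A b" using H[OF B0] PB by simp
    then have "f = gl_at A a / gl_at A b" using ab(3,4) A(2) by (simp add: frac_eq_eq mult.commute)
    moreover have "gl_at A a \<in> Kbar" "gl_at A b \<in> Kbar" using ab by (auto intro: gl_at_in_subring[OF RC] A')
    ultimately show ?thesis using subfield_divide[OF Kbar] by simp
  qed
  have \<Lambda>Q: "\<Lambda> \<subseteq> \<Lambda>tilde"
    unfolding \<Lambda>_def
  proof (rule field_adjoin_least[OF Q(1)])
    show "K \<subseteq> \<Lambda>tilde" using KC Q(2) by blast
    show "mat_entries \<Psi> \<subseteq> \<Lambda>tilde"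
      using coord_ring_gens(1)[OF RC, of \<Psi>] fraction_field_base[OF CR] by (auto simp: mat_entries_def \<Lambda>tilde_def)
  qed
  \<comment> \<open>Part (b) is part (a) intersected with \<Lambda>, in which K is algebraically
    closed.\<close>
  have \<Lambda>C: "\<Lambda> \<inter> Kbar = K"
    using alg_closed_in by (auto simp: alg_closure_in_def Kbar_def)
  show ?thesis
  proof (intro conjI subset_antisym subsetI)
    fix f assume "f \<in> {f \<in> \<Lambda>. \<forall>\<gamma>\<in>\<Gamma>. act_field Kbar \<Psi> \<gamma> f = f}"
    then have "f \<in> \<Lambda>" "f \<in> Kbar" using main[of f] \<Lambda>Q by auto
    then show "f \<in> K" using \<Lambda>C by blast
  next
    fix f assume "f \<in> K"
    then have "f \<in> \<Lambda>" "f \<in> Kbar" using \<Lambda>(2) KC by auto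
    then show "f \<in> {f \<in> \<Lambda>. \<forall>\<gamma>\<in>\<Gamma>. act_field Kbar \<Psi> \<gamma> f = f}" using fixK by simp
  next
    fix f assume "f \<in> {f \<in> \<Lambda>tilde. \<forall>\<gamma>\<in>\<Gamma>. act_field Kbar \<Psi> \<gamma> f = f}"
    then show "f \<in> Kbar" using main[of f] by simp
  next
    fix f assume "f \<in> Kbar"
    then show "f \<in> {f \<in> \<Lambda>tilde. \<forall>\<gamma>\<in>\<Gamma>. act_field Kbar \<Psi> \<gamma> f = f}" using fixK Q(2) by auto
  qed
qed

end
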